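(* Let $p>1$, $s=1/p$, $f(u)=\frac{|u|^{1+p}}{1+p}$ and $\alpha\in L^\infty(0,\infty)$. There exists an initial datum $u_0\in L^\infty(\mathbb{R})$ such that the corresponding entropy solution $u$ of $$\partial_t u+\partial_x f(u)=\alpha(t)u\quad (x\in\mathbb{R},\ t>0),\qquad u(x,0)=u_0(x)\quad (x\in\mathbb{R}),$$ satisfies $$TV^{s}(u(\cdot,t))<\infty=TV^{s+\varepsilon}(u(\cdot,t))\quad\text{for all } t>0 \text{ and } \varepsilon>0.$$
   Context: For $\sigma>0$ and a function $v:\mathbb{R}\to\mathbb{R}$, the $TV^\sigma$ variation is $$TV^\sigma v=\sup\sum_{i=2}^n|v(x_i)-v(x_{i-1})|^{1/\sigma},$$ the supremum being over all $n\ge2$ and all $x_1<\dots<x_n$ in $\mathbb{R}$. For a function defined only almost everywhere, $TV^\sigma$ denotes the infimum over its representatives. "Entropy solution" means Kruzhkov entropy solution: $u\in L^\infty(\mathbb{R}\times(0,T))$ for every $T>0$, $u\in C([0,\infty);L^1_{loc}(\mathbb{R}))$, $u(\cdot,0)=u_0$, and for every $k\in\mathbb{R}$, $\partial_t|u-k|+\partial_x\big(\mathrm{sgn}(u-k)(f(u)-f(k))\big)\le \mathrm{sgn}(u-k)\,\alpha(t)u$ in the sense of distributions on $\mathbb{R}\times(0,\infty)$. *)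

theory Defs
  imports "HOL-Analysis.Analysis"
begin

definition TV_fun :: "real \<Rightarrow> (real \<Rightarrow> real) \<Rightarrow> ennreal" where
  "TV_fun \<sigma> v =
     (SUP (n, x) \<in> {(n :: nat, x :: nat \<Rightarrow> real). 2 \<le> n \<and> strict_mono_on {1..n} x}.
        ennreal (\<Sum>i = 2..n. \<bar>v (x i) - v (x (i - 1))\<bar> powr (1 / \<sigma>)))"

definition TV :: "real \<Rightarrow> (real \<Rightarrow> real) \<Rightarrow> ennreal" where
  "TV \<sigma> v = (INF w \<in> {w. AE x in lebesgue. w x = v x}. TV_fun \<sigma> w)"

definition Linfty :: "'a measure \<Rightarrow> ('a \<Rightarrow> real) \<Rightarrow> bool" where
  "Linfty M g \<longleftrightarrow> g \<in> borel_measurable M \<and> (\<exists>C. AE z in M. \<bar>g z\<bar> \<le> C)"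

primrec times_cont_diff ::
  "nat \<Rightarrow> ('a :: real_normed_vector \<Rightarrow> 'b :: real_normed_vector) \<Rightarrow> bool" where
  "times_cont_diff 0 g \<longleftrightarrow> continuous_on UNIV g"
| "times_cont_diff (Suc n) g \<longleftrightarrow>
     (\<forall>z. g differentiable (at z)) \<and>
     (\<forall>h. times_cont_diff n (\<lambda>z. frechet_derivative g (at z) h))"

definition smooth :: "('a :: real_normed_vector \<Rightarrow> 'b :: real_normed_vector) \<Rightarrow> bool" where
  "smooth g \<longleftrightarrow> (\<forall>n. times_cont_diff n g)"

text \<open>Points of the half plane are pairs (x, t), space first. A test function on the open
  half plane is represented by its extension by zero to the whole plane.\<close>

definition test_function :: "(real \<times> real \<Rightarrow> real) \<Rightarrow> bool" where
  "test_function \<phi> \<longleftrightarrow> smooth \<phi> \<and>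
     (\<exists>K. compact K \<and> K \<subseteq> UNIV \<times> {0<..} \<and> (\<forall>z. z \<notin> K \<longrightarrow> \<phi> z = 0))"

text \<open>The solution is a pointwise function, jointly measurable in (x, t), whose section at
  every single time is the value of the curve in \<open>C([0,\<infinity>); L\<^sup>1\<^sub>l\<^sub>o\<^sub>c)\<close>.
  Every such curve that is locally bounded in time has a representative of this kind.\<close>

definition entropy_solution ::
  "(real \<Rightarrow> real) \<Rightarrow> (real \<Rightarrow> real) \<Rightarrow> (real \<Rightarrow> real) \<Rightarrow> (real \<Rightarrow> real \<Rightarrow> real) \<Rightarrow> bool" where
  "entropy_solution f \<alpha> u\<^sub>0 u \<longleftrightarrow>
     (\<forall>T>0. Linfty (lebesgue_on (UNIV \<times> {0<..<T})) (\<lambda>(x, t). u x t)) \<and>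
     (\<forall>t\<ge>0. \<forall>K. compact K \<longrightarrow> (\<lambda>x. u x t) absolutely_integrable_on K) \<and>
     (\<forall>t\<ge>0. \<forall>K. compact K \<longrightarrow>
        ((\<lambda>\<tau>. LINT x:K|lebesgue. \<bar>u x \<tau> - u x t\<bar>) \<longlongrightarrow> 0) (at t within {0..})) \<and>
     (AE x in lebesgue. u x 0 = u\<^sub>0 x) \<and>
     (\<forall>k. \<forall>\<phi>. test_function \<phi> \<longrightarrow> (\<forall>z. 0 \<le> \<phi> z) \<longrightarrow>
        0 \<le> set_lebesgue_integral lebesgue (UNIV \<times> {0<..}) (\<lambda>(x, t).
               \<bar>u x t - k\<bar> * deriv (\<lambda>\<tau>. \<phi> (x, \<tau>)) t
             + sgn (u x t - k) * (f (u x t) - f k) * deriv (\<lambda>y. \<phi> (y, t)) x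
             + sgn (u x t - k) * \<alpha> t * u x t * \<phi> (x, t)))"

end

theory Submission
  imports Defs "HOL-Real_Asymp.Real_Asymp"
begin

text \<open>The datum is a sawtooth \<open>h\<close> over cells \<open>[b n, b (n + 1))\<close>: \<open>h\<close> is \<open>(x - b n)\<^sup>1\<^sup>/\<^sup>p\<close> on the left half
  of the cell and \<open>- (b (n + 1) - x)\<^sup>1\<^sup>/\<^sup>p\<close> on the right half, and it vanishes off the cells. Away from the
  midpoints, \<open>f (h)' = h / p\<close>, and the downward jumps at the midpoints are stationary entropy shocks because
  \<open>f\<close> is even. Hence \<open>u (x, t) = B (t) h (x)\<close> is an entropy solution as soon as
  \<open>B' = B (\<alpha> - B\<^sup>p / p)\<close>, \<open>B (0) = 1\<close>, and this Bernoulli equation is solved explicitly.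
  Every other entropy solution with this datum coincides with it by doubling of variables.
  At all times the profile is a positive multiple of \<open>h\<close>. The function
  \<open>sgn (h) |h|\<^sup>p\<close> is a difference of two bounded monotone functions, so \<open>TV\<^sup>1\<^sup>/\<^sup>p\<close> is finite. A jump is of order
  \<open>(b (n + 1) - b n)\<^sup>1\<^sup>/\<^sup>p\<close>, so for the larger index the variation dominates
  \<open>\<Sum>n. (b (n + 1) - b n)\<^sup>r\<close> with some \<open>r < 1\<close>; with \<open>b n = - 1 / ln (n + 2)\<close> all these series diverge
  while the cells stay in a bounded interval.\<close>

section \<open>Smooth bump functions\<close>

text \<open>The ansatz rests on homogeneity:
  \<open>flux p (B * v) = B powr (1 + p) * flux p v\<close>, so at a fixed time the level
  \<open>k\<close> turns into the stationary level \<open>k / B\<close>. The profile is dictated by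
  asking that \<open>f' (h) = sgn h * |h|^p\<close> be affine of slope one on each branch, the
  amplitude by the unknown \<open>B^(-p)\<close>, for which the Bernoulli equation is linear. The
  obstacle is that the claim concerns every entropy solution, every positive time and every
  representative. Uniqueness has to be proved with a coefficient that is only measurable, and the
  lower bound for the variation has to survive changes on null sets; it does, because a jump is
  visible from sets of positive measure on both sides. The doubling is asymmetric: the unknown
  solution is tested at positive times only, so its initial trace enters through continuity in
  \<open>L^1_loc\<close>, while the explicit solution has an inequality up to time zero. One datum
  must serve all \<epsilon> at once, which calls for gaps that are summable but lose summability
  under every power between zero and one.\<close>

primrec times_differentiable :: "nat \<Rightarrow> (real \<Rightarrow> real) \<Rightarrow> bool" where
  "times_differentiable 0 f \<longleftrightarrow> continuous_on UNIV f"
| "times_differentiable (Suc n) f \<longleftrightarrow>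
     (\<exists>f'. (\<forall>x. (f has_real_derivative f' x) (at x)) \<and> times_differentiable n f')"

lemma times_differentiable_SucD: "times_differentiable (Suc n) f \<Longrightarrow> times_differentiable n f"
proof (induction n arbitrary: f)
  case 0
  then show ?case
    by (auto simp: continuous_on_eq_continuous_at intro: DERIV_isCont)
next
  case (Suc n)
  then show ?case by (metis times_differentiable.simps(2))
qed

lemma times_differentiable_add:
  "\<lbrakk>times_differentiable n f; times_differentiable n g\<rbrakk> \<Longrightarrow> times_differentiable n (\<lambda>x. f x + g x)"
proof (induction n arbitrary: f g)
  case 0
  then show ?case by (auto intro: continuous_intros)
next
  case (Suc n)
  then obtain f' g' where "\<forall>x. (f has_real_derivative f' x) (at x)" "times_differentiable n f'"
    "\<forall>x. (g has_real_derivative g' x) (at x)" "times_differentiable n g'" by auto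
  then show ?case using Suc.IH[of f' g']
    by (auto intro!: exI[of _ "\<lambda>x. f' x + g' x"] derivative_eq_intros)
qed

lemma times_differentiable_mult:
  "\<lbrakk>times_differentiable n f; times_differentiable n g\<rbrakk> \<Longrightarrow> times_differentiable n (\<lambda>x. f x * g x)"
proof (induction n arbitrary: f g)
  case 0
  then show ?case by (auto intro: continuous_intros)
next
  case (Suc n)
  then obtain f' g' where *: "\<forall>x. (f has_real_derivative f' x) (at x)" "times_differentiable n f'"
    "\<forall>x. (g has_real_derivative g' x) (at x)" "times_differentiable n g'" by auto
  have "times_differentiable n f" "times_differentiable n g"
    using Suc.prems times_differentiable_SucD by blast+
  then have "times_differentiable n (\<lambda>x. f' x * g x + f x * g' x)"
    using * by (intro times_differentiable_add Suc.IH) auto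
  then show ?case using *(1,3)
    by (auto intro!: exI[of _ "\<lambda>x. f' x * g x + f x * g' x"] derivative_eq_intros)
qed

text \<open>The outer factor \<open>c\<close> is there for the induction: each differentiation
  multiplies it by \<open>a\<close>.\<close>

lemma times_differentiable_affine:
  "times_differentiable n f \<Longrightarrow> times_differentiable n (\<lambda>x. c * f (a * x + b))"
proof (induction n arbitrary: f c)
  case 0
  then show ?case by (auto intro!: continuous_intros continuous_on_compose2[of UNIV f])
next
  case (Suc n)
  then obtain f' where *: "\<And>x. (f has_real_derivative f' x) (at x)" "times_differentiable n f'" by auto
  have "((\<lambda>x. c * f (a * x + b)) has_real_derivative (c * a) * f' (a * x + b)) (at x)" for x
    by (auto intro!: derivative_eq_intros DERIV_chain2[of f, OF *(1)])
  moreover have "times_differentiable n (\<lambda>x. (c * a) * f' (a * x + b))"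
    by (rule Suc.IH[OF *(2)])
  ultimately show ?case unfolding times_differentiable.simps(2)
    by (intro exI[of _ "\<lambda>x. (c * a) * f' (a * x + b)"]) simp
qed

text \<open>The classical flat function \<open>exp (- 1 / x)\<close>, enlarged by polynomial factors
  in \<open>1 / x\<close>. The enlarged class is closed under differentiation, so one derivative
  formula gives smoothness of all orders.\<close>

definition poly_exp :: "real poly \<Rightarrow> real \<Rightarrow> real" where
  "poly_exp P x = (if 0 < x then poly P (1 / x) * exp (- (1 / x)) else 0)"

lemma poly_times_exp_tendsto_0:
  fixes P :: "real poly"
  shows "((\<lambda>x. poly P (1 / x) * exp (- (1 / x))) \<longlongrightarrow> 0) (at_right 0)"
proof -
  have "((\<lambda>y. poly P y * exp (- y)) \<longlongrightarrow> 0) at_top"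
  proof -
    have "((\<lambda>y. \<Sum>i\<le>degree P. coeff P i * (y ^ i / exp y)) \<longlongrightarrow> (\<Sum>i\<le>degree P. coeff P i * 0)) at_top"
      by (intro tendsto_intros tendsto_power_div_exp_0)
    then show ?thesis
      by (simp add: poly_altdef exp_minus sum_divide_distrib divide_inverse sum_distrib_right mult.assoc)
  qed
  then have "((\<lambda>x. poly P (inverse x) * exp (- inverse x)) \<longlongrightarrow> 0) (at_right 0)"
    by (rule filterlim_compose) (rule filterlim_inverse_at_top_right)
  then show ?thesis by (simp add: inverse_eq_divide)
qed

text \<open>The factor \<open>monom 1 2\<close> is the inner derivative of \<open>1 / x\<close> up
  to sign; the exponential contributes \<open>P\<close> and the polynomial contributes
  \<open>- pderiv P\<close>.\<close>

lemma poly_exp_has_derivative: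
  "(poly_exp P has_real_derivative poly_exp (monom 1 2 * (P - pderiv P)) x) (at x)"
proof -
  consider "x < 0" | "x = 0" | "0 < x" by linarith
  then show ?thesis
  proof cases
    case 1
    show ?thesis
      by (rule has_field_derivative_transform_within_open[of "\<lambda>x. 0" _ _ "{..<0}"])
        (use 1 in \<open>auto simp: poly_exp_def\<close>)
  next
    case 2
    \<comment> \<open>Dividing by \<open>h\<close> multiplies the polynomial in \<open>1 / h\<close>
      by its variable, so the difference quotient at zero is covered by the same limit.\<close>
    have "((\<lambda>h. poly_exp P h / h) \<longlongrightarrow> 0) (at_right 0)"
    proof -
      have "((\<lambda>x. poly ([:0,1:] * P) (1 / x) * exp (- (1 / x))) \<longlongrightarrow> 0) (at_right 0)"
        by (rule poly_times_exp_tendsto_0)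
      moreover have "\<forall>\<^sub>F x in at_right 0. poly ([:0,1:] * P) (1 / x) * exp (- (1 / x)) = poly_exp P x / x"
        by (auto simp: eventually_at_right_less poly_exp_def eventually_at_filter)
      ultimately show ?thesis by (rule Lim_transform_eventually)
    qed
    moreover have "((\<lambda>h. poly_exp P h / h) \<longlongrightarrow> 0) (at_left 0)"
      by (rule tendsto_eventually) (auto simp: poly_exp_def eventually_at_filter)
    ultimately have "((\<lambda>h. poly_exp P h / h) \<longlongrightarrow> 0) (at 0)"
      by (rule filterlim_split_at_real[rotated])
    then show ?thesis using 2 by (simp add: DERIV_def poly_exp_def)
  next
    case 3
    have "((\<lambda>x. poly P (1 / x) * exp (- (1 / x))) has_real_derivative
        poly (monom 1 2 * (P - pderiv P)) (1 / x) * exp (- (1 / x))) (at x)"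
      using 3
      by (auto intro!: derivative_eq_intros DERIV_chain2[OF poly_DERIV] simp: poly_monom field_simps power2_eq_square)
    then show ?thesis
      by (rule has_field_derivative_transform_within_open[of _ _ _ "{0<..}" "poly_exp P", THEN DERIV_cong])
        (use 3 in \<open>auto simp: poly_exp_def\<close>)
  qed
qed

lemma times_differentiable_poly_exp: "times_differentiable n (poly_exp P)"
proof (induction n arbitrary: P)
  case 0
  show ?case
    using poly_exp_has_derivative by (auto simp: continuous_on_eq_continuous_at intro: DERIV_isCont)
next
  case (Suc n)
  then show ?case using poly_exp_has_derivative by auto
qed

section \<open>Tensor products as smooth functions on the plane\<close>

lemma times_cont_diff_add:
  "\<lbrakk>times_cont_diff n f; times_cont_diff n g\<rbrakk> \<Longrightarrow> times_cont_diff n (\<lambda>z. f z + g z)"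
proof (induction n arbitrary: f g)
  case 0
  then show ?case by (auto intro: continuous_intros)
next
  case (Suc n)
  have "frechet_derivative (\<lambda>z. f z + g z) (at z) =
      (\<lambda>h. frechet_derivative f (at z) h + frechet_derivative g (at z) h)" for z
    using Suc.prems by (intro frechet_derivative_at[symmetric] has_derivative_add)
      (auto simp: frechet_derivative_works)
  then show ?case using Suc by auto
qed

lemma times_cont_diff_scale:
  fixes f :: "'a::real_normed_vector \<Rightarrow> real"
  shows "times_cont_diff n f \<Longrightarrow> times_cont_diff n (\<lambda>z. c * f z)"
proof (induction n arbitrary: f)
  case 0
  then show ?case by (auto intro: continuous_intros)
next
  case (Suc n)
  have "frechet_derivative (\<lambda>z. c * f z) (at z) =
      (\<lambda>h. c * frechet_derivative f (at z) h)" for z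
    using Suc.prems by (intro frechet_derivative_at[symmetric] has_derivative_mult_right)
      (auto simp: frechet_derivative_works)
  then show ?case using Suc by auto
qed

text \<open>In direction \<open>h\<close> the derivative of a tensor product is a combination of two
  tensor products with constant coefficients \<open>fst h\<close> and \<open>snd h\<close>, so the
  induction stays inside this class. The one-variable predicate has its derivative under an
  existential quantifier, which keeps Frechet derivatives out of the hypotheses.\<close>

lemma times_cont_diff_product:
  "\<lbrakk>times_differentiable n f; times_differentiable n g\<rbrakk>
    \<Longrightarrow> times_cont_diff n (\<lambda>z::real \<times> real. f (fst z) * g (snd z))"
proof (induction n arbitrary: f g)
  case 0
  then show ?case
    by (auto intro!: continuous_intros continuous_on_compose2[of UNIV f] continuous_on_compose2[of UNIV g])
next
  case (Suc n)
  then obtain f' g' where *: "\<And>x. (f has_real_derivative f' x) (at x)" "times_differentiable n f'"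
    "\<And>x. (g has_real_derivative g' x) (at x)" "times_differentiable n g'" by auto
  have nn: "times_differentiable n f" "times_differentiable n g"
    using Suc.prems times_differentiable_SucD by blast+
  have f: "((\<lambda>z::real \<times> real. f (fst z)) has_derivative (\<lambda>h. f' (fst z) * fst h)) (at z)" for z
    using has_derivative_compose[OF has_derivative_fst[OF has_derivative_ident[of "at z"]]
        *(1)[unfolded has_field_derivative_def, of "fst z"]] by simp
  have g: "((\<lambda>z::real \<times> real. g (snd z)) has_derivative (\<lambda>h. g' (snd z) * snd h)) (at z)" for z
    using has_derivative_compose[OF has_derivative_snd[OF has_derivative_ident[of "at z"]]
        *(3)[unfolded has_field_derivative_def, of "snd z"]] by simp
  have D: "((\<lambda>z::real \<times> real. f (fst z) * g (snd z)) has_derivative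
     (\<lambda>h. fst h * (f' (fst z) * g (snd z)) + snd h * (f (fst z) * g' (snd z)))) (at z)" for z
    using has_derivative_mult[OF f g, of z] by (simp add: algebra_simps)
  then have "frechet_derivative (\<lambda>z::real \<times> real. f (fst z) * g (snd z)) (at z) =
     (\<lambda>h. fst h * (f' (fst z) * g (snd z)) + snd h * (f (fst z) * g' (snd z)))" for z
    by (rule frechet_derivative_at[symmetric])
  moreover have "times_cont_diff n (\<lambda>z. fst h * (f' (fst z) * g (snd z)) + snd h * (f (fst z) * g' (snd z)))"
    for h :: "real \<times> real"
    using nn * by (intro times_cont_diff_add times_cont_diff_scale Suc.IH)
  moreover have "(\<lambda>z::real \<times> real. f (fst z) * g (snd z)) differentiable (at z)" for z
    using D unfolding differentiable_def by blast
  ultimately show ?case unfolding times_cont_diff.simps(2) by presburger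
qed

text \<open>The support lies strictly to the right of zero. In a kernel
  \<open>\<eta> (t - s)\<close> the time \<open>t\<close> is then later than \<open>s\<close>, and
  this asymmetry is what the doubling exploits at the initial time.\<close>

definition bump :: "real \<Rightarrow> (real \<Rightarrow> real) \<Rightarrow> (real \<Rightarrow> real) \<Rightarrow> bool" where
  "bump \<delta> \<eta> \<eta>' \<longleftrightarrow> (\<forall>n. times_differentiable n \<eta>) \<and> (\<forall>x. (\<eta> has_real_derivative \<eta>' x) (at x)) \<and>
     continuous_on UNIV \<eta>' \<and> (\<forall>x. 0 \<le> \<eta> x) \<and> (\<forall>x. x \<notin> {0<..<\<delta>} \<longrightarrow> \<eta> x = 0 \<and> \<eta>' x = 0) \<and>
     has_bochner_integral lborel \<eta> 1"

lemma ex_bump: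
  assumes "0 < \<delta>"
  shows "\<exists>\<eta> \<eta>'. bump \<delta> \<eta> \<eta>'"
proof -
  define \<beta> where "\<beta> x = poly_exp 1 x * poly_exp 1 (\<delta> - x)" for x
  have td: "times_differentiable n \<beta>" for n
    unfolding \<beta>_def
    using times_differentiable_affine[OF times_differentiable_poly_exp, where c=1 and a="-1" and b=\<delta>, of n 1]
    by (intro times_differentiable_mult times_differentiable_poly_exp) simp
  have cont: "continuous_on UNIV \<beta>" using td[of 0] by simp
  have nn: "0 \<le> \<beta> x" for x by (auto simp: \<beta>_def poly_exp_def)
  have pos: "0 < \<beta> x" if "x \<in> {0<..<\<delta>}" for x using that by (auto simp: \<beta>_def poly_exp_def)
  have zero: "\<beta> x = 0" if "x \<notin> {0<..<\<delta>}" for x using that by (auto simp: \<beta>_def poly_exp_def)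
  define c where "c = integral\<^sup>L lborel \<beta>"
  have int: "integrable lborel \<beta>"
  proof -
    have "integrable lborel (\<lambda>x. indicator {0..\<delta>} x *\<^sub>R \<beta> x)"
      using borel_integrable_compact[of "{0..\<delta>}" \<beta>] cont continuous_on_subset by blast
    moreover have "(\<lambda>x. indicator {0..\<delta>} x *\<^sub>R \<beta> x) = \<beta>"
    proof
      show "indicator {0..\<delta>} x *\<^sub>R \<beta> x = \<beta> x" for x
        using zero[of x] by (cases "x \<in> {0..\<delta>}") auto
    qed
    ultimately show ?thesis by simp
  qed
  have "c \<noteq> 0"
  proof
    assume "c = 0"
    then have "AE x in lborel. \<beta> x = 0"
      unfolding c_def by (subst (asm) integral_nonneg_eq_0_iff_AE[OF int]) (simp_all add: nn)
    then have "AE x in lborel. x \<notin> {0<..<\<delta>}"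
      by (rule eventually_mono) (use pos in force)
    then have "emeasure lborel {0<..<\<delta>} = 0"
      by (subst (asm) AE_iff_measurable[of "{0<..<\<delta>}"]) auto
    then show False using assms by simp
  qed
  moreover have "0 \<le> c" unfolding c_def using nn by (intro Bochner_Integration.integral_nonneg) simp
  ultimately have c: "0 < c" by simp
  define \<eta> where "\<eta> x = (1 / c) * \<beta> x" for x
  have td': "times_differentiable n \<eta>" for n
    unfolding \<eta>_def using times_differentiable_affine[OF td, where c="1/c" and a=1 and b=0] by simp
  then obtain \<eta>' where \<eta>': "\<And>x. (\<eta> has_real_derivative \<eta>' x) (at x)" "continuous_on UNIV \<eta>'"
    using td'[of "Suc 0"] unfolding times_differentiable.simps by blast
  have zero': "\<eta> x = 0" if "x \<notin> {0<..<\<delta>}" for x using zero[OF that] by (simp add: \<eta>_def)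
  have min: "0 \<le> \<eta> x" for x using c nn by (auto simp: \<eta>_def)
  \<comment> \<open>Off the open interval \<open>\<eta>\<close> attains its minimum zero, so its
    derivative vanishes there, end points included.\<close>
  have "\<eta>' x = 0" if "x \<notin> {0<..<\<delta>}" for x
    using DERIV_local_min[OF \<eta>'(1)[of x], of 1] zero'[OF that] min by auto
  moreover have "has_bochner_integral lborel \<eta> 1"
    unfolding \<eta>_def using c int c_def
    by (auto simp: has_bochner_integral_iff)
  ultimately show ?thesis
    unfolding bump_def using td' \<eta>' zero' min by (intro exI[of _ \<eta>] exI[of _ \<eta>'] conjI allI impI) simp_all
qed

lemma bump_product_test_function:
  assumes "bump \<delta> \<eta> \<eta>'" "0 < s"
  shows "test_function (\<lambda>(x, t). \<eta> (x - y) * \<eta> (t - s))"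
proof -
  have "times_differentiable n (\<lambda>x. \<eta> (x - c))" for n c
    using assms(1) times_differentiable_affine[of n \<eta> 1 1 "-c"] by (auto simp: bump_def)
  then have "smooth (\<lambda>z::real \<times> real. \<eta> (fst z - y) * \<eta> (snd z - s))"
    unfolding smooth_def by (auto intro: times_cont_diff_product)
  moreover have "compact (cbox (y, s) (y + \<delta>, s + \<delta>))" by simp
  moreover have "cbox (y, s) (y + \<delta>, s + \<delta>) \<subseteq> UNIV \<times> {0<..}"
    using assms(2) by (auto simp: cbox_Pair_eq)
  moreover have "\<eta> (fst z - y) * \<eta> (snd z - s) = 0" if "z \<notin> cbox (y, s) (y + \<delta>, s + \<delta>)" for z
  proof -
    have "fst z - y \<notin> {0<..<\<delta>} \<or> snd z - s \<notin> {0<..<\<delta>}"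
      using that by (cases z) (auto simp: cbox_Pair_eq)
    then show ?thesis using assms(1) by (auto simp: bump_def)
  qed
  ultimately show ?thesis
    unfolding test_function_def case_prod_unfold by blast
qed

section \<open>Continuity of translations in the mean\<close>

lemma integral_translate:
  fixes f :: "'a::euclidean_space \<Rightarrow> real"
  assumes "f \<in> borel_measurable borel"
  shows "(LBINT x. f (x + c)) = (LBINT x. f x)"
proof -
  have "(LBINT x. f x) = (\<integral>x. f x \<partial>distr lborel borel ((+) c))"
    by (simp only: lborel_distr_plus)
  also have "\<dots> = (LBINT x. f (c + x))"
    using assms by (subst integral_distr) auto
  finally show ?thesis by (simp add: add.commute)
qed

lemma integrable_translate:
  fixes f :: "'a::euclidean_space \<Rightarrow> real"
  assumes "f \<in> borel_measurable borel"
  shows "integrable lborel (\<lambda>x. f (x + c)) \<longleftrightarrow> integrable lborel f"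
proof -
  have "integrable lborel f \<longleftrightarrow> integrable (distr lborel borel ((+) c)) f"
    by (simp only: lborel_distr_plus)
  also have "\<dots> \<longleftrightarrow> integrable lborel (\<lambda>x. f (c + x))"
    using assms by (subst integrable_distr_eq) auto
  finally show ?thesis by (simp add: add.commute)
qed

text \<open>The predicate \<open>measurable_on\<close> supplies continuous functions converging off
  a negligible set. Cutting them off at height \<open>M\<close> leaves the limit unchanged and
  provides the uniform bound for dominated convergence.\<close>

lemma bounded_borel_continuous_approx:
  fixes a :: "'a::euclidean_space \<Rightarrow> real"
  assumes "a \<in> borel_measurable borel" and M: "\<And>x. \<bar>a x\<bar> \<le> M"
  obtains b where "\<And>n::nat. continuous_on UNIV (b n)" "\<And>n x. \<bar>b n x\<bar> \<le> M"
    "AE x in lborel. (\<lambda>n. b n x) \<longlonglongrightarrow> a x"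
proof -
  have "a \<in> borel_measurable lebesgue"
    using assms(1) by (simp add: borel_measurable_if measurable_completion)
  then have "a measurable_on UNIV"
    by (intro lebesgue_measurable_imp_measurable_on_real) auto
  then obtain N g where N: "negligible N" and g: "\<And>n. continuous_on UNIV (g n)"
    "\<And>x. x \<notin> N \<Longrightarrow> (\<lambda>n. g n x) \<longlonglongrightarrow> a x"
    unfolding measurable_on_def by auto
  define b where "b n x = max (- M) (min M (g n x))" for n x
  have "AE x in lebesgue. x \<notin> N"
    using N by (simp add: negligible_iff_null_sets AE_not_in)
  then have "AE x in lborel. x \<notin> N" by (simp add: AE_completion_iff)
  then have "AE x in lborel. (\<lambda>n. b n x) \<longlonglongrightarrow> a x"
  proof (rule eventually_mono)
    fix x assume "x \<notin> N"
    from tendsto_max[OF tendsto_const tendsto_min[OF tendsto_const g(2)[OF this]]]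
    have "(\<lambda>n. b n x) \<longlonglongrightarrow> max (- M) (min M (a x))" unfolding b_def .
    then show "(\<lambda>n. b n x) \<longlonglongrightarrow> a x" using M[of x] by (simp add: max_def min_def abs_le_iff split: if_splits)
  qed
  moreover have "0 \<le> M" using M[of undefined] by linarith
  ultimately show ?thesis using g(1)
    by (intro that[of b]) (auto simp: b_def intro!: continuous_intros)
qed

lemma integrable_bounded_mult:
  fixes f g :: "'a \<Rightarrow> real"
  assumes "integrable M g" "f \<in> borel_measurable M" "\<And>x. x \<in> space M \<Longrightarrow> \<bar>f x\<bar> \<le> C"
  shows "integrable M (\<lambda>x. f x * g x)"
proof (rule Bochner_Integration.integrable_bound[where f = "\<lambda>x. C * g x"])
  show "integrable M (\<lambda>x. C * g x)" using assms(1) by simp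
  show "(\<lambda>x. f x * g x) \<in> borel_measurable M" using assms(1,2) by measurable
  show "AE x in M. norm (f x * g x) \<le> norm (C * g x)"
    using order_trans[OF assms(3) abs_ge_self] by (intro AE_I2) (auto simp: abs_mult intro!: mult_right_mono)
qed

text \<open>A bounded function need not be integrable, hence the weight \<open>G\<close>. For
  continuous bounded functions the claim is dominated convergence; in general \<open>a\<close> is
  approximated in the mean with respect to \<open>G\<close>. The error at the shifted point carries
  the unshifted weight, and \<open>Gc\<close> trades it for the shifted one, after which translation
  invariance applies.\<close>

lemma translation_continuity:
  fixes a G :: "'a::euclidean_space \<Rightarrow> real"
  assumes a[measurable]: "a \<in> borel_measurable borel" and M: "\<And>x. \<bar>a x\<bar> \<le> M"
    and G: "integrable lborel G" "\<And>x. 0 \<le> G x"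
    and Gc: "\<And>x z. norm z \<le> 1 \<Longrightarrow> G x \<le> c * G (x + z)"
    and "0 < \<epsilon>"
  obtains \<delta> where "0 < \<delta>" "\<delta> \<le> 1" "\<And>z. norm z \<le> \<delta> \<Longrightarrow> (LBINT x. \<bar>a (x + z) - a x\<bar> * G x) \<le> \<epsilon>"
proof -
  have Gm[measurable]: "G \<in> borel_measurable borel" using G(1) by auto
  obtain b where b: "\<And>n::nat. continuous_on UNIV (b n)" "\<And>n x. \<bar>b n x\<bar> \<le> M"
    "AE x in lborel. (\<lambda>n. b n x) \<longlonglongrightarrow> a x"
    using bounded_borel_continuous_approx[OF a M] by metis
  have bm[measurable]: "b n \<in> borel_measurable borel" for n
    using b(1) by (rule borel_measurable_continuous_onI)
  have M2: "\<bar>b n x - a y\<bar> \<le> 2 * M" "\<bar>b n x - b n y\<bar> \<le> 2 * M" "\<bar>a x - a y\<bar> \<le> 2 * M" for n x y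
    using b(2)[of n x] b(2)[of n y] M[of y] M[of x] by linarith+
  \<comment> \<open>The sign of \<open>c\<close> can be read off only where \<open>G\<close> is
    positive; \<open>d\<close> below is its nonnegative version.\<close>
  have c: "0 \<le> c \<or> G = (\<lambda>_. 0)"
  proof (rule disjCI)
    assume "G \<noteq> (\<lambda>_. 0)"
    then obtain x where "G x \<noteq> 0" by auto
    then have "0 < G x" using G(2)[of x] by linarith
    then show "0 \<le> c" using Gc[of 0 x] by (auto simp: mult_le_cancel_right1)
  qed
  define d where "d = max c 0"
  have Gd: "G x \<le> d * G (x + z)" if "norm z \<le> 1" for x z
    using c Gc[OF that, of x] by (auto simp: d_def max_def)
  have d: "0 \<le> d" by (simp add: d_def)
  have lim: "(\<lambda>n. LBINT x. \<bar>b n x - a x\<bar> * G x) \<longlonglongrightarrow> (\<integral>x. 0 \<partial>(lborel::'a measure))"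
  proof (rule integral_dominated_convergence[where w = "\<lambda>x. 2 * M * G x"])
    show "AE x in lborel. (\<lambda>n. \<bar>b n x - a x\<bar> * G x) \<longlonglongrightarrow> 0"
      using b(3)
    proof eventually_elim
      case (elim x)
      then have "(\<lambda>n. \<bar>b n x - a x\<bar> * G x) \<longlonglongrightarrow> \<bar>a x - a x\<bar> * G x" by (intro tendsto_intros)
      then show ?case by simp
    qed
    show "AE x in lborel. norm (\<bar>b n x - a x\<bar> * G x) \<le> 2 * M * G x" for n
      using M2 G(2) by (auto simp: abs_mult intro!: mult_right_mono)
  qed (use G in auto)
  \<comment> \<open>The approximation error enters \<open>d + 1\<close> times: \<open>d\<close>
    times through the shifted point and once at \<open>x\<close>.\<close>
  have "0 < \<epsilon> / (2 * (d + 1))" using \<open>0 < \<epsilon>\<close> d by simp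
  with lim obtain n where n: "(LBINT x. \<bar>b n x - a x\<bar> * G x) < \<epsilon> / (2 * (d + 1))"
    by (force dest!: order_tendstoD(2) simp: eventually_sequentially)
  have bint: "integrable lborel (\<lambda>x. \<bar>b n x - a x\<bar> * G x)"
    by (rule integrable_bounded_mult[OF G(1), where C = "2 * M"]) (use M2 in auto)
  \<comment> \<open>Dominated convergence is about sequences, so a failure of uniformity is turned
    into a sequence of shifts tending to zero.\<close>
  have "\<exists>\<delta>>0. \<forall>z. norm z \<le> \<delta> \<longrightarrow> (LBINT x. \<bar>b n (x + z) - b n x\<bar> * G x) \<le> \<epsilon> / 2"
  proof (rule ccontr)
    assume "\<not> ?thesis"
    then have "\<exists>z. norm z \<le> 1 / Suc k \<and> \<epsilon> / 2 < (LBINT x. \<bar>b n (x + z) - b n x\<bar> * G x)" for k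
      by (force simp: not_le dest!: spec[of _ "1 / Suc k"])
    then obtain z where z: "\<And>k. norm (z k) \<le> 1 / Suc k"
      "\<And>k. \<epsilon> / 2 < (LBINT x. \<bar>b n (x + z k) - b n x\<bar> * G x)" by metis
    have z0: "z \<longlonglongrightarrow> 0"
      by (rule Lim_null_comparison[OF always_eventually])
        (use z(1) LIMSEQ_inverse_real_of_nat in \<open>auto simp: inverse_eq_divide\<close>)
    have "(\<lambda>k. LBINT x. \<bar>b n (x + z k) - b n x\<bar> * G x) \<longlonglongrightarrow> (\<integral>x. 0 \<partial>(lborel::'a measure))"
    proof (rule integral_dominated_convergence[where w = "\<lambda>x. 2 * M * G x"])
      show "AE x in lborel. (\<lambda>k. \<bar>b n (x + z k) - b n x\<bar> * G x) \<longlonglongrightarrow> 0"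
      proof (rule AE_I2)
        fix x
        have "isCont (b n) x" using b(1) by (simp add: continuous_on_eq_continuous_at)
        moreover have "(\<lambda>k. x + z k) \<longlonglongrightarrow> x" using tendsto_add[OF tendsto_const z0, of x] by simp
        ultimately have "(\<lambda>k. b n (x + z k)) \<longlonglongrightarrow> b n x" by (rule isCont_tendsto_compose)
        then have "(\<lambda>k. \<bar>b n (x + z k) - b n x\<bar> * G x) \<longlonglongrightarrow> \<bar>b n x - b n x\<bar> * G x"
          by (intro tendsto_intros)
        then show "(\<lambda>k. \<bar>b n (x + z k) - b n x\<bar> * G x) \<longlonglongrightarrow> 0" by simp
      qed
      show "AE x in lborel. norm (\<bar>b n (x + z k) - b n x\<bar> * G x) \<le> 2 * M * G x" for k
        using M2 G(2) by (auto simp: abs_mult intro!: mult_right_mono)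
    qed (use G in auto)
    then have "eventually (\<lambda>k. (LBINT x. \<bar>b n (x + z k) - b n x\<bar> * G x) < \<epsilon> / 2) sequentially"
      using \<open>0 < \<epsilon>\<close> by (intro order_tendstoD(2)) auto
    then show False using z(2) by (auto simp: eventually_sequentially less_not_sym)
  qed
  then obtain \<delta> where \<delta>: "0 < \<delta>"
    "\<And>z. norm z \<le> \<delta> \<Longrightarrow> (LBINT x. \<bar>b n (x + z) - b n x\<bar> * G x) \<le> \<epsilon> / 2" by auto
  show thesis
  proof (rule that[of "min \<delta> 1"])
    fix z :: 'a assume z: "norm z \<le> min \<delta> 1"
    have i1: "integrable lborel (\<lambda>x. \<bar>b n (x + z) - a (x + z)\<bar> * G (x + z))"
      using integrable_translate[of "\<lambda>x. \<bar>b n x - a x\<bar> * G x" z] bint by simp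
    have i2: "integrable lborel (\<lambda>x. \<bar>b n (x + z) - b n x\<bar> * G x)"
      by (rule integrable_bounded_mult[OF G(1), where C = "2 * M"]) (use M2 in auto)
    have i3: "integrable lborel (\<lambda>x. \<bar>a (x + z) - a x\<bar> * G x)"
      by (rule integrable_bounded_mult[OF G(1), where C = "2 * M"]) (use M2 in auto)
    have "(LBINT x. \<bar>a (x + z) - a x\<bar> * G x) \<le>
      (LBINT x. d * (\<bar>b n (x + z) - a (x + z)\<bar> * G (x + z)) + \<bar>b n (x + z) - b n x\<bar> * G x + \<bar>b n x - a x\<bar> * G x)"
    proof (rule integral_mono)
      fix x
      have "\<bar>a (x + z) - a x\<bar> * G x \<le> (\<bar>b n (x + z) - a (x + z)\<bar> + \<bar>b n (x + z) - b n x\<bar> + \<bar>b n x - a x\<bar>) * G x"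
        by (intro mult_right_mono G(2)) linarith
      also have "\<dots> = \<bar>b n (x + z) - a (x + z)\<bar> * G x + \<bar>b n (x + z) - b n x\<bar> * G x + \<bar>b n x - a x\<bar> * G x"
        by (simp add: algebra_simps)
      also have "\<bar>b n (x + z) - a (x + z)\<bar> * G x \<le> \<bar>b n (x + z) - a (x + z)\<bar> * (d * G (x + z))"
        using Gd[of z x] z by (intro mult_left_mono) auto
      finally show "\<bar>a (x + z) - a x\<bar> * G x \<le>
         d * (\<bar>b n (x + z) - a (x + z)\<bar> * G (x + z)) + \<bar>b n (x + z) - b n x\<bar> * G x + \<bar>b n x - a x\<bar> * G x"
        by (simp add: algebra_simps)
    qed (use i1 i2 i3 bint in auto)
    also have "\<dots> = d * (LBINT x. \<bar>b n (x + z) - a (x + z)\<bar> * G (x + z))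
        + (LBINT x. \<bar>b n (x + z) - b n x\<bar> * G x) + (LBINT x. \<bar>b n x - a x\<bar> * G x)"
      using i1 i2 bint by simp
    also have "(LBINT x. \<bar>b n (x + z) - a (x + z)\<bar> * G (x + z)) = (LBINT x. \<bar>b n x - a x\<bar> * G x)"
      by (rule integral_translate) measurable
    also have "(LBINT x. \<bar>b n (x + z) - b n x\<bar> * G x) \<le> \<epsilon> / 2" using \<delta>(2) z by simp
    also have "d * (LBINT x. \<bar>b n x - a x\<bar> * G x) + \<epsilon> / 2 + (LBINT x. \<bar>b n x - a x\<bar> * G x)
       = (d + 1) * (LBINT x. \<bar>b n x - a x\<bar> * G x) + \<epsilon> / 2"
      by (simp add: algebra_simps)
    also have "\<dots> \<le> (d + 1) * (\<epsilon> / (2 * (d + 1))) + \<epsilon> / 2"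
      using n d by (intro add_right_mono mult_left_mono) auto
    also have "\<dots> = \<epsilon>" using d by (simp add: field_simps)
    finally show "(LBINT x. \<bar>a (x + z) - a x\<bar> * G x) \<le> \<epsilon>" by simp
  qed (use \<delta> in auto)
qed

section \<open>Mollifying kernels on the doubled space\<close>

lemma integrable_convolution_kernel:
  fixes \<kappa> \<gamma> :: "'a::euclidean_space \<Rightarrow> real"
  assumes "integrable lborel \<kappa>" "integrable lborel \<gamma>"
  shows "integrable (lborel \<Otimes>\<^sub>M lborel) (\<lambda>(x, y). \<kappa> (x - y) * \<gamma> y)"
proof -
  have [measurable]: "\<kappa> \<in> borel_measurable borel" "\<gamma> \<in> borel_measurable borel"
    using assms by auto
  have *: "integrable lborel (\<lambda>x. \<kappa> (x - y) * \<gamma> y)" for y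
    using assms integrable_translate[of \<kappa> "-y"] by simp
  have "integrable (lborel \<Otimes>\<^sub>M lborel) (\<lambda>(y, x). \<kappa> (x - y) * \<gamma> y)"
  proof (rule lborel_pair.Fubini_integrable)
    have "(LBINT x. norm (case (y, x) of (y, x) \<Rightarrow> \<kappa> (x - y) * \<gamma> y)) = (LBINT x. \<bar>\<kappa> x\<bar>) * \<bar>\<gamma> y\<bar>" for y
      using integral_translate[of "\<lambda>x. \<bar>\<kappa> x\<bar>" "-y"] by (simp add: abs_mult)
    then show "integrable lborel (\<lambda>y. LBINT x. norm (case (y, x) of (y, x) \<Rightarrow> \<kappa> (x - y) * \<gamma> y))"
      using assms by simp
    show "AE y in lborel. integrable lborel (\<lambda>x. case (y, x) of (y, x) \<Rightarrow> \<kappa> (x - y) * \<gamma> y)"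
      using * by simp
  qed measurable
  then show ?thesis
    by (subst lborel_pair.integrable_product_swap_iff[symmetric]) simp
qed

text \<open>Substituting \<open>x = y + z\<close> turns the double integral into an average over
  \<open>z\<close>, with density \<open>\<kappa>\<close> of mass one, of translation errors that are
  all at most \<epsilon> on the support of \<open>\<kappa>\<close>.\<close>

lemma integral_convolution_kernel_le:
  fixes a \<kappa> \<gamma> :: "'a::euclidean_space \<Rightarrow> real"
  assumes a[measurable]: "a \<in> borel_measurable borel" and M: "\<And>x. \<bar>a x\<bar> \<le> M"
    and \<kappa>: "has_bochner_integral lborel \<kappa> 1" "\<And>z. 0 \<le> \<kappa> z" "\<And>z. \<delta> < norm z \<Longrightarrow> \<kappa> z = 0"
    and \<gamma>: "integrable lborel \<gamma>" "\<And>x. 0 \<le> \<gamma> x"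
    and le: "\<And>z. norm z \<le> \<delta> \<Longrightarrow> (LBINT x. \<bar>a (x + z) - a x\<bar> * \<gamma> x) \<le> \<epsilon>"
  shows "(\<integral>(x, y). \<kappa> (x - y) * \<gamma> y * \<bar>a x - a y\<bar> \<partial>(lborel \<Otimes>\<^sub>M lborel)) \<le> \<epsilon>"
proof -
  have \<kappa>i: "integrable lborel \<kappa>" "integral\<^sup>L lborel \<kappa> = 1" using \<kappa>(1) by (auto simp: has_bochner_integral_iff)
  have [measurable]: "\<kappa> \<in> borel_measurable borel" "\<gamma> \<in> borel_measurable borel"
    using \<kappa>i \<gamma> by auto
  have M2: "\<bar>a x - a y\<bar> \<le> 2 * M" for x y using M[of x] M[of y] by linarith
  have "integrable (lborel \<Otimes>\<^sub>M lborel) (\<lambda>p. \<bar>a (fst p) - a (snd p)\<bar> * (case p of (x, y) \<Rightarrow> \<kappa> (x - y) * \<gamma> y))"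
    by (rule integrable_bounded_mult[OF integrable_convolution_kernel[OF \<kappa>i(1) \<gamma>(1)], where C="2*M"])
      (use M2 in \<open>auto, measurable\<close>)
  then have int: "integrable (lborel \<Otimes>\<^sub>M lborel) (\<lambda>(x, y). \<kappa> (x - y) * \<gamma> y * \<bar>a x - a y\<bar>)"
    by (simp add: case_prod_unfold mult_ac)
  have "integrable (lborel \<Otimes>\<^sub>M lborel) (\<lambda>p. \<bar>a (fst p + snd p) - a (snd p)\<bar> * (\<kappa> (fst p) * \<gamma> (snd p)))"
  proof (rule integrable_bounded_mult[where C="2*M"])
    show "integrable (lborel \<Otimes>\<^sub>M lborel) (\<lambda>p. \<kappa> (fst p) * \<gamma> (snd p))"
      by (rule lborel_pair.Fubini_integrable) (use \<kappa>i \<gamma> in \<open>auto simp: abs_mult\<close>)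
  qed (use M2 in \<open>auto, measurable\<close>)
  then have int2: "integrable (lborel \<Otimes>\<^sub>M lborel) (\<lambda>(z, y). \<kappa> z * (\<bar>a (y + z) - a y\<bar> * \<gamma> y))"
    by (simp add: case_prod_unfold mult_ac add.commute)
  have "(\<integral>(x, y). \<kappa> (x - y) * \<gamma> y * \<bar>a x - a y\<bar> \<partial>(lborel \<Otimes>\<^sub>M lborel))
      = (LBINT y. LBINT x. \<kappa> (x - y) * \<gamma> y * \<bar>a x - a y\<bar>)"
    using lborel_pair.integral_snd[OF int] by simp
  also have "\<dots> = (LBINT y. LBINT z. \<kappa> z * (\<bar>a (y + z) - a y\<bar> * \<gamma> y))"
  proof (rule Bochner_Integration.integral_cong[OF refl])
    fix y
    show "(LBINT x. \<kappa> (x - y) * \<gamma> y * \<bar>a x - a y\<bar>) = (LBINT z. \<kappa> z * (\<bar>a (y + z) - a y\<bar> * \<gamma> y))"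
      using integral_translate[of "\<lambda>x. \<kappa> (x - y) * \<gamma> y * \<bar>a x - a y\<bar>" y]
      by (auto simp: mult_ac add.commute)
  qed
  also have "\<dots> = (LBINT z. \<kappa> z * (LBINT y. \<bar>a (y + z) - a y\<bar> * \<gamma> y))"
    using lborel_pair.Fubini_integral[OF int2] by simp
  also have "\<dots> \<le> (LBINT z. \<kappa> z * \<epsilon>)"
  proof (rule integral_mono)
    show "integrable lborel (\<lambda>z. \<kappa> z * (LBINT y. \<bar>a (y + z) - a y\<bar> * \<gamma> y))"
      using lborel_pair.integrable_fst[OF int2] by simp
    show "\<kappa> z * (LBINT y. \<bar>a (y + z) - a y\<bar> * \<gamma> y) \<le> \<kappa> z * \<epsilon>" for z
      using le[of z] \<kappa>(2,3)[of z] by (cases "norm z \<le> \<delta>") (auto intro: mult_left_mono)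
  qed (use \<kappa>i in auto)
  also have "\<dots> = \<epsilon>" using \<kappa>i by simp
  finally show ?thesis .
qed

section \<open>The flux and its Kruzhkov entropy flux\<close>

definition flux :: "real \<Rightarrow> real \<Rightarrow> real" where
  "flux p v = \<bar>v\<bar> powr (1 + p) / (1 + p)"

definition eflux :: "real \<Rightarrow> real \<Rightarrow> real \<Rightarrow> real" where
  "eflux p u k = sgn (u - k) * (flux p u - flux p k)"

lemma continuous_on_flux: "0 < p \<Longrightarrow> continuous_on A (flux p)"
  unfolding flux_def by (intro continuous_intros continuous_on_powr') auto

lemma borel_measurable_flux[measurable (raw)]:
  "f \<in> borel_measurable M \<Longrightarrow> (\<lambda>x. flux p (f x)) \<in> borel_measurable M"
  unfolding flux_def by (intro borel_measurable_divide powr_real_measurable borel_measurable_abs) auto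

lemma borel_measurable_sgn_real[measurable]: "sgn \<in> borel_measurable (borel :: real measure)"
proof -
  have "sgn = (\<lambda>x::real. if x < 0 then - 1 else if x = 0 then 0 else 1)" by (auto simp: sgn_if)
  then show ?thesis by simp
qed

lemma borel_measurable_eflux[measurable (raw)]:
  "\<lbrakk>f \<in> borel_measurable M; g \<in> borel_measurable M\<rbrakk> \<Longrightarrow> (\<lambda>x. eflux p (f x) (g x)) \<in> borel_measurable M"
  unfolding eflux_def
  by (intro borel_measurable_times borel_measurable_diff borel_measurable_flux
      measurable_compose[OF _ borel_measurable_sgn_real]) auto

lemma flux_minus[simp]: "flux p (- v) = flux p v" by (simp add: flux_def)
lemma flux_0[simp]: "flux p 0 = 0" by (simp add: flux_def)

lemma flux_mono: "\<lbrakk>0 < p; \<bar>u\<bar> \<le> \<bar>k\<bar>\<rbrakk> \<Longrightarrow> flux p u \<le> flux p k"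
  unfolding flux_def by (intro divide_right_mono powr_mono2) auto

lemma flux_scale: "0 \<le> B \<Longrightarrow> flux p (B * v) = B powr (1 + p) * flux p v"
  by (simp add: flux_def abs_mult powr_mult)

lemma eflux_commute: "eflux p u k = eflux p k u"
  by (auto simp: eflux_def sgn_if)

lemma abs_eflux: "\<bar>eflux p u k\<bar> = \<bar>flux p u - flux p k\<bar>"
  by (auto simp: eflux_def sgn_if)

lemma eflux_scale: "0 < B \<Longrightarrow> eflux p (B * u) (B * k) = B powr (1 + p) * eflux p u k"
  by (simp add: eflux_def flux_scale sgn_mult flip: right_diff_distrib)

lemma eflux_eq: "eflux p u k = flux p (max u k) - flux p (min u k)"
  by (auto simp: eflux_def sgn_if max_def min_def)

lemma continuous_on_eflux: "\<lbrakk>0 < p; continuous_on A h\<rbrakk> \<Longrightarrow> continuous_on A (\<lambda>x. eflux p (h x) k)"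
  unfolding eflux_eq
  by (intro continuous_intros continuous_on_compose2[OF continuous_on_flux[of p UNIV]]) auto

text \<open>This is the entropy condition for a stationary shock falling from \<open>a\<close> to
  \<open>- a\<close>. Evenness gives both states the same flux, so only the sign factors differ:
  they agree for \<open>k\<close> beyond both states, and for \<open>k\<close> between them the two
  values are opposite, the one at \<open>a\<close> being nonnegative.\<close>

lemma eflux_antisym_le:
  assumes "0 < p" "0 \<le> a" shows "eflux p (- a) k \<le> eflux p a k"
  using flux_mono[OF assms(1), of a k] flux_mono[OF assms(1), of k a] assms(2)
  by (auto simp: eflux_def sgn_if)

lemma flux_has_derivative:
  assumes "0 < p" "0 < z"
  shows "(flux p has_real_derivative z powr p) (at z)"
proof -
  have "((\<lambda>v. v powr (1 + p) / (1 + p)) has_real_derivative z powr p) (at z)"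
    using assms by (auto intro!: derivative_eq_intros)
  then show ?thesis
    by (rule has_field_derivative_transform_within_open[of _ _ _ "{0<..}"])
      (use assms in \<open>auto simp: flux_def\<close>)
qed

text \<open>By evenness only nonnegative arguments matter, and there the derivative
  \<open>z powr p\<close> is at most \<open>M powr p\<close>.\<close>

lemma flux_lipschitz:
  assumes p: "0 < p" and "\<bar>u\<bar> \<le> M" "\<bar>k\<bar> \<le> M"
  shows "\<bar>flux p u - flux p k\<bar> \<le> M powr p * \<bar>u - k\<bar>"
proof -
  have *: "flux p y - flux p x \<le> M powr p * (y - x)" if "0 \<le> x" "x \<le> y" "y \<le> M" for x y
  proof (cases "x = y")
    case False
    then have "x < y" using that by simp
    have "\<exists>l z. x < z \<and> z < y \<and> (flux p has_real_derivative l) (at z) \<and> flux p y - flux p x = (y - x) * l"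
    proof (rule MVT[OF \<open>x < y\<close>])
      show "continuous_on {x..y} (flux p)" by (rule continuous_on_flux[OF p])
      show "flux p differentiable at z" if "x < z" "z < y" for z
        using flux_has_derivative[OF p, of z] that \<open>0 \<le> x\<close> by (auto simp: real_differentiable_def)
    qed
    then obtain l z where z: "x < z" "z < y" "(flux p has_real_derivative l) (at z)"
      "flux p y - flux p x = (y - x) * l" by auto
    moreover have "l = z powr p"
      using z flux_has_derivative[OF p, of z] \<open>0 \<le> x\<close> DERIV_unique by force
    moreover have "z powr p \<le> M powr p" using z that p by (intro powr_mono2) auto
    ultimately show ?thesis using that by (simp add: mult.commute mult_left_mono)
  qed auto
  have "flux p u = flux p \<bar>u\<bar>" "flux p k = flux p \<bar>k\<bar>" by (auto simp: flux_def)
  moreover have "\<bar>flux p \<bar>u\<bar> - flux p \<bar>k\<bar>\<bar> \<le> M powr p * \<bar>\<bar>u\<bar> - \<bar>k\<bar>\<bar>"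
    using *[of "\<bar>u\<bar>" "\<bar>k\<bar>"] *[of "\<bar>k\<bar>" "\<bar>u\<bar>"] flux_mono[OF p, of u k] flux_mono[OF p, of k u] assms
    by (cases "\<bar>u\<bar> \<le> \<bar>k\<bar>") (auto simp: \<open>flux p u = flux p \<bar>u\<bar>\<close>[symmetric] \<open>flux p k = flux p \<bar>k\<bar>\<close>[symmetric] abs_if[of "\<bar>u\<bar> - \<bar>k\<bar>"] abs_if[of "flux p u - flux p k"])
  moreover have "M powr p * \<bar>\<bar>u\<bar> - \<bar>k\<bar>\<bar> \<le> M powr p * \<bar>u - k\<bar>" by (intro mult_left_mono) auto
  ultimately show ?thesis by simp
qed

text \<open>Off the level set of \<open>\<kappa>\<close> the sign factor is locally constant, so the
  entropy flux is locally the flux up to a sign and a constant.\<close>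

lemma eflux_has_derivative:
  assumes F: "((\<lambda>x. flux p (H x)) has_real_derivative D) (at x)"
    and H: "isCont H x" and "H x \<noteq> \<kappa>"
  shows "((\<lambda>x. eflux p (H x) \<kappa>) has_real_derivative sgn (H x - \<kappa>) * D) (at x)"
proof -
  have "((\<lambda>y. sgn (H x - \<kappa>) * (flux p (H y) - flux p \<kappa>)) has_real_derivative sgn (H x - \<kappa>) * D) (at x)"
    by (auto intro!: derivative_eq_intros F)
  moreover have "\<forall>\<^sub>F y in nhds x. sgn (H x - \<kappa>) * (flux p (H y) - flux p \<kappa>) = eflux p (H y) \<kappa>"
  proof (cases "H x < \<kappa>")
    case True
    have "\<forall>\<^sub>F y in nhds x. H y < \<kappa>"
      using H True unfolding isCont_def tendsto_at_iff_tendsto_nhds by (rule order_tendstoD)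
    then show ?thesis by (rule eventually_mono) (use True in \<open>simp add: eflux_def\<close>)
  next
    case False
    then have "\<kappa> < H x" using assms(3) by simp
    have "\<forall>\<^sub>F y in nhds x. \<kappa> < H y"
      using H \<open>\<kappa> < H x\<close> unfolding isCont_def tendsto_at_iff_tendsto_nhds by (rule order_tendstoD)
    then show ?thesis by (rule eventually_mono) (use \<open>\<kappa> < H x\<close> in \<open>simp add: eflux_def\<close>)
  qed
  ultimately show ?thesis
    by (subst (asm) DERIV_cong_ev[OF refl _ refl])
qed

text \<open>The integrand is the derivative of \<open>eflux p (H x) \<kappa> * \<psi> x\<close>
  except where \<open>H\<close> meets the level \<open>\<kappa>\<close>. Injectivity leaves at most
  one such point, and the primitive is continuous across it, so the fundamental theorem still
  applies.\<close>

lemma half_tooth_has_integral: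
  fixes H \<psi> \<psi>' :: "real \<Rightarrow> real"
  assumes p: "0 < p" and "a \<le> c" and H: "continuous_on {a..c} H" "inj_on H {a<..<c}"
    and F: "\<And>x. a < x \<Longrightarrow> x < c \<Longrightarrow> ((\<lambda>x. flux p (H x)) has_real_derivative H x / p) (at x)"
    and \<psi>: "\<And>x. (\<psi> has_real_derivative \<psi>' x) (at x)"
  shows "((\<lambda>x. eflux p (H x) \<kappa> * \<psi>' x + sgn (H x - \<kappa>) * (H x / p) * \<psi> x) has_integral
     eflux p (H c) \<kappa> * \<psi> c - eflux p (H a) \<kappa> * \<psi> a) {a..c}"
proof (rule fundamental_theorem_of_calculus_interior_strong[where S = "{x. a < x \<and> x < c \<and> H x = \<kappa>}"])
  have "\<exists>z. {x. a < x \<and> x < c \<and> H x = \<kappa>} \<subseteq> {z}"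
  proof (cases "{x. a < x \<and> x < c \<and> H x = \<kappa>} = {}")
    case False
    then obtain z where "a < z" "z < c" "H z = \<kappa>" by blast
    have "x = z" if "a < x" "x < c" "H x = \<kappa>" for x
      by (rule inj_onD[OF H(2)]) (use that \<open>a < z\<close> \<open>z < c\<close> \<open>H z = \<kappa>\<close> in simp_all)
    then have "{x. a < x \<and> x < c \<and> H x = \<kappa>} \<subseteq> {z}" by blast
    then show ?thesis by blast
  qed blast
  then show "finite {x. a < x \<and> x < c \<and> H x = \<kappa>}" using finite_subset by blast
  have "continuous_on {a..c} \<psi>"
    using \<psi> by (intro DERIV_atLeastAtMost_imp_continuous_on) blast
  then show "continuous_on {a..c} (\<lambda>x. eflux p (H x) \<kappa> * \<psi> x)"
    by (intro continuous_intros continuous_on_eflux H p)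
  fix x assume x: "x \<in> {a<..<c} - {x. a < x \<and> x < c \<and> H x = \<kappa>}"
  have "isCont H x" using H(1) x by (intro continuous_on_interior[of "{a..c}"]) auto
  then have "((\<lambda>x. eflux p (H x) \<kappa>) has_real_derivative sgn (H x - \<kappa>) * (H x / p)) (at x)"
    using F x by (intro eflux_has_derivative) auto
  from DERIV_mult[OF this \<psi>[of x]]
  show "((\<lambda>x. eflux p (H x) \<kappa> * \<psi> x) has_vector_derivative
      eflux p (H x) \<kappa> * \<psi>' x + sgn (H x - \<kappa>) * (H x / p) * \<psi> x) (at x)"
    by (simp add: has_real_derivative_iff_has_vector_derivative[symmetric] algebra_simps)
qed (use assms in auto)

text \<open>In terms of the speed \<open>sgn v * |v|^p\<close> the two branches read
  \<open>x - l\<close> and \<open>x - r\<close>, both of slope one. At the midpoint the one-sided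
  values are opposite, which makes the jump there stationary.\<close>

definition tooth :: "real \<Rightarrow> real \<Rightarrow> real \<Rightarrow> real \<Rightarrow> real" where
  "tooth p l r x = (if l \<le> x \<and> x < (l + r) / 2 then (x - l) powr (1 / p)
     else if (l + r) / 2 \<le> x \<and> x < r then - ((r - x) powr (1 / p)) else 0)"

text \<open>The tooth vanishes at both ends, so the subtracted constant removes both end terms. What
  remains is the difference of the entropy fluxes on the two sides of the midpoint, times the value
  of \<open>\<psi>\<close> there.\<close>

lemma tooth_has_integral:
  assumes p: "0 < p" and "l < r"
    and \<psi>: "\<And>x. (\<psi> has_real_derivative \<psi>' x) (at x)" and nn: "\<And>x. 0 \<le> \<psi> x"
  obtains I where "0 \<le> I"
    "((\<lambda>x. (eflux p (tooth p l r x) \<kappa> - eflux p 0 \<kappa>) * \<psi>' x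
       + sgn (tooth p l r x - \<kappa>) * (tooth p l r x / p) * \<psi> x) has_integral I) {l..r}"
proof -
  define m where "m = (l + r) / 2"
  have m: "l < m" "m < r" using \<open>l < r\<close> by (auto simp: m_def field_simps)
  define H1 where "H1 x = (x - l) powr (1 / p)" for x
  define H2 where "H2 x = - ((r - x) powr (1 / p))" for x
  define g where "g H x = (eflux p (H x) \<kappa> - eflux p 0 \<kappa>) * \<psi>' x + sgn (H x - \<kappa>) * (H x / p) * \<psi> x" for H x
  have \<psi>int: "((\<lambda>x. eflux p 0 \<kappa> * \<psi>' x) has_integral eflux p 0 \<kappa> * \<psi> c - eflux p 0 \<kappa> * \<psi> a) {a..c}"
    if "a \<le> c" for a c
  proof -
    have "((\<lambda>x. eflux p 0 \<kappa> * \<psi> x) has_real_derivative eflux p 0 \<kappa> * \<psi>' x) (at x)" for x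
      using DERIV_cmult[OF \<psi>] .
    then show ?thesis using that
      by (intro fundamental_theorem_of_calculus)
        (auto simp: has_real_derivative_iff_has_vector_derivative[symmetric] intro: has_field_derivative_at_within)
  qed
  have 1: "((\<lambda>x. eflux p (H1 x) \<kappa> * \<psi>' x + sgn (H1 x - \<kappa>) * (H1 x / p) * \<psi> x) has_integral
     eflux p (H1 m) \<kappa> * \<psi> m - eflux p (H1 l) \<kappa> * \<psi> l) {l..m}"
  proof (rule half_tooth_has_integral[OF p])
    show "continuous_on {l..m} H1" unfolding H1_def
      using p by (intro continuous_on_powr' continuous_intros) auto
    show "inj_on H1 {l<..<m}"
    proof (rule inj_on_inverseI[where g = "\<lambda>y. l + \<bar>y\<bar> powr p"])
      show "l + \<bar>H1 x\<bar> powr p = x" if "x \<in> {l<..<m}" for x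
        using that p m by (simp add: H1_def powr_powr)
    qed
    fix x assume x: "l < x" "x < m"
    have "((\<lambda>x. (x - l) powr ((1 + p) / p) / (1 + p)) has_real_derivative H1 x / p) (at x)"
    proof -
      have "(1 + p) / p - 1 = 1 / p" using p by (simp add: field_simps)
      moreover have "((\<lambda>x. (x - l) powr ((1 + p) / p) / (1 + p)) has_real_derivative
          (1 + p) / p * (x - l) powr ((1 + p) / p - 1) * 1 / (1 + p)) (at x)"
        using x m by (auto intro!: derivative_eq_intros)
      moreover have "(1 + p) / p * A * 1 / (1 + p) = A / p" for A
        using p by (simp add: divide_simps)
      ultimately show ?thesis by (simp add: H1_def)
    qed
    then show "((\<lambda>x. flux p (H1 x)) has_real_derivative H1 x / p) (at x)"
      by (rule has_field_derivative_transform_within_open[of _ _ _ "{l<..<m}"])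
        (use x p in \<open>auto simp: flux_def H1_def powr_powr field_simps\<close>)
  qed (use m \<psi> in auto)
  have 2: "((\<lambda>x. eflux p (H2 x) \<kappa> * \<psi>' x + sgn (H2 x - \<kappa>) * (H2 x / p) * \<psi> x) has_integral
     eflux p (H2 r) \<kappa> * \<psi> r - eflux p (H2 m) \<kappa> * \<psi> m) {m..r}"
  proof (rule half_tooth_has_integral[OF p])
    show "continuous_on {m..r} H2" unfolding H2_def
      using p by (intro continuous_on_powr' continuous_intros) auto
    show "inj_on H2 {m<..<r}"
    proof (rule inj_on_inverseI[where g = "\<lambda>y. r - \<bar>y\<bar> powr p"])
      show "r - \<bar>H2 x\<bar> powr p = x" if "x \<in> {m<..<r}" for x
        using that p m by (simp add: H2_def powr_powr)
    qed
    fix x assume x: "m < x" "x < r"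
    have "((\<lambda>x. (r - x) powr ((1 + p) / p) / (1 + p)) has_real_derivative H2 x / p) (at x)"
    proof -
      have "(1 + p) / p - 1 = 1 / p" using p by (simp add: field_simps)
      moreover have "((\<lambda>x. (r - x) powr ((1 + p) / p) / (1 + p)) has_real_derivative
          (1 + p) / p * (r - x) powr ((1 + p) / p - 1) * -1 / (1 + p)) (at x)"
        using x m by (auto intro!: derivative_eq_intros)
      moreover have "(1 + p) / p * A * -1 / (1 + p) = -A / p" for A
        using p by (simp add: divide_simps)
      ultimately show ?thesis by (simp add: H2_def)
    qed
    then show "((\<lambda>x. flux p (H2 x)) has_real_derivative H2 x / p) (at x)"
      by (rule has_field_derivative_transform_within_open[of _ _ _ "{m<..<r}"])
        (use x p in \<open>auto simp: flux_def H2_def powr_powr field_simps\<close>)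
  qed (use m \<psi> in auto)
  have H0: "H1 l = 0" "H2 r = 0" "H2 m = - H1 m" "0 \<le> H1 m"
    by (auto simp: H1_def H2_def m_def field_simps)
  have 3: "(g (tooth p l r) has_integral (eflux p (H1 m) \<kappa> - eflux p 0 \<kappa>) * \<psi> m) {l..m}"
  proof (rule has_integral_spike_finite[of "{m}" _ _ "g H1"])
    show "g (tooth p l r) x = g H1 x" if "x \<in> {l..m} - {m}" for x
      using that by (auto simp: g_def tooth_def H1_def m_def)
    show "(g H1 has_integral (eflux p (H1 m) \<kappa> - eflux p 0 \<kappa>) * \<psi> m) {l..m}"
      using has_integral_diff[OF 1 \<psi>int[of l m]] m unfolding g_def H0 by (simp add: algebra_simps)
  qed auto
  have 4: "(g (tooth p l r) has_integral - ((eflux p (- H1 m) \<kappa> - eflux p 0 \<kappa>) * \<psi> m)) {m..r}"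
  proof (rule has_integral_spike_finite[of "{r}" _ _ "g H2"])
    show "g (tooth p l r) x = g H2 x" if "x \<in> {m..r} - {r}" for x
      using that by (auto simp: g_def tooth_def H2_def m_def)
    show "(g H2 has_integral - ((eflux p (- H1 m) \<kappa> - eflux p 0 \<kappa>) * \<psi> m)) {m..r}"
      using has_integral_diff[OF 2 \<psi>int[of m r]] m unfolding g_def H0 by (simp add: algebra_simps)
  qed auto
  have "(g (tooth p l r) has_integral (eflux p (H1 m) \<kappa> - eflux p (- H1 m) \<kappa>) * \<psi> m) {l..r}"
    using has_integral_combine[OF _ _ 3 4] m by (simp add: algebra_simps)
  moreover have "0 \<le> (eflux p (H1 m) \<kappa> - eflux p (- H1 m) \<kappa>) * \<psi> m"
    using eflux_antisym_le[OF p H0(4), of \<kappa>] nn by simp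
  ultimately show ?thesis using that unfolding g_def by blast
qed

section \<open>The stationary sawtooth profile\<close>

lemma tooth_outside: "x \<notin> {l..<r} \<Longrightarrow> tooth p l r x = 0"
  by (auto simp: tooth_def field_simps)

lemma abs_tooth_le:
  assumes "0 < p" "l \<le> r" shows "\<bar>tooth p l r x\<bar> \<le> (r - l) powr (1 / p)"
  using assms by (auto simp: tooth_def intro!: powr_mono2)

text \<open>For increasing nodes at most one summand is nonzero at a given point. Writing the
  profile as a series makes its measurability immediate.\<close>

definition sawtooth :: "real \<Rightarrow> (nat \<Rightarrow> real) \<Rightarrow> real \<Rightarrow> real" where
  "sawtooth p b x = (\<Sum>n. tooth p (b n) (b (Suc n)) x)"

lemma cell_unique:
  fixes b :: "nat \<Rightarrow> real"
  assumes "strict_mono b" "x \<in> {b n..<b (Suc n)}" "x \<in> {b m..<b (Suc m)}"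
  shows "m = n"
proof -
  have "b n < b (Suc m)" "b m < b (Suc n)" using assms(2,3) by auto
  then have "n < Suc m" "m < Suc n" using assms(1) by (auto simp: strict_mono_less)
  then show ?thesis by simp
qed

lemma sawtooth_cell:
  assumes "strict_mono b" "x \<in> {b n..<b (Suc n)}"
  shows "sawtooth p b x = tooth p (b n) (b (Suc n)) x"
proof -
  have "tooth p (b m) (b (Suc m)) x = 0" if "m \<noteq> n" for m
    using cell_unique[OF assms, of m] that by (intro tooth_outside) blast
  then have "(\<Sum>m. tooth p (b m) (b (Suc m)) x) = (\<Sum>m\<in>{n}. tooth p (b m) (b (Suc m)) x)"
    by (intro suminf_finite) auto
  then show ?thesis by (simp add: sawtooth_def)
qed

lemma sawtooth_no_cell:
  assumes "\<And>n. x \<notin> {b n..<b (Suc n)}"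
  shows "sawtooth p b x = 0"
  unfolding sawtooth_def using tooth_outside[OF assms] by simp

lemma ex_cell:
  fixes b :: "nat \<Rightarrow> real"
  assumes "b \<longlonglongrightarrow> L" "b 0 \<le> x" "x < L"
  shows "\<exists>n. x \<in> {b n..<b (Suc n)}"
proof -
  have "\<exists>n. x < b n"
    using order_tendstoD(1)[OF assms(1,3)] by (auto simp: eventually_sequentially)
  \<comment> \<open>The least index beyond \<open>x\<close> is positive because \<open>b 0\<close>
    is not beyond \<open>x\<close>; its predecessor labels the cell.\<close>
  then have "x < b (LEAST n. x < b n)" by (rule LeastI_ex)
  moreover have "(LEAST n. x < b n) \<noteq> 0" using calculation assms(2) by (metis linorder_not_le)
  then obtain k where k: "(LEAST n. x < b n) = Suc k" by (metis not0_implies_Suc)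
  moreover have "\<not> x < b k" using k by (metis lessI not_less_Least)
  ultimately show ?thesis by (auto intro!: exI[of _ k])
qed

lemma strict_mono_less_limit:
  fixes b :: "nat \<Rightarrow> real"
  assumes "strict_mono b" "b \<longlonglongrightarrow> L" shows "b n < L"
proof -
  have "b n < b (Suc n)" using assms(1) by (simp add: strict_mono_Suc_iff)
  also have "\<dots> \<le> L" using assms by (intro incseq_le) (auto simp: strict_mono_mono)
  finally show ?thesis .
qed

lemma sawtooth_outside:
  assumes "strict_mono b" "b \<longlonglongrightarrow> L" "x \<notin> {b 0..<L}"
  shows "sawtooth p b x = 0"
proof (rule sawtooth_no_cell)
  fix n
  have "b 0 \<le> b n" using assms(1) by (simp add: strict_mono_less_eq)
  then show "x \<notin> {b n..<b (Suc n)}"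
    using assms(3) strict_mono_less_limit[OF assms(1,2), of "Suc n"] by auto
qed

lemma abs_sawtooth_le:
  assumes "0 < p" "strict_mono b" "b \<longlonglongrightarrow> L"
  shows "\<bar>sawtooth p b x\<bar> \<le> (L - b 0) powr (1 / p)"
proof (cases "\<exists>n. x \<in> {b n..<b (Suc n)}")
  case True
  then obtain n where n: "x \<in> {b n..<b (Suc n)}" by blast
  have 1: "b 0 \<le> b n" "b n \<le> b (Suc n)" using assms(2) by (auto simp: strict_mono_less_eq)
  have "\<bar>sawtooth p b x\<bar> \<le> (b (Suc n) - b n) powr (1 / p)"
    using sawtooth_cell[OF assms(2) n] abs_tooth_le[OF assms(1) 1(2)] by simp
  also have "\<dots> \<le> (L - b 0) powr (1 / p)"
    using 1 strict_mono_less_limit[OF assms(2,3), of "Suc n"] assms(1) by (intro powr_mono2) auto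
  finally show ?thesis .
next
  case False
  then show ?thesis using sawtooth_no_cell[of x b p] by simp
qed

lemma borel_measurable_sawtooth[measurable]: "sawtooth p b \<in> borel_measurable borel"
proof -
  have "tooth p l r \<in> borel_measurable borel" for l r
    unfolding tooth_def by measurable
  then show ?thesis unfolding sawtooth_def by measurable
qed

lemma integrable_continuous_compact_support:
  fixes g :: "real \<Rightarrow> real"
  assumes "continuous_on UNIV g" "\<And>x. R < \<bar>x\<bar> \<Longrightarrow> g x = 0"
  shows "integrable lborel g"
proof -
  have "integrable lborel (\<lambda>x. indicator {-R..R} x *\<^sub>R g x)"
    using borel_integrable_compact[of "{-R..R}" g] assms(1) continuous_on_subset by blast
  moreover have "(\<lambda>x. indicator {-R..R} x *\<^sub>R g x) = g"
  proof
    show "indicator {-R..R} x *\<^sub>R g x = g x" for x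
      using assms(2)[of x] by (cases "x \<in> {-R..R}") auto
  qed
  ultimately show ?thesis by simp
qed

lemma integral_derivative_compact_support:
  fixes \<psi> \<psi>' :: "real \<Rightarrow> real"
  assumes \<psi>: "\<And>x. (\<psi> has_real_derivative \<psi>' x) (at x)" "continuous_on UNIV \<psi>'"
    and supp: "\<And>x. R < \<bar>x\<bar> \<Longrightarrow> \<psi> x = 0" "\<And>x. R < \<bar>x\<bar> \<Longrightarrow> \<psi>' x = 0"
  shows "integral\<^sup>L lborel \<psi>' = 0"
proof -
  \<comment> \<open>The absolute value and the margin put both end points outside the support and in
    the right order for every sign of \<open>R\<close>.\<close>
  define R' where "R' = \<bar>R\<bar> + 1"
  have i: "integrable lborel \<psi>'" using integrable_continuous_compact_support[OF \<psi>(2) supp(2)] .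
  have "(\<psi>' has_integral \<psi> R' - \<psi> (- R')) {- R'..R'}"
    using \<psi>(1) by (intro fundamental_theorem_of_calculus)
      (auto simp: R'_def has_real_derivative_iff_has_vector_derivative[symmetric] intro: has_field_derivative_at_within)
  moreover have "\<psi> R' = 0" "\<psi> (- R') = 0" by (auto intro!: supp simp: R'_def)
  ultimately have "(\<psi>' has_integral 0) {- R'..R'}" by simp
  then have "((\<lambda>x. if x \<in> {- R'..R'} then \<psi>' x else 0) has_integral 0) UNIV"
    by (simp only: has_integral_restrict_UNIV)
  moreover have "(\<lambda>x. if x \<in> {- R'..R'} then \<psi>' x else 0) = \<psi>'"
    by (rule ext) (use supp(2) in \<open>auto simp: R'_def abs_if split: if_splits\<close>)
  ultimately have "(\<psi>' has_integral 0) UNIV" by simp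
  moreover have "(\<psi>' has_integral integral\<^sup>L lborel \<psi>') UNIV"
    using i by (rule has_integral_integral_lborel)
  ultimately show ?thesis using has_integral_unique by blast
qed

text \<open>Subtracting the constant \<open>eflux p 0 \<kappa>\<close> makes the entropy flux vanish off the cells, so that the claim
  reduces to single cells, where the shock at the midpoint contributes with the right sign.\<close>

lemma sawtooth_stationary:
  assumes p: "0 < p" and b: "strict_mono b" "b \<longlonglongrightarrow> L"
    and \<psi>: "\<And>x. (\<psi> has_real_derivative \<psi>' x) (at x)" "continuous_on UNIV \<psi>'" "\<And>x. 0 \<le> \<psi> x"
    and supp: "\<And>x. R < \<bar>x\<bar> \<Longrightarrow> \<psi> x = 0" "\<And>x. R < \<bar>x\<bar> \<Longrightarrow> \<psi>' x = 0"
  shows "0 \<le> (LBINT x. eflux p (sawtooth p b x) \<kappa> * \<psi>' x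
            + sgn (sawtooth p b x - \<kappa>) * (sawtooth p b x / p) * \<psi> x)"
proof -
  define h where "h = sawtooth p b"
  define M where "M = (L - b 0) powr (1 / p)"
  have hM: "\<bar>h x\<bar> \<le> M" for x unfolding h_def M_def by (rule abs_sawtooth_le[OF p b])
  have M0: "0 \<le> M" by (simp add: M_def)
  have [measurable]: "h \<in> borel_measurable borel" by (simp add: h_def)
  have \<psi>c: "continuous_on UNIV \<psi>" using \<psi>(1) by (auto simp: continuous_on_eq_continuous_at intro: DERIV_isCont)
  have \<psi>i: "integrable lborel \<psi>'" "integrable lborel \<psi>"
    using integrable_continuous_compact_support[OF \<psi>(2) supp(2)]
      integrable_continuous_compact_support[OF \<psi>c supp(1)] by auto
  define q0 where "q0 = eflux p 0 \<kappa>"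
  define g where "g x = (eflux p (h x) \<kappa> - q0) * \<psi>' x + sgn (h x - \<kappa>) * (h x / p) * \<psi> x" for x
  have gi: "integrable lborel g"
    unfolding g_def
  proof (intro Bochner_Integration.integrable_add integrable_bounded_mult \<psi>i)
    fix x
    have "\<bar>eflux p (h x) \<kappa>\<bar> \<le> flux p M + \<bar>flux p \<kappa>\<bar>"
      using flux_mono[OF p, of "h x" M] hM[of x] M0 by (simp add: abs_eflux) (smt (verit) flux_def divide_nonneg_nonneg p powr_ge_zero)
    then show "\<bar>eflux p (h x) \<kappa> - q0\<bar> \<le> flux p M + \<bar>flux p \<kappa>\<bar> + \<bar>q0\<bar>" by linarith
    show "\<bar>sgn (h x - \<kappa>) * (h x / p)\<bar> \<le> M / p"
      using hM[of x] p M0 by (auto simp: abs_mult sgn_if intro!: divide_right_mono)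
  qed measurable
  have cell: "\<exists>I\<ge>0. (g has_integral I) {b n..b (Suc n)}" for n
  proof -
    have "b n < b (Suc n)" using b(1) by (simp add: strict_mono_Suc_iff)
    then obtain I where I: "0 \<le> I"
      "((\<lambda>x. (eflux p (tooth p (b n) (b (Suc n)) x) \<kappa> - eflux p 0 \<kappa>) * \<psi>' x
       + sgn (tooth p (b n) (b (Suc n)) x - \<kappa>) * (tooth p (b n) (b (Suc n)) x / p) * \<psi> x) has_integral I) {b n..b (Suc n)}"
      using tooth_has_integral[where \<kappa>=\<kappa>, OF p _ \<psi>(1,3)] by blast
    have "(g has_integral I) {b n..b (Suc n)}"
      by (rule has_integral_spike_finite[OF _ _ I(2), of "{b (Suc n)}"])
        (auto simp: g_def h_def q0_def sawtooth_cell[OF b(1), of _ n])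
    then show ?thesis using I(1) by blast
  qed
  have "\<exists>I\<ge>0. (g has_integral I) {b 0..b n}" for n
  proof (induction n)
    case 0
    show ?case by (intro exI[of _ 0]) (simp add: has_integral_refl)
  next
    case (Suc n)
    then obtain I J where "0 \<le> I" "(g has_integral I) {b 0..b n}" "0 \<le> J" "(g has_integral J) {b n..b (Suc n)}"
      using cell[of n] by blast
    moreover have "b 0 \<le> b n" "b n \<le> b (Suc n)" using b(1) by (auto simp: strict_mono_less_eq)
    ultimately have "(g has_integral I + J) {b 0..b (Suc n)}" by (metis has_integral_combine)
    then show ?case using \<open>0 \<le> I\<close> \<open>0 \<le> J\<close> by (intro exI[of _ "I + J"]) simp
  qed
  then have pos: "0 \<le> (LBINT x. indicator {b 0..b n} x *\<^sub>R g x)" for n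
  proof -
    have "set_integrable lborel {b 0..b n} g"
      unfolding set_integrable_def using gi by (intro integrable_mult_indicator) auto
    from set_borel_integral_eq_integral(2)[OF this]
    have "(LBINT x. indicator {b 0..b n} x *\<^sub>R g x) = integral {b 0..b n} g"
      by (simp add: set_lebesgue_integral_def)
    moreover obtain I where "I \<ge> 0" "(g has_integral I) {b 0..b n}"
      using \<open>\<exists>I\<ge>0. (g has_integral I) {b 0..b n}\<close> by blast
    ultimately show ?thesis by (simp add: integral_unique)
  qed
  \<comment> \<open>The cells accumulate at \<open>L\<close>, so finitely many never exhaust them.
    Each point left of \<open>L\<close> is eventually covered, and outside \<open>[b 0, L)\<close>
    the choice of \<open>q0\<close> makes \<open>g\<close> vanish.\<close>
  have "(\<lambda>n. LBINT x. indicator {b 0..b n} x *\<^sub>R g x) \<longlonglongrightarrow> (LBINT x. g x)"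
  proof (rule integral_dominated_convergence[where w = "\<lambda>x. \<bar>g x\<bar>"])
    show "AE x in lborel. (\<lambda>n. indicator {b 0..b n} x *\<^sub>R g x) \<longlonglongrightarrow> g x"
    proof (rule AE_I2)
      fix x
      show "(\<lambda>n. indicator {b 0..b n} x *\<^sub>R g x) \<longlonglongrightarrow> g x"
      proof (cases "x \<in> {b 0..<L}")
        case True
        have "\<forall>\<^sub>F n in sequentially. x < b n" using True by (intro order_tendstoD(1)[OF b(2)]) simp
        then have "\<forall>\<^sub>F n in sequentially. indicator {b 0..b n} x *\<^sub>R g x = g x"
          by (rule eventually_mono) (use True in auto)
        then show ?thesis by (rule tendsto_eventually)
      next
        case False
        then have "g x = 0"
          using sawtooth_outside[OF b False] by (simp add: g_def h_def q0_def)
        then show ?thesis by simp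
      qed
    qed
    show "AE x in lborel. norm (indicator {b 0..b n} x *\<^sub>R g x) \<le> \<bar>g x\<bar>" for n
      by (auto simp: indicator_def)
  qed (use gi in auto)
  from LIMSEQ_le_const[OF this, of 0] pos have "0 \<le> (LBINT x. g x)" by auto
  \<comment> \<open>A derivative with compact support has integral zero, so the constant
    \<open>q0\<close> can be put back for free.\<close>
  also have "\<dots> = (LBINT x. g x) + q0 * (LBINT x. \<psi>' x)"
    using integral_derivative_compact_support[OF \<psi>(1,2) supp] by simp
  also have "\<dots> = (LBINT x. g x + q0 * \<psi>' x)" using gi \<psi>i by simp
  also have "\<dots> = (LBINT x. eflux p (h x) \<kappa> * \<psi>' x + sgn (h x - \<kappa>) * (h x / p) * \<psi> x)"
    by (intro Bochner_Integration.integral_cong) (auto simp: g_def algebra_simps)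
  finally show ?thesis unfolding h_def .
qed

section \<open>The amplitude\<close>

text \<open>For negative \<open>t\<close> the interval is empty and the value is zero. The amplitude
  built from it is then equal to one at negative times and continuous on the whole line.\<close>

definition prim :: "(real \<Rightarrow> real) \<Rightarrow> real \<Rightarrow> real" where
  "prim \<alpha> t = (LBINT s. indicator {0..t} s * \<alpha> s)"

definition growth :: "(real \<Rightarrow> real) \<Rightarrow> real \<Rightarrow> real" where
  "growth \<alpha> t = exp (prim \<alpha> t)"

text \<open>The unknown \<open>y = B^(-p)\<close> turns the Bernoulli equation into
  \<open>y' = 1 - p * \<alpha> * y\<close> with \<open>y (0) = 1\<close>. Variation of constants
  with the integrating factor \<open>growth \<alpha> t powr p\<close> gives this formula. It makes
  sense for a bounded measurable \<open>\<alpha>\<close>.\<close>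

definition amp :: "real \<Rightarrow> (real \<Rightarrow> real) \<Rightarrow> real \<Rightarrow> real" where
  "amp p \<alpha> t = growth \<alpha> t / (1 + prim (\<lambda>s. growth \<alpha> s powr p) t) powr (1 / p)"

lemma integrable_indicator_Icc[simp]: "integrable lborel (indicator {c..d::real} :: real \<Rightarrow> real)"
  by (rule integrable_real_indicator) (auto simp: emeasure_lborel_Icc_eq)

lemma abs_mult_le:
  fixes x y :: real
  shows "\<lbrakk>\<bar>x\<bar> \<le> A; \<bar>y\<bar> \<le> B\<rbrakk> \<Longrightarrow> \<bar>x * y\<bar> \<le> A * B"
  by (metis abs_ge_zero abs_mult mult_mono')

lemma sqrt_square_has_derivative:
  fixes g :: "real \<Rightarrow> real"
  assumes "(g has_real_derivative D) (at s within S)" "0 < \<epsilon>"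
  shows "((\<lambda>s. sqrt ((g s)\<^sup>2 + \<epsilon>\<^sup>2)) has_real_derivative g s / sqrt ((g s)\<^sup>2 + \<epsilon>\<^sup>2) * D) (at s within S)"
proof -
  have "0 < (g s)\<^sup>2 + \<epsilon>\<^sup>2" using assms(2) by (intro add_nonneg_pos) auto
  then show ?thesis
    by (auto intro!: derivative_eq_intros assms(1) simp: divide_simps)
qed

lemma integrable_on_Icc:
  fixes g :: "real \<Rightarrow> real"
  assumes "g \<in> borel_measurable borel" "\<And>s. s \<in> {c..d} \<Longrightarrow> \<bar>g s\<bar> \<le> K"
  shows "integrable lborel (\<lambda>s. indicator {c..d} s * g s)"
proof -
  have "integrable lborel (\<lambda>s. (indicator {c..d} s * g s) * indicator {c..d} s)"
  proof (rule integrable_bounded_mult[where C = "\<bar>K\<bar>"])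
    show "\<bar>indicator {c..d} x * g x\<bar> \<le> \<bar>K\<bar>" for x
      using assms(2)[of x] by (auto simp: indicator_def)
  qed (use assms in auto)
  moreover have "(\<lambda>s. (indicator {c..d} s * g s) * indicator {c..d} s) = (\<lambda>s. indicator {c..d} s * g s)"
    by (auto simp: indicator_def)
  ultimately show ?thesis by metis
qed

lemma prim_neg: "t \<le> 0 \<Longrightarrow> prim \<alpha> t = 0"
proof -
  assume "t \<le> 0"
  then have "AE s in lborel. indicator {0..t} s * \<alpha> s = 0"
    by (intro AE_I'[of "{0}"]) (auto simp: indicator_def)
  then show ?thesis unfolding prim_def by (rule integral_eq_zero_AE)
qed

lemma prim_max: "prim \<alpha> (max 0 t) = prim \<alpha> t"
  by (cases "t \<le> 0") (auto simp: prim_neg max_def)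

lemma prim_lipschitz:
  assumes [measurable]: "\<alpha> \<in> borel_measurable borel" and a: "\<And>s. \<bar>\<alpha> s\<bar> \<le> a"
  shows "\<bar>prim \<alpha> t - prim \<alpha> s\<bar> \<le> a * \<bar>t - s\<bar>"
proof -
  have *: "\<bar>prim \<alpha> t - prim \<alpha> s\<bar> \<le> a * (t - s)" if "s \<le> t" for s t
  proof -
    have "prim \<alpha> t - prim \<alpha> s = (LBINT x. indicator {0..t} x * \<alpha> x - indicator {0..s} x * \<alpha> x)"
      unfolding prim_def using a
      by (subst Bochner_Integration.integral_diff) (auto intro!: integrable_on_Icc)
    also have "\<bar>\<dots>\<bar> \<le> (LBINT x. a * indicator {s..t} x)"
    proof (rule order_trans[OF integral_abs_bound], rule integral_mono)
      show "\<bar>indicator {0..t} x * \<alpha> x - indicator {0..s} x * \<alpha> x\<bar> \<le> a * indicator {s..t} x" for x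
        using a[of x] that by (auto simp: indicator_def)
    qed (use a in \<open>auto intro!: integrable_abs Bochner_Integration.integrable_diff integrable_on_Icc\<close>)
    also have "\<dots> = a * (t - s)" using that by simp
    finally show ?thesis .
  qed
  show ?thesis using *[of s t] *[of t s] by (cases "s \<le> t") (auto simp: abs_minus_commute)
qed

lemma continuous_on_lipschitz:
  fixes g :: "real \<Rightarrow> real"
  assumes "\<And>s t. \<bar>g t - g s\<bar> \<le> a * \<bar>t - s\<bar>"
  shows "continuous_on UNIV g"
proof (rule lipschitz_on_continuous_on[of "max a 0"], rule lipschitz_onI)
  fix x y
  show "dist (g x) (g y) \<le> max a 0 * dist x y"
    using assms[of x y] mult_right_mono[of a "max a 0" "\<bar>x - y\<bar>"] by (simp add: dist_real_def)
qed simp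

lemma continuous_on_growth:
  assumes "\<alpha> \<in> borel_measurable borel" "\<And>s. \<bar>\<alpha> s\<bar> \<le> a"
  shows "continuous_on A (growth \<alpha>)"
proof -
  have "continuous_on UNIV (prim \<alpha>)"
    by (rule continuous_on_lipschitz[OF prim_lipschitz[OF assms]])
  then have "continuous_on UNIV (growth \<alpha>)" unfolding growth_def by (intro continuous_intros)
  then show ?thesis using continuous_on_subset by blast
qed

lemma growth_bounds:
  assumes "\<alpha> \<in> borel_measurable borel" "\<And>s. \<bar>\<alpha> s\<bar> \<le> a" "t \<le> T" "0 \<le> T"
  shows "0 < growth \<alpha> t" "growth \<alpha> t \<le> exp (a * T)"
proof -
  have "0 \<le> a" using assms(2)[of 0] by linarith
  have "prim \<alpha> t \<le> a * T"
  proof (cases "t \<le> 0")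
    case True
    then show ?thesis using \<open>0 \<le> a\<close> assms(4) by (simp add: prim_neg)
  next
    case False
    have "prim \<alpha> t \<le> a * \<bar>t\<bar>" using prim_lipschitz[OF assms(1,2), of t 0] by (simp add: prim_neg)
    also have "\<dots> \<le> a * T" using False assms \<open>0 \<le> a\<close> by (intro mult_left_mono) auto
    finally show ?thesis .
  qed
  then show "growth \<alpha> t \<le> exp (a * T)" by (simp add: growth_def)
qed (simp add: growth_def)

section \<open>The amplitude as a function of time and its dependence on the coefficient\<close>

lemma prim_has_derivative:
  assumes "continuous_on UNIV g" "t \<in> {0..T}"
  shows "(prim g has_real_derivative g t) (at t within {0..T})"
proof -
  have *: "prim g x = integral {0..x} g" for x
  proof -
    have "set_integrable lborel {0..x} g"
      using assms(1) continuous_on_subset by (intro borel_integrable_atLeastAtMost') blast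
    from set_borel_integral_eq_integral(2)[OF this] show ?thesis
      by (simp add: prim_def set_lebesgue_integral_def)
  qed
  show ?thesis unfolding * using assms
    by (intro integral_has_real_derivative) (auto intro: continuous_on_subset)
qed

lemma continuous_on_growth_powr:
  assumes "\<alpha> \<in> borel_measurable borel" "\<And>s. \<bar>\<alpha> s\<bar> \<le> a"
  shows "continuous_on UNIV (\<lambda>s. growth \<alpha> s powr p)"
  using continuous_on_growth[OF assms, of UNIV]
  by (intro continuous_intros) (auto simp: growth_def)

lemma prim_nonneg: "(\<And>s. 0 \<le> g s) \<Longrightarrow> 0 \<le> prim g t"
  unfolding prim_def by (intro Bochner_Integration.integral_nonneg) (auto simp: indicator_def)

lemma amp_0[simp]: "amp p \<alpha> 0 = 1" by (simp add: amp_def growth_def prim_neg)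

lemma amp_pos: "0 < amp p \<alpha> t"
proof -
  have "0 \<le> prim (\<lambda>s. growth \<alpha> s powr p) t" by (rule prim_nonneg) simp
  then show ?thesis by (simp add: amp_def growth_def)
qed

lemma amp_le:
  assumes "\<alpha> \<in> borel_measurable borel" "\<And>s. \<bar>\<alpha> s\<bar> \<le> a" "t \<le> T" "0 \<le> T" "0 < p"
  shows "amp p \<alpha> t \<le> exp (a * T)"
proof -
  have "0 \<le> prim (\<lambda>s. growth \<alpha> s powr p) t" by (rule prim_nonneg) simp
  then have "1 \<le> (1 + prim (\<lambda>s. growth \<alpha> s powr p) t) powr (1 / p)"
    using assms(5) by (intro ge_one_powr_ge_zero) auto
  then have "amp p \<alpha> t \<le> growth \<alpha> t / 1"
    unfolding amp_def using growth_bounds(1)[OF assms(1-4)] by (intro divide_left_mono) auto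
  then show ?thesis using growth_bounds(2)[OF assms(1-4)] by simp
qed

lemma continuous_on_amp:
  assumes "\<alpha> \<in> borel_measurable borel" "\<And>s. \<bar>\<alpha> s\<bar> \<le> a"
  shows "continuous_on UNIV (amp p \<alpha>)"
proof -
  have T: "continuous_on {0..T} (amp p \<alpha>)" for T
  proof -
    have "continuous_on {0..T} (prim (\<lambda>s. growth \<alpha> s powr p))"
      by (rule DERIV_continuous_on[OF prim_has_derivative[OF continuous_on_growth_powr[OF assms]]])
    moreover have "1 + prim (\<lambda>s. growth \<alpha> s powr p) t \<noteq> 0" for t
      using prim_nonneg[of "\<lambda>s. growth \<alpha> s powr p" t] by simp
    ultimately show ?thesis unfolding amp_def
      by (intro continuous_intros continuous_on_growth[OF assms]) auto
  qed
  \<comment> \<open>Negative times are invisible to \<open>prim\<close>, so continuity on the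
    intervals \<open>{0..T}\<close> is enough.\<close>
  have "amp p \<alpha> = (\<lambda>t. amp p \<alpha> (max 0 t))"
    by (rule ext) (simp add: amp_def growth_def prim_max)
  moreover have "isCont (\<lambda>t. amp p \<alpha> (max 0 t)) x" for x
  proof -
    have "continuous_on {..x + 1} (\<lambda>t. amp p \<alpha> (max 0 t))"
      by (rule continuous_on_compose2[OF T[of "max 0 (x + 1)"]]) (auto intro!: continuous_intros)
    then show ?thesis by (rule continuous_on_interior) simp
  qed
  ultimately show ?thesis by (simp add: continuous_on_eq_continuous_at)
qed

text \<open>The power \<open>\<tau> powr (- 1 / p)\<close> yields an extra factor
  \<open>G t / \<tau>\<close> upon differentiation, and this factor is the \<open>p\<close>-th power
  of the amplitude.\<close>

lemma amp_has_derivative: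
  assumes \<alpha>: "continuous_on UNIV \<alpha>" "\<And>s. \<bar>\<alpha> s\<bar> \<le> a" and t: "t \<in> {0..T}" and p: "0 < p"
  shows "(amp p \<alpha> has_real_derivative amp p \<alpha> t * (\<alpha> t - amp p \<alpha> t powr p / p)) (at t within {0..T})"
proof -
  have m: "\<alpha> \<in> borel_measurable borel" using \<alpha>(1) by (rule borel_measurable_continuous_onI)
  define G where "G = (\<lambda>s. growth \<alpha> s powr p)"
  have Gp: "G s = exp (p * prim \<alpha> s)" for s by (simp add: G_def growth_def powr_def)
  have 1: "(growth \<alpha> has_real_derivative growth \<alpha> t * \<alpha> t) (at t within {0..T})"
    unfolding growth_def by (auto intro!: derivative_eq_intros prim_has_derivative[OF \<alpha>(1) t])
  have 2: "(prim G has_real_derivative G t) (at t within {0..T})"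
    unfolding G_def by (rule prim_has_derivative[OF continuous_on_growth_powr[OF m \<alpha>(2)] t])
  define \<tau> where "\<tau> = 1 + prim G t"
  have \<tau>: "0 < \<tau>" using prim_nonneg[of G t] by (simp add: \<tau>_def G_def)
  have "((\<lambda>s. growth \<alpha> s / (1 + prim G s) powr (1 / p)) has_real_derivative
      growth \<alpha> t * \<alpha> t * \<tau> powr (- 1 / p) + growth \<alpha> t * (- 1 / p * \<tau> powr (- 1 / p - 1) * G t)) (at t within {0..T})"
  proof -
    have "((\<lambda>s. growth \<alpha> s * (1 + prim G s) powr (- 1 / p)) has_real_derivative
      growth \<alpha> t * \<alpha> t * \<tau> powr (- 1 / p) + growth \<alpha> t * (- 1 / p * \<tau> powr (- 1 / p - 1) * G t)) (at t within {0..T})"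
      using \<tau> by (auto intro!: derivative_eq_intros 1 2 simp: \<tau>_def)
    then show ?thesis by (simp add: powr_minus_divide)
  qed
  moreover have "growth \<alpha> t * \<alpha> t * \<tau> powr (- 1 / p) + growth \<alpha> t * (- 1 / p * \<tau> powr (- 1 / p - 1) * G t)
     = amp p \<alpha> t * (\<alpha> t - amp p \<alpha> t powr p / p)"
  proof -
    have e: "amp p \<alpha> t = growth \<alpha> t * \<tau> powr (- 1 / p)"
      by (simp add: amp_def \<tau>_def G_def powr_minus_divide)
    have "amp p \<alpha> t powr p = G t * \<tau> powr (- 1)"
      unfolding e using \<tau> p by (simp add: powr_mult powr_powr G_def growth_def)
    moreover have "\<tau> powr (- 1 / p - 1) = \<tau> powr (- 1 / p) * \<tau> powr (- 1)"
      by (simp only: powr_add[symmetric]) simp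
    ultimately show ?thesis unfolding e by (simp add: algebra_simps)
  qed
  ultimately show ?thesis unfolding amp_def G_def by simp
qed

lemma prim_tendsto:
  assumes "\<And>n. g n \<in> borel_measurable borel" "g' \<in> borel_measurable borel"
    and "\<And>n s. s \<in> {0..t} \<Longrightarrow> \<bar>g n s\<bar> \<le> K" and "AE s in lborel. s \<in> {0..t} \<longrightarrow> (\<lambda>n. g n s) \<longlonglongrightarrow> g' s"
  shows "(\<lambda>n. prim (g n) t) \<longlonglongrightarrow> prim g' t"
  unfolding prim_def
proof (rule integral_dominated_convergence[where w = "\<lambda>s. K * indicator {0..t} s"])
  show "AE s in lborel. (\<lambda>n. indicator {0..t} s * g n s) \<longlonglongrightarrow> indicator {0..t} s * g' s"
    using assms(4)
  proof eventually_elim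
    case (elim s)
    then show ?case by (cases "s \<in> {0..t}") (auto intro!: tendsto_intros)
  qed
  show "AE s in lborel. norm (indicator {0..t} s * g n s) \<le> K * indicator {0..t} s" for n
    using assms(3)[of _ n] by (intro AE_I2) (auto simp: indicator_def)
qed (use assms(1,2) in auto)

text \<open>Dominated convergence is used twice: for the primitive of the coefficient and then for
  the primitive of the resulting growth factor.\<close>

lemma amp_tendsto:
  assumes b: "\<And>n. b n \<in> borel_measurable borel" "\<And>n s. \<bar>b n s\<bar> \<le> a"
    and \<alpha>: "\<alpha> \<in> borel_measurable borel" "\<And>s. \<bar>\<alpha> s\<bar> \<le> a"
    and lim: "AE s in lborel. (\<lambda>n. b n s) \<longlonglongrightarrow> \<alpha> s" and p: "0 < p" "0 \<le> t"
  shows "(\<lambda>n. amp p (b n) t) \<longlonglongrightarrow> amp p \<alpha> t"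
proof -
  have P: "(\<lambda>n. prim (b n) s) \<longlonglongrightarrow> prim \<alpha> s" for s
    using b \<alpha> lim by (intro prim_tendsto) (auto elim: eventually_mono)
  then have g: "(\<lambda>n. growth (b n) s) \<longlonglongrightarrow> growth \<alpha> s" for s
    unfolding growth_def by (intro tendsto_intros)
  have m: "growth \<beta> \<in> borel_measurable borel" if "\<beta> \<in> borel_measurable borel" "\<And>s. \<bar>\<beta> s\<bar> \<le> a" for \<beta>
    by (rule borel_measurable_continuous_onI[OF continuous_on_growth[OF that]])
  have "(\<lambda>n. prim (\<lambda>s. growth (b n) s powr p) t) \<longlonglongrightarrow> prim (\<lambda>s. growth \<alpha> s powr p) t"
  proof (rule prim_tendsto)
    show "\<bar>growth (b n) s powr p\<bar> \<le> exp (a * t) powr p" if "s \<in> {0..t}" for n s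
      using growth_bounds[OF b, of s t n] that p by (auto intro!: powr_mono2)
    show "AE s in lborel. s \<in> {0..t} \<longrightarrow> (\<lambda>n. growth (b n) s powr p) \<longlonglongrightarrow> growth \<alpha> s powr p"
      using g by (intro AE_I2 impI tendsto_powr tendsto_const) (auto simp: growth_def)
  qed (use m[OF b] m[OF \<alpha>] in measurable)
  moreover have "1 + prim (\<lambda>s. growth \<alpha> s powr p) t \<noteq> 0"
    using prim_nonneg[of "\<lambda>s. growth \<alpha> s powr p" t] by simp
  ultimately show ?thesis unfolding amp_def
    by (intro tendsto_divide tendsto_powr tendsto_add tendsto_const g) auto
qed

text \<open>As \<open>\<alpha>\<close> is merely measurable, \<open>amp p \<alpha>\<close> has no classical derivative. The chain rule for
  \<open>|amp p \<alpha> s * y - k|\<close> is therefore proved for continuous \<open>\<alpha>\<close> and a smoothed modulus; first the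
  coefficient and then the smoothing are removed by dominated convergence.\<close>

lemma smoothed_abs_identity_continuous:
  fixes \<phi> \<phi>' :: "real \<Rightarrow> real"
  assumes \<alpha>: "continuous_on UNIV \<alpha>" "\<And>s. \<bar>\<alpha> s\<bar> \<le> a" and p: "0 < p" and T: "0 < T" and \<epsilon>: "0 < \<epsilon>"
    and \<phi>: "\<And>s. (\<phi> has_real_derivative \<phi>' s) (at s)" "continuous_on UNIV \<phi>'" "\<phi> T = 0"
  shows "(LBINT s. indicator {0..T} s *
      (sqrt ((amp p \<alpha> s * y - k)\<^sup>2 + \<epsilon>\<^sup>2) * \<phi>' s
       + (amp p \<alpha> s * y - k) / sqrt ((amp p \<alpha> s * y - k)\<^sup>2 + \<epsilon>\<^sup>2) * (amp p \<alpha> s * y) * (\<alpha> s - amp p \<alpha> s powr p / p) * \<phi> s))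
    = - sqrt ((y - k)\<^sup>2 + \<epsilon>\<^sup>2) * \<phi> 0"
proof -
  have m: "\<alpha> \<in> borel_measurable borel" using \<alpha>(1) by (rule borel_measurable_continuous_onI)
  have pos: "0 < (amp p \<alpha> s * y - k)\<^sup>2 + \<epsilon>\<^sup>2" for s using \<epsilon> by (intro add_nonneg_pos) auto
  have \<phi>c: "continuous_on {0..T} \<phi>"
    using \<phi>(1) by (meson DERIV_isCont continuous_at_imp_continuous_on)
  have ac: "continuous_on {0..T} (amp p \<alpha>)"
    using continuous_on_amp[OF m \<alpha>(2)] continuous_on_subset by blast
  have "(LBINT s. indicator {0..T} s *\<^sub>R
      (sqrt ((amp p \<alpha> s * y - k)\<^sup>2 + \<epsilon>\<^sup>2) * \<phi>' s
       + (amp p \<alpha> s * y - k) / sqrt ((amp p \<alpha> s * y - k)\<^sup>2 + \<epsilon>\<^sup>2) * (amp p \<alpha> s * y) * (\<alpha> s - amp p \<alpha> s powr p / p) * \<phi> s))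
    = sqrt ((amp p \<alpha> T * y - k)\<^sup>2 + \<epsilon>\<^sup>2) * \<phi> T - sqrt ((amp p \<alpha> 0 * y - k)\<^sup>2 + \<epsilon>\<^sup>2) * \<phi> 0"
  proof (rule integral_FTC_Icc)
    show "0 \<le> T" using T by simp
    fix s assume s: "0 \<le> s" "s \<le> T"
    have 1: "(amp p \<alpha> has_real_derivative amp p \<alpha> s * (\<alpha> s - amp p \<alpha> s powr p / p)) (at s within {0..T})"
      using s by (intro amp_has_derivative[OF \<alpha> _ p]) auto
    have 2: "(\<phi> has_real_derivative \<phi>' s) (at s within {0..T})"
      using \<phi>(1) by (rule has_field_derivative_at_within)
    show "((\<lambda>s. sqrt ((amp p \<alpha> s * y - k)\<^sup>2 + \<epsilon>\<^sup>2) * \<phi> s) has_vector_derivative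
      sqrt ((amp p \<alpha> s * y - k)\<^sup>2 + \<epsilon>\<^sup>2) * \<phi>' s
       + (amp p \<alpha> s * y - k) / sqrt ((amp p \<alpha> s * y - k)\<^sup>2 + \<epsilon>\<^sup>2) * (amp p \<alpha> s * y) * (\<alpha> s - amp p \<alpha> s powr p / p) * \<phi> s) (at s within {0..T})"
      unfolding has_real_derivative_iff_has_vector_derivative[symmetric]
      by (rule DERIV_cong[OF DERIV_mult[OF sqrt_square_has_derivative[OF DERIV_diff[OF DERIV_mult[OF 1 DERIV_const] DERIV_const] \<epsilon>] 2]])
        (simp only: diff_0_right mult_zero_right mult_zero_left add_0_left mult_ac add_ac)
  next
    show "continuous_on {0..T} (\<lambda>s. sqrt ((amp p \<alpha> s * y - k)\<^sup>2 + \<epsilon>\<^sup>2) * \<phi>' s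
       + (amp p \<alpha> s * y - k) / sqrt ((amp p \<alpha> s * y - k)\<^sup>2 + \<epsilon>\<^sup>2) * (amp p \<alpha> s * y) * (\<alpha> s - amp p \<alpha> s powr p / p) * \<phi> s)"
    proof -
      have "sqrt ((amp p \<alpha> s * y - k)\<^sup>2 + \<epsilon>\<^sup>2) \<noteq> 0" for s using pos[of s] by (metis less_irrefl real_sqrt_gt_0_iff)
      moreover have "amp p \<alpha> s \<noteq> 0" for s using amp_pos[of p \<alpha> s] by simp
      ultimately show ?thesis using p
        by (intro continuous_intros ac \<phi>c continuous_on_subset[OF \<phi>(2)] continuous_on_subset[OF \<alpha>(1)]) simp_all
    qed
  qed
  then show ?thesis using \<phi>(3) by simp
qed

lemma continuous_bounded_Icc:
  fixes g :: "real \<Rightarrow> real"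
  assumes "continuous_on UNIV g"
  shows "\<exists>C. \<forall>s\<in>{c..d}. \<bar>g s\<bar> \<le> C"
proof -
  have "bounded (g ` {c..d})"
    using assms by (intro compact_imp_bounded compact_continuous_image) (auto intro: continuous_on_subset)
  then show ?thesis by (auto simp: bounded_iff)
qed

text \<open>Both the coefficient and the approximate modulus depend on \<open>n\<close>, so that
  this serves for both limits: varying the coefficient under a fixed smoothing, and removing the
  smoothing under a fixed coefficient.\<close>

lemma amp_integral_tendsto:
  fixes \<phi> \<phi>' :: "real \<Rightarrow> real" and J J' :: "nat \<Rightarrow> real \<Rightarrow> real"
  assumes b: "\<And>n. b n \<in> borel_measurable borel" "\<And>n s. \<bar>b n s\<bar> \<le> a"
    and \<alpha>: "\<alpha> \<in> borel_measurable borel" "\<And>s. \<bar>\<alpha> s\<bar> \<le> a"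
    and lim: "AE s in lborel. (\<lambda>n. b n s) \<longlonglongrightarrow> \<alpha> s"
    and p: "0 < p" and \<phi>: "continuous_on UNIV \<phi>" "continuous_on UNIV \<phi>'"
    and Jm: "\<And>n. J n \<in> borel_measurable borel" "\<And>n. J' n \<in> borel_measurable borel"
      "j \<in> borel_measurable borel" "j' \<in> borel_measurable borel"
    and J: "\<And>n z. \<bar>J n z\<bar> \<le> \<bar>z\<bar> + e" "\<And>n z. \<bar>J' n z\<bar> \<le> 1"
    and J_lim: "\<And>s. 0 \<le> s \<Longrightarrow> s \<le> T \<Longrightarrow> (\<lambda>n. J n (amp p (b n) s * y - k)) \<longlonglongrightarrow> j (amp p \<alpha> s * y - k)"
    and J'_lim: "\<And>s. 0 \<le> s \<Longrightarrow> s \<le> T \<Longrightarrow> (\<lambda>n. J' n (amp p (b n) s * y - k)) \<longlonglongrightarrow> j' (amp p \<alpha> s * y - k)"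
  shows "(\<lambda>n. LBINT s. indicator {0..T} s * (J n (amp p (b n) s * y - k) * \<phi>' s
       + J' n (amp p (b n) s * y - k) * (amp p (b n) s * y) * (b n s - amp p (b n) s powr p / p) * \<phi> s))
    \<longlonglongrightarrow> (LBINT s. indicator {0..T} s * (j (amp p \<alpha> s * y - k) * \<phi>' s
       + j' (amp p \<alpha> s * y - k) * (amp p \<alpha> s * y) * (\<alpha> s - amp p \<alpha> s powr p / p) * \<phi> s))"
proof -
  note [measurable] = b(1) \<alpha>(1) Jm borel_measurable_continuous_onI[OF \<phi>(1)] borel_measurable_continuous_onI[OF \<phi>(2)]
    borel_measurable_continuous_onI[OF continuous_on_amp[OF \<alpha>]]
    borel_measurable_continuous_onI[OF continuous_on_amp[OF b]]
  define F where "F n s = J n (amp p (b n) s * y - k) * \<phi>' s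
     + J' n (amp p (b n) s * y - k) * (amp p (b n) s * y) * (b n s - amp p (b n) s powr p / p) * \<phi> s" for n s
  obtain C where C: "\<And>s. s \<in> {0..T} \<Longrightarrow> \<bar>\<phi> s\<bar> \<le> C" using continuous_bounded_Icc[OF \<phi>(1)] by blast
  obtain C' where C': "\<And>s. s \<in> {0..T} \<Longrightarrow> \<bar>\<phi>' s\<bar> \<le> C'" using continuous_bounded_Icc[OF \<phi>(2)] by blast
  define M where "M = exp (a * T)"
  \<comment> \<open>A bound for \<open>F\<close> on \<open>{0..T}\<close> that is independent of
    \<open>n\<close>, since the amplitudes share the bound \<open>M\<close>.\<close>
  define K where "K = (M * \<bar>y\<bar> + \<bar>k\<bar> + e) * C' + 1 * (M * \<bar>y\<bar>) * (a + M powr p / p) * C"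
  have bound: "\<bar>F n s\<bar> \<le> K" if s: "s \<in> {0..T}" for n s
  proof -
    let ?B = "amp p (b n) s"
    have B: "0 < ?B" "?B \<le> M"
      using amp_pos amp_le[OF b, of s T p n] s p by (auto simp: M_def)
    have By: "\<bar>?B * y\<bar> \<le> M * \<bar>y\<bar>" using B by (simp add: abs_mult mult_right_mono)
    have "\<bar>J n (?B * y - k)\<bar> \<le> M * \<bar>y\<bar> + \<bar>k\<bar> + e"
      using J(1)[of n "?B * y - k"] By abs_triangle_ineq4[of "?B * y" k] by linarith
    moreover have "\<bar>b n s - ?B powr p / p\<bar> \<le> a + M powr p / p"
    proof -
      have "?B powr p / p \<le> M powr p / p" using B p by (intro divide_right_mono powr_mono2) auto
      moreover have "0 \<le> ?B powr p / p" using p by simp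
      ultimately show ?thesis using b(2)[of n s] by linarith
    qed
    ultimately show ?thesis unfolding F_def K_def
      by (intro order_trans[OF abs_triangle_ineq] add_mono[OF abs_mult_le abs_mult_le[OF abs_mult_le[OF abs_mult_le]]]
          C[OF s] C'[OF s] J(2) By)
  qed
  show ?thesis unfolding F_def[symmetric]
  proof (rule integral_dominated_convergence[where w = "\<lambda>s. K * indicator {0..T} s"])
    show "AE s in lborel. (\<lambda>n. indicator {0..T} s * F n s) \<longlonglongrightarrow> indicator {0..T} s * (j (amp p \<alpha> s * y - k) * \<phi>' s
       + j' (amp p \<alpha> s * y - k) * (amp p \<alpha> s * y) * (\<alpha> s - amp p \<alpha> s powr p / p) * \<phi> s)"
      using lim
    proof eventually_elim
      case (elim s)
      show ?case
      proof (cases "s \<in> {0..T}")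
        case True
        then have "(\<lambda>n. amp p (b n) s) \<longlonglongrightarrow> amp p \<alpha> s"
          using b \<alpha> p lim by (intro amp_tendsto) auto
        then show ?thesis unfolding F_def using elim True p amp_pos[of p \<alpha> s]
          by (intro tendsto_intros J_lim J'_lim) auto
      qed simp
    qed
    show "AE s in lborel. norm (indicator {0..T} s * F n s) \<le> K * indicator {0..T} s" for n
      using bound by (intro AE_I2) (auto simp: indicator_def)
  qed (unfold F_def, measurable)
qed

lemma smoothed_abs_bounds:
  fixes z \<epsilon> :: real
  assumes "0 < \<epsilon>"
  shows "\<bar>sqrt (z\<^sup>2 + \<epsilon>\<^sup>2)\<bar> \<le> \<bar>z\<bar> + \<epsilon>" "\<bar>z / sqrt (z\<^sup>2 + \<epsilon>\<^sup>2)\<bar> \<le> 1"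
proof -
  show "\<bar>sqrt (z\<^sup>2 + \<epsilon>\<^sup>2)\<bar> \<le> \<bar>z\<bar> + \<epsilon>"
    using sqrt_sum_squares_le_sum_abs[of z \<epsilon>] assms by simp
  have "\<bar>z\<bar> \<le> sqrt (z\<^sup>2 + \<epsilon>\<^sup>2)" by (rule real_le_rsqrt) simp
  moreover have "0 < sqrt (z\<^sup>2 + \<epsilon>\<^sup>2)" using assms by (simp add: add_nonneg_pos)
  ultimately show "\<bar>z / sqrt (z\<^sup>2 + \<epsilon>\<^sup>2)\<bar> \<le> 1" by (simp add: divide_le_eq)
qed

lemma smoothed_abs_identity:
  fixes \<phi> \<phi>' :: "real \<Rightarrow> real"
  assumes \<alpha>: "\<alpha> \<in> borel_measurable borel" "\<And>s. \<bar>\<alpha> s\<bar> \<le> a"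
    and p: "0 < p" and T: "0 < T" and \<epsilon>: "0 < \<epsilon>"
    and \<phi>: "\<And>s. (\<phi> has_real_derivative \<phi>' s) (at s)" "continuous_on UNIV \<phi>'" "\<phi> T = 0"
  shows "(LBINT s. indicator {0..T} s *
      (sqrt ((amp p \<alpha> s * y - k)\<^sup>2 + \<epsilon>\<^sup>2) * \<phi>' s
       + (amp p \<alpha> s * y - k) / sqrt ((amp p \<alpha> s * y - k)\<^sup>2 + \<epsilon>\<^sup>2) * (amp p \<alpha> s * y) * (\<alpha> s - amp p \<alpha> s powr p / p) * \<phi> s))
    = - sqrt ((y - k)\<^sup>2 + \<epsilon>\<^sup>2) * \<phi> 0"
proof -
  obtain b where b: "\<And>n::nat. continuous_on UNIV (b n)" "\<And>n s. \<bar>b n s\<bar> \<le> a"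
    "AE s in lborel. (\<lambda>n. b n s) \<longlonglongrightarrow> \<alpha> s"
    using bounded_borel_continuous_approx[of \<alpha> a] \<alpha> by auto
  have bm: "b n \<in> borel_measurable borel" for n
    using b(1) by (rule borel_measurable_continuous_onI)
  have \<phi>c: "continuous_on UNIV \<phi>"
    using \<phi>(1) by (meson DERIV_isCont continuous_at_imp_continuous_on)
  have nz: "sqrt (z\<^sup>2 + \<epsilon>\<^sup>2) \<noteq> 0" for z using \<epsilon> by (simp add: add_nonneg_eq_0_iff)
  have lim: "(\<lambda>n. amp p (b n) s) \<longlonglongrightarrow> amp p \<alpha> s" if "0 \<le> s" for s
    using amp_tendsto[OF bm b(2) \<alpha> b(3) p that] .
  \<comment> \<open>The amplitude starts at one whatever the coefficient, so the right-hand sides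
    form a constant sequence and the limit is identified at once.\<close>
  have "(\<lambda>n. - sqrt ((y - k)\<^sup>2 + \<epsilon>\<^sup>2) * \<phi> 0) \<longlonglongrightarrow> (LBINT s. indicator {0..T} s *
      (sqrt ((amp p \<alpha> s * y - k)\<^sup>2 + \<epsilon>\<^sup>2) * \<phi>' s
       + (amp p \<alpha> s * y - k) / sqrt ((amp p \<alpha> s * y - k)\<^sup>2 + \<epsilon>\<^sup>2) * (amp p \<alpha> s * y) * (\<alpha> s - amp p \<alpha> s powr p / p) * \<phi> s))"
  proof (rule Lim_transform_eventually[OF amp_integral_tendsto[OF bm b(2) \<alpha> b(3) p \<phi>c \<phi>(2),
          where J = "\<lambda>_ z. sqrt (z\<^sup>2 + \<epsilon>\<^sup>2)" and J' = "\<lambda>_ z. z / sqrt (z\<^sup>2 + \<epsilon>\<^sup>2)"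
            and j = "\<lambda>z. sqrt (z\<^sup>2 + \<epsilon>\<^sup>2)" and j' = "\<lambda>z. z / sqrt (z\<^sup>2 + \<epsilon>\<^sup>2)" and e = \<epsilon>]])
    show "\<forall>\<^sub>F n in sequentially. (LBINT s. indicator {0..T} s *
      (sqrt ((amp p (b n) s * y - k)\<^sup>2 + \<epsilon>\<^sup>2) * \<phi>' s
       + (amp p (b n) s * y - k) / sqrt ((amp p (b n) s * y - k)\<^sup>2 + \<epsilon>\<^sup>2) * (amp p (b n) s * y)
         * (b n s - amp p (b n) s powr p / p) * \<phi> s)) = - sqrt ((y - k)\<^sup>2 + \<epsilon>\<^sup>2) * \<phi> 0"
      by (intro always_eventually allI smoothed_abs_identity_continuous[OF b(1,2) p T \<epsilon> \<phi>])
    show "\<bar>sqrt (z\<^sup>2 + \<epsilon>\<^sup>2)\<bar> \<le> \<bar>z\<bar> + \<epsilon>" "\<bar>z / sqrt (z\<^sup>2 + \<epsilon>\<^sup>2)\<bar> \<le> 1" for z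
      by (rule smoothed_abs_bounds[OF \<epsilon>])+
    fix s :: real assume "0 \<le> s"
    note l = lim[OF this]
    show "(\<lambda>n. sqrt ((amp p (b n) s * y - k)\<^sup>2 + \<epsilon>\<^sup>2)) \<longlonglongrightarrow> sqrt ((amp p \<alpha> s * y - k)\<^sup>2 + \<epsilon>\<^sup>2)"
      "(\<lambda>n. (amp p (b n) s * y - k) / sqrt ((amp p (b n) s * y - k)\<^sup>2 + \<epsilon>\<^sup>2))
        \<longlonglongrightarrow> (amp p \<alpha> s * y - k) / sqrt ((amp p \<alpha> s * y - k)\<^sup>2 + \<epsilon>\<^sup>2)"
      by (intro tendsto_intros l nz)+
  qed simp_all
  then show ?thesis using LIMSEQ_unique tendsto_const by blast
qed

lemma amp_abs_identity:
  fixes \<phi> \<phi>' :: "real \<Rightarrow> real"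
  assumes \<alpha>: "\<alpha> \<in> borel_measurable borel" "\<And>s. \<bar>\<alpha> s\<bar> \<le> a"
    and p: "0 < p" and T: "0 < T"
    and \<phi>: "\<And>s. (\<phi> has_real_derivative \<phi>' s) (at s)" "continuous_on UNIV \<phi>'" "\<phi> T = 0"
  shows "(LBINT s. indicator {0..T} s *
      (\<bar>amp p \<alpha> s * y - k\<bar> * \<phi>' s
       + sgn (amp p \<alpha> s * y - k) * (amp p \<alpha> s * y) * (\<alpha> s - amp p \<alpha> s powr p / p) * \<phi> s))
    = - \<bar>y - k\<bar> * \<phi> 0"
proof -
  define e :: "nat \<Rightarrow> real" where "e n = 1 / Suc n" for n
  have e: "0 < e n" "e n \<le> 1" for n by (auto simp: e_def)
  have e0: "e \<longlonglongrightarrow> 0" unfolding e_def using LIMSEQ_inverse_real_of_nat by (simp add: inverse_eq_divide)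
  have J: "(\<lambda>n. sqrt (z\<^sup>2 + (e n)\<^sup>2)) \<longlonglongrightarrow> \<bar>z\<bar>" for z
    using tendsto_real_sqrt[OF tendsto_add[OF tendsto_const tendsto_power[OF e0]], of "z\<^sup>2" 2] by simp
  \<comment> \<open>At \<open>z = 0\<close> the quotient is zero for all \<open>n\<close>, in
    accordance with \<open>sgn 0 = 0\<close>. The limit thus holds at every time, including those
    where the solution meets the level \<open>k\<close>.\<close>
  have J': "(\<lambda>n. z / sqrt (z\<^sup>2 + (e n)\<^sup>2)) \<longlonglongrightarrow> sgn z" for z
  proof (cases "z = 0")
    case False
    then show ?thesis
      using tendsto_divide[OF tendsto_const J[of z], of z] by (simp add: real_sgn_eq)
  qed simp
  have \<phi>c: "continuous_on UNIV \<phi>"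
    using \<phi>(1) by (meson DERIV_isCont continuous_at_imp_continuous_on)
  have "(\<lambda>n. - sqrt ((y - k)\<^sup>2 + (e n)\<^sup>2) * \<phi> 0) \<longlonglongrightarrow> (LBINT s. indicator {0..T} s *
      (\<bar>amp p \<alpha> s * y - k\<bar> * \<phi>' s
       + sgn (amp p \<alpha> s * y - k) * (amp p \<alpha> s * y) * (\<alpha> s - amp p \<alpha> s powr p / p) * \<phi> s))"
    unfolding smoothed_abs_identity[OF \<alpha> p T e(1) \<phi>, symmetric]
  proof (rule amp_integral_tendsto[OF \<alpha> \<alpha> _ p \<phi>c \<phi>(2), where J = "\<lambda>n z. sqrt (z\<^sup>2 + (e n)\<^sup>2)"
        and J' = "\<lambda>n z. z / sqrt (z\<^sup>2 + (e n)\<^sup>2)" and j = abs and j' = sgn and e = 1])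
    show "\<bar>sqrt (z\<^sup>2 + (e n)\<^sup>2)\<bar> \<le> \<bar>z\<bar> + 1" for n z
      using smoothed_abs_bounds(1)[OF e(1)[of n], of z] e(2)[of n] by linarith
    show "\<bar>z / sqrt (z\<^sup>2 + (e n)\<^sup>2)\<bar> \<le> 1" for n z by (rule smoothed_abs_bounds(2)[OF e(1)])
  qed (auto intro!: J J')
  moreover have "(\<lambda>n. - sqrt ((y - k)\<^sup>2 + (e n)\<^sup>2) * \<phi> 0) \<longlonglongrightarrow> - \<bar>y - k\<bar> * \<phi> 0"
    by (intro tendsto_intros J)
  ultimately show ?thesis using LIMSEQ_unique by blast
qed

section \<open>The separable entropy solution\<close>

lemma integrable_compact_support_plane:
  fixes g :: "real \<times> real \<Rightarrow> real"
  assumes "g \<in> borel_measurable borel" "\<And>z. z \<in> cbox (- R, c) (R, d) \<Longrightarrow> \<bar>g z\<bar> \<le> K"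
    and "\<And>z. z \<notin> cbox (- R, c) (R, d) \<Longrightarrow> g z = 0"
  shows "integrable lborel g"
proof -
  have "integrable lborel (indicator (cbox (- R, c) (R, d)) :: real \<times> real \<Rightarrow> real)"
    by (rule integrable_real_indicator) (auto simp: emeasure_lborel_cbox_eq)
  then have "integrable lborel (\<lambda>z. g z * indicator (cbox (- R, c) (R, d)) z)"
    using assms by (intro integrable_bounded_mult[where C = "\<bar>K\<bar>"])
      (auto, metis abs_ge_self abs_ge_zero abs_zero order_trans)
  moreover have "(\<lambda>z. g z * indicator (cbox (- R, c) (R, d)) z) = g"
  proof
    show "g z * indicator (cbox (- R, c) (R, d)) z = g z" for z
      using assms(3)[of z] by (cases "z \<in> cbox (- R, c) (R, d)") simp_all
  qed
  ultimately show ?thesis by simp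
qed

lemma AE_lborel_snd:
  assumes "AE t in lborel. P t"
  shows "AE z in (lborel :: (real \<times> real) measure). P (snd z)"
proof -
  obtain N where N: "{t. \<not> P t} \<subseteq> N" "N \<in> null_sets lborel"
    using AE_E[OF assms] by (auto simp: null_sets_def)
  have "(UNIV :: real set) \<times> N \<in> null_sets (lborel \<Otimes>\<^sub>M (lborel :: real measure))"
  proof (rule null_setsI)
    have "emeasure (lborel \<Otimes>\<^sub>M (lborel :: real measure)) ((UNIV :: real set) \<times> N) = emeasure lborel (UNIV :: real set) * emeasure lborel N"
      by (rule lborel.emeasure_pair_measure_Times) (use N(2) in auto)
    then show "emeasure (lborel \<Otimes>\<^sub>M lborel) ((UNIV :: real set) \<times> N) = 0"
      using N(2) by (simp add: null_setsD1)
  qed (use N(2) in auto)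
  then have "UNIV \<times> N \<in> null_sets (lborel :: (real \<times> real) measure)"
    by (simp only: lborel_prod)
  then show ?thesis by (rule AE_I') (use N(1) in auto)
qed

definition wave :: "real \<Rightarrow> (nat \<Rightarrow> real) \<Rightarrow> (real \<Rightarrow> real) \<Rightarrow> real \<times> real \<Rightarrow> real" where
  "wave p b \<alpha> z = amp p \<alpha> (snd z) * sawtooth p b (fst z)"

lemma abs_wave_le:
  assumes \<alpha>: "\<alpha> \<in> borel_measurable borel" "\<And>s. \<bar>\<alpha> s\<bar> \<le> a" and p: "0 < p"
    and b: "strict_mono b" "b \<longlonglongrightarrow> L" and t: "snd z \<le> T" "0 \<le> T"
  shows "\<bar>wave p b \<alpha> z\<bar> \<le> exp (a * T) * (L - b 0) powr (1 / p)"
  unfolding wave_def abs_mult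
  using abs_sawtooth_le[OF p b, of "fst z"] amp_le[OF \<alpha> t p] amp_pos[of p \<alpha> "snd z"]
  by (intro mult_mono) auto

text \<open>The partial derivatives are separate arguments, so that explicit kernels can be inserted
  in place of \<open>deriv\<close>.\<close>

definition kruzkov ::
  "real \<Rightarrow> (real \<Rightarrow> real) \<Rightarrow> (real \<times> real \<Rightarrow> real) \<Rightarrow> real \<Rightarrow> (real \<times> real \<Rightarrow> real) \<Rightarrow>
   (real \<times> real \<Rightarrow> real) \<Rightarrow> (real \<times> real \<Rightarrow> real) \<Rightarrow> real \<times> real \<Rightarrow> real" where
  "kruzkov p \<beta> v k \<phi> \<phi>t \<phi>x z = \<bar>v z - k\<bar> * \<phi>t z + eflux p (v z) k * \<phi>x z
     + sgn (v z - k) * \<beta> (snd z) * v z * \<phi> z"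

text \<open>The inequality includes the initial term because the doubling tests the explicit
  solution down to time zero. Nonnegativity is asked on \<open>{0..T}\<close> only, since the later
  test functions carry a factor \<open>T - s\<close> that is negative beyond \<open>T\<close>; its
  zero at \<open>T\<close> is what removes the final term.\<close>

lemma wave_entropy_inequality:
  fixes \<phi> \<phi>x \<phi>t :: "real \<times> real \<Rightarrow> real"
  assumes \<alpha>: "\<alpha> \<in> borel_measurable borel" "\<And>s. \<bar>\<alpha> s\<bar> \<le> a" and p: "0 < p" and T: "0 < T"
    and b: "strict_mono b" "b \<longlonglongrightarrow> L"
    and \<phi>t: "\<And>y s. ((\<lambda>\<tau>. \<phi> (y, \<tau>)) has_real_derivative \<phi>t (y, s)) (at s)"
    and \<phi>x: "\<And>y s. ((\<lambda>x. \<phi> (x, s)) has_real_derivative \<phi>x (y, s)) (at y)"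
    and cont: "continuous_on UNIV \<phi>" "continuous_on UNIV \<phi>t" "continuous_on UNIV \<phi>x"
    and nonneg: "\<And>y s. 0 \<le> s \<Longrightarrow> s \<le> T \<Longrightarrow> 0 \<le> \<phi> (y, s)" and final: "\<And>y. \<phi> (y, T) = 0"
    and supp: "\<And>y s. R < \<bar>y\<bar> \<Longrightarrow> \<phi> (y, s) = 0" "\<And>y s. R < \<bar>y\<bar> \<Longrightarrow> \<phi>t (y, s) = 0" "\<And>y s. R < \<bar>y\<bar> \<Longrightarrow> \<phi>x (y, s) = 0"
  shows "0 \<le> (LBINT z. indicator {0..T} (snd z) *
       kruzkov p \<alpha> (wave p b \<alpha>) k \<phi> \<phi>t \<phi>x z)
      + (LBINT y. \<bar>sawtooth p b y - k\<bar> * \<phi> (y, 0))"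
proof -
  define h where "h = sawtooth p b"
  define B where "B = amp p \<alpha>"
  define M where "M = exp (a * T) * (L - b 0) powr (1 / p)"
  \<comment> \<open>The term with \<open>B s powr p / p\<close> is subtracted in \<open>F1\<close>
    and added in \<open>F2\<close>. Then \<open>F1\<close> is integrated in time for fixed
    \<open>y\<close>, where it is an exact derivative of the modulus, and \<open>F2\<close> in space
    for fixed \<open>s\<close>, where it is the stationary inequality.\<close>
  define F1 where "F1 y s = indicator {0..T} s * (\<bar>B s * h y - k\<bar> * \<phi>t (y, s)
      + sgn (B s * h y - k) * (B s * h y) * (\<alpha> s - B s powr p / p) * \<phi> (y, s))" for y s
  define F2 where "F2 y s = indicator {0..T} s * (eflux p (B s * h y) k * \<phi>x (y, s)
      + sgn (B s * h y - k) * (B s powr p / p) * (B s * h y) * \<phi> (y, s))" for y s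
  have v: "\<bar>B s * h y\<bar> \<le> M" if "s \<in> {0..T}" for s y
    using abs_wave_le[OF \<alpha> p b, of "(y, s)" T] that T unfolding wave_def B_def h_def M_def by simp
  have M0: "0 \<le> M" by (simp add: M_def)
  have am: "\<alpha> \<in> borel_measurable borel" by fact
  have Bm: "B \<in> borel_measurable borel" unfolding B_def
    using continuous_on_amp[OF \<alpha>] by (rule borel_measurable_continuous_onI)
  have hm: "h \<in> borel_measurable borel" by (simp add: h_def)
  have [measurable]: "\<phi> \<in> borel_measurable borel" "\<phi>t \<in> borel_measurable borel" "\<phi>x \<in> borel_measurable borel"
    using cont by (auto intro: borel_measurable_continuous_onI)
  have [measurable]: "(\<lambda>z. \<alpha> (snd z)) \<in> borel_measurable (borel :: (real \<times> real) measure)"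
     "(\<lambda>z. B (snd z)) \<in> borel_measurable (borel :: (real \<times> real) measure)"
     "(\<lambda>z. h (fst z)) \<in> borel_measurable (borel :: (real \<times> real) measure)"
    using am Bm hm by (auto simp: borel_prod[symmetric])
  have [measurable]: "(\<lambda>z. indicator {0..T} (snd z) :: real) \<in> borel_measurable (borel :: (real \<times> real) measure)"
    by (auto simp: borel_prod[symmetric])
  have bdd: "\<exists>C. \<forall>z\<in>cbox (- R, 0) (R, T). \<bar>g z\<bar> \<le> C" if "continuous_on UNIV g" for g :: "real \<times> real \<Rightarrow> real"
  proof -
    have "bounded (g ` cbox (- R, 0) (R, T))"
      using that by (intro compact_imp_bounded compact_continuous_image compact_cbox) (auto intro: continuous_on_subset)
    then show ?thesis by (auto simp: bounded_iff)
  qed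
  obtain C Ct Cx where C: "\<And>z. z \<in> cbox (- R, 0) (R, T) \<Longrightarrow> \<bar>\<phi> z\<bar> \<le> C"
    "\<And>z. z \<in> cbox (- R, 0) (R, T) \<Longrightarrow> \<bar>\<phi>t z\<bar> \<le> Ct" "\<And>z. z \<in> cbox (- R, 0) (R, T) \<Longrightarrow> \<bar>\<phi>x z\<bar> \<le> Cx"
    using bdd[OF cont(1)] bdd[OF cont(2)] bdd[OF cont(3)] by metis
  define Q where "Q = flux p M + flux p k"
  have flux_nonneg: "0 \<le> flux p y" for y using p by (simp add: flux_def)
  define D where "D = exp (a * T) powr p / p"
  have D: "0 \<le> B s powr p / p" "B s powr p / p \<le> D" if "s \<in> {0..T}" for s
    using amp_le[OF \<alpha> _ _ p, of s T] amp_pos[of p \<alpha> s] p that T unfolding D_def B_def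
    by (auto intro!: divide_right_mono powr_mono2)
  have s1: "\<bar>sgn x\<bar> \<le> 1" for x :: real by (simp add: sgn_if)
  have out: "R < \<bar>fst z\<bar> \<or> snd z \<notin> {0..T}" if "z \<notin> cbox (- R, 0) (R, T)" for z
    using that by (cases z) (auto simp: cbox_Pair_eq)
  have inn: "snd z \<in> {0..T}" if "z \<in> cbox (- R, 0) (R, T)" for z
    using that by (cases z) (auto simp: cbox_Pair_eq)
  have i1: "integrable lborel (\<lambda>z. F1 (fst z) (snd z))"
  proof (rule integrable_compact_support_plane[where R=R and c=0 and d=T])
    show "(\<lambda>z. F1 (fst z) (snd z)) \<in> borel_measurable borel" unfolding F1_def by simp
    show "F1 (fst z) (snd z) = 0" if "z \<notin> cbox (- R, 0) (R, T)" for z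
      using out[OF that] supp[of "fst z" "snd z"] by (auto simp: F1_def)
    fix z assume z: "z \<in> cbox (- R, 0) (R, T)"
    let ?v = "B (snd z) * h (fst z)"
    have "\<bar>?v - k\<bar> \<le> M + \<bar>k\<bar>" using v[OF inn[OF z], of "fst z"] by linarith
    then have 1: "\<bar>\<bar>?v - k\<bar> * \<phi>t z\<bar> \<le> (M + \<bar>k\<bar>) * Ct" by (intro abs_mult_le C z) simp
    have "\<bar>\<alpha> (snd z) - B (snd z) powr p / p\<bar> \<le> a + D" using \<alpha>(2)[of "snd z"] D[OF inn[OF z]] by linarith
    then have 2: "\<bar>sgn (?v - k) * ?v * (\<alpha> (snd z) - B (snd z) powr p / p) * \<phi> z\<bar> \<le> 1 * M * (a + D) * C"
      by (intro abs_mult_le C z s1 v inn)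
    show "\<bar>F1 (fst z) (snd z)\<bar> \<le> (M + \<bar>k\<bar>) * Ct + 1 * M * (a + D) * C"
      using 1 2 inn[OF z] by (simp add: F1_def)
  qed
  have i2: "integrable lborel (\<lambda>z. F2 (fst z) (snd z))"
  proof (rule integrable_compact_support_plane[where R=R and c=0 and d=T])
    show "(\<lambda>z. F2 (fst z) (snd z)) \<in> borel_measurable borel" unfolding F2_def by simp
    show "F2 (fst z) (snd z) = 0" if "z \<notin> cbox (- R, 0) (R, T)" for z
      using out[OF that] supp[of "fst z" "snd z"] by (auto simp: F2_def)
    fix z assume z: "z \<in> cbox (- R, 0) (R, T)"
    let ?v = "B (snd z) * h (fst z)"
    have "\<bar>eflux p ?v k\<bar> \<le> Q"
      using flux_mono[OF p, of ?v M] v[OF inn[OF z], of "fst z"] flux_nonneg[of ?v] flux_nonneg[of k] M0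
      unfolding abs_eflux Q_def by simp
    then have 1: "\<bar>eflux p ?v k * \<phi>x z\<bar> \<le> Q * Cx" by (intro abs_mult_le C z)
    have "\<bar>B (snd z) powr p / p\<bar> \<le> D" using D[OF inn[OF z]] by simp
    then have 2: "\<bar>sgn (?v - k) * (B (snd z) powr p / p) * ?v * \<phi> z\<bar> \<le> 1 * D * M * C"
      by (intro abs_mult_le C z s1 v inn)
    show "\<bar>F2 (fst z) (snd z)\<bar> \<le> Q * Cx + 1 * D * M * C"
      using order_trans[OF abs_triangle_ineq add_mono[OF 1 2]] inn[OF z]
      by (simp only: F2_def indicator_simps prod.collapse mult_1)
  qed
  have i1': "integrable (lborel \<Otimes>\<^sub>M lborel) (case_prod F1)"
    using i1 by (simp add: lborel_prod case_prod_unfold)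
  have i2': "integrable (lborel \<Otimes>\<^sub>M lborel) (case_prod F2)"
    using i2 by (simp add: lborel_prod case_prod_unfold)
  have slice: "continuous_on UNIV (\<lambda>s. g (y, s))" "continuous_on UNIV (\<lambda>x. g (x, y))"
    if "continuous_on UNIV g" for g :: "real \<times> real \<Rightarrow> real" and y
    using that by (auto intro!: continuous_on_compose2[of UNIV g] continuous_intros)
  have "(LBINT z. F1 (fst z) (snd z)) = (LBINT y. LBINT s. F1 y s)"
    using lborel_pair.integral_fst[OF i1'] by (simp add: lborel_prod case_prod_unfold)
  also have "\<dots> = (LBINT y. - (\<bar>h y - k\<bar> * \<phi> (y, 0)))"
  proof (rule Bochner_Integration.integral_cong[OF refl])
    fix y
    show "(LBINT s. F1 y s) = - (\<bar>h y - k\<bar> * \<phi> (y, 0))"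
      unfolding F1_def B_def
      using amp_abs_identity[OF \<alpha> p T \<phi>t[of y] slice(1)[OF cont(2)] final, of "h y" k] by simp
  qed
  finally have e1: "(LBINT z. F1 (fst z) (snd z)) + (LBINT y. \<bar>h y - k\<bar> * \<phi> (y, 0)) = 0"
    by simp
  have "0 \<le> (LBINT s. LBINT y. F2 y s)"
  proof (rule Bochner_Integration.integral_nonneg)
    fix s
    show "0 \<le> (LBINT y. F2 y s)"
    proof (cases "s \<in> {0..T}")
      case True
      \<comment> \<open>By homogeneity the level \<open>k\<close> for \<open>B s * h\<close> is the
        level \<open>\<kappa>\<close> for \<open>h\<close>, with the common factor
        \<open>B s powr (1 + p)\<close>. The added source term has been chosen to scale in the same
        way.\<close>
      define \<kappa> where "\<kappa> = k / B s"
      have B: "0 < B s" unfolding B_def by (rule amp_pos)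
      have k: "k = B s * \<kappa>" using B by (simp add: \<kappa>_def)
      have "F2 y s = B s powr (1 + p) * (eflux p (h y) \<kappa> * \<phi>x (y, s) + sgn (h y - \<kappa>) * (h y / p) * \<phi> (y, s))" for y
      proof -
        have "sgn (B s * h y - B s * \<kappa>) = sgn (h y - \<kappa>)"
          using B by (simp add: sgn_mult flip: right_diff_distrib)
        moreover have "B s powr (1 + p) = B s * B s powr p" using B by (simp add: powr_add)
        ultimately show ?thesis
          unfolding F2_def k eflux_scale[OF B] using True by (simp add: algebra_simps)
      qed
      moreover have "0 \<le> (LBINT y. eflux p (h y) \<kappa> * \<phi>x (y, s) + sgn (h y - \<kappa>) * (h y / p) * \<phi> (y, s))"
        unfolding h_def
        by (rule sawtooth_stationary[OF p b \<phi>x slice(2)[OF cont(3)] nonneg supp(1,3)]) (use True in auto)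
      ultimately show ?thesis by simp
    qed (simp add: F2_def)
  qed
  also have "\<dots> = (LBINT z. F2 (fst z) (snd z))"
    using lborel_pair.integral_snd[OF i2'] by (simp add: lborel_prod case_prod_unfold)
  finally have e2: "0 \<le> (LBINT z. F2 (fst z) (snd z))" .
  have "(LBINT z. indicator {0..T} (snd z) *
       kruzkov p \<alpha> (wave p b \<alpha>) k \<phi> \<phi>t \<phi>x z)
     = (LBINT z. F1 (fst z) (snd z) + F2 (fst z) (snd z))"
    by (intro Bochner_Integration.integral_cong refl)
      (simp add: kruzkov_def F1_def F2_def wave_def B_def h_def algebra_simps)
  also have "\<dots> = (LBINT z. F1 (fst z) (snd z)) + (LBINT z. F2 (fst z) (snd z))"
    using i1 i2 by simp
  finally show ?thesis using e1 e2 by (simp add: h_def)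
qed

lemma smooth_partial_derivatives:
  fixes \<phi> :: "real \<times> real \<Rightarrow> real"
  assumes "smooth \<phi>"
  obtains \<phi>x \<phi>t where "\<And>x t. ((\<lambda>\<tau>. \<phi> (x, \<tau>)) has_real_derivative \<phi>t (x, t)) (at t)"
    "\<And>x t. ((\<lambda>y. \<phi> (y, t)) has_real_derivative \<phi>x (x, t)) (at x)"
    "continuous_on UNIV \<phi>" "continuous_on UNIV \<phi>t" "continuous_on UNIV \<phi>x"
proof -
  have tcd: "times_cont_diff (Suc 0) \<phi>" "times_cont_diff 0 \<phi>" using assms unfolding smooth_def by blast+
  have "\<phi> differentiable (at z)" for z using tcd(1) unfolding times_cont_diff.simps(2) by blast
  then have D: "(\<phi> has_derivative frechet_derivative \<phi> (at z)) (at z)" for z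
    by (simp only: frechet_derivative_works[symmetric])
  define \<phi>x where "\<phi>x z = frechet_derivative \<phi> (at z) (1, 0)" for z
  define \<phi>t where "\<phi>t z = frechet_derivative \<phi> (at z) (0, 1)" for z
  have lin: "frechet_derivative \<phi> (at z) (c *\<^sub>R w) = c *\<^sub>R frechet_derivative \<phi> (at z) w" for c z w
    by (rule linear_simps(5)[OF has_derivative_bounded_linear[OF D]])
  have "((\<lambda>\<tau>. \<phi> (x, \<tau>)) has_real_derivative \<phi>t (x, t)) (at t)" for x t
  proof -
    have "((\<lambda>\<tau>. \<phi> (x, \<tau>)) has_derivative (\<lambda>h. frechet_derivative \<phi> (at (x, t)) (0, h))) (at t)"
      by (rule has_derivative_compose[OF has_derivative_Pair[OF has_derivative_const has_derivative_ident] D])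
    moreover have "frechet_derivative \<phi> (at (x, t)) (0, h) = \<phi>t (x, t) * h" for h
      using lin[of "(x, t)" h "(0, 1)"] by (simp add: \<phi>t_def mult.commute)
    ultimately show ?thesis by (simp add: has_field_derivative_def)
  qed
  moreover have "((\<lambda>y. \<phi> (y, t)) has_real_derivative \<phi>x (x, t)) (at x)" for x t
  proof -
    have "((\<lambda>y. \<phi> (y, t)) has_derivative (\<lambda>h. frechet_derivative \<phi> (at (x, t)) (h, 0))) (at x)"
      by (rule has_derivative_compose[OF has_derivative_Pair[OF has_derivative_ident has_derivative_const] D])
    moreover have "frechet_derivative \<phi> (at (x, t)) (h, 0) = \<phi>x (x, t) * h" for h
      using lin[of "(x, t)" h "(1, 0)"] by (simp add: \<phi>x_def mult.commute)
    ultimately show ?thesis by (simp add: has_field_derivative_def)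
  qed
  moreover have "continuous_on UNIV \<phi>" "continuous_on UNIV \<phi>t" "continuous_on UNIV \<phi>x"
    using tcd unfolding \<phi>x_def \<phi>t_def by auto
  ultimately show ?thesis using that by blast
qed

text \<open>The passage from the definition, with a Lebesgue integral and functions known up to null
  sets, to Borel representatives that can be used in Fubini's theorem. The time support matters
  because \<open>v\<close> represents \<open>u\<close> only for times in
  \<open>(0, T)\<close>.\<close>

lemma entropy_integral_eq:
  fixes v \<phi> \<phi>x \<phi>t :: "real \<times> real \<Rightarrow> real"
  assumes v: "v \<in> borel_measurable borel" "AE z in lborel. 0 < snd z \<and> snd z < T \<longrightarrow> u (fst z) (snd z) = v z"
    and \<beta>: "\<beta> \<in> borel_measurable borel" "AE t in lborel. 0 < t \<longrightarrow> \<alpha> t = \<beta> t"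
    and cont: "continuous_on UNIV \<phi>" "continuous_on UNIV \<phi>t" "continuous_on UNIV \<phi>x"
    and supp: "\<And>z. \<not> (0 < snd z \<and> snd z < T) \<Longrightarrow> \<phi> z = 0 \<and> \<phi>x z = 0 \<and> \<phi>t z = 0"
  shows "set_lebesgue_integral lebesgue (UNIV \<times> {0<..}) (\<lambda>(x, t).
      \<bar>u x t - k\<bar> * \<phi>t (x, t) + sgn (u x t - k) * (flux p (u x t) - flux p k) * \<phi>x (x, t)
       + sgn (u x t - k) * \<alpha> t * u x t * \<phi> (x, t))
    = (LBINT z. kruzkov p \<beta> v k \<phi> \<phi>t \<phi>x z)"
proof -
  define G where "G z = kruzkov p \<beta> v k \<phi> \<phi>t \<phi>x z" for z
  define F where "F z = indicator (UNIV \<times> {0<..}) z *\<^sub>R (case z of (x, t) \<Rightarrow>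
      \<bar>u x t - k\<bar> * \<phi>t (x, t) + sgn (u x t - k) * (flux p (u x t) - flux p k) * \<phi>x (x, t)
       + sgn (u x t - k) * \<alpha> t * u x t * \<phi> (x, t))" for z
  have [measurable]: "\<phi> \<in> borel_measurable borel" "\<phi>t \<in> borel_measurable borel" "\<phi>x \<in> borel_measurable borel"
    using cont by (auto intro: borel_measurable_continuous_onI)
  have [measurable]: "(\<lambda>z. \<beta> (snd z)) \<in> borel_measurable (borel :: (real \<times> real) measure)"
    using \<beta>(1) by (auto simp: borel_prod[symmetric])
  have [measurable]: "v \<in> borel_measurable borel" by fact
  have Gm: "G \<in> borel_measurable borel" unfolding G_def kruzkov_def by measurable
  have "AE z in lborel. G z = F z"
    using v(2) AE_lborel_snd[OF \<beta>(2)]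
  proof eventually_elim
    case (elim z)
    show ?case
    proof (cases "0 < snd z \<and> snd z < T")
      case True
      then show ?thesis using elim by (cases z) (auto simp: F_def G_def kruzkov_def eflux_def)
    next
      case False
      then show ?thesis using supp[OF False] by (cases z) (auto simp: F_def G_def kruzkov_def)
    qed
  qed
  then have ae: "AE z in lebesgue. G z = F z" by (rule AE_completion)
  have Gl: "G \<in> borel_measurable lebesgue" using Gm by (simp add: measurable_completion)
  have "integral\<^sup>L lebesgue F = integral\<^sup>L lebesgue G"
    using ae Gl borel_measurable_AE[OF Gl ae] by (intro integral_cong_AE) auto
  also have "\<dots> = integral\<^sup>L lborel G" by (rule integral_completion) (use Gm in simp)
  finally show ?thesis unfolding set_lebesgue_integral_def F_def G_def .
qed

lemma integrable_indicator_compact: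
  fixes g :: "real \<Rightarrow> real"
  assumes "compact K" "g \<in> borel_measurable borel" "\<And>x. \<bar>g x\<bar> \<le> C"
  shows "integrable lborel (\<lambda>x. g x * indicator K x)"
proof (rule integrable_bounded_mult)
  show "integrable lborel (indicator K :: real \<Rightarrow> real)"
    using assms(1) by (intro integrable_real_indicator)
      (auto simp: compact_imp_closed borel_closed emeasure_bounded_finite[unfolded infinity_ennreal_def] compact_imp_bounded)
qed (use assms in auto)

lemma wave_entropy_solution:
  assumes \<beta>: "\<beta> \<in> borel_measurable borel" "\<And>s. \<bar>\<beta> s\<bar> \<le> a" "AE t in lborel. 0 < t \<longrightarrow> \<alpha> t = \<beta> t"
    and p: "0 < p" and b: "strict_mono b" "b \<longlonglongrightarrow> L"
  shows "entropy_solution (flux p) \<alpha> (sawtooth p b) (\<lambda>x t. wave p b \<beta> (x, t))"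
proof -
  define C where "C T = exp (a * T) * (L - b 0) powr (1 / p)" for T
  have bd: "\<bar>wave p b \<beta> (x, t)\<bar> \<le> C T" if "t \<le> T" "0 \<le> T" for x t T
    unfolding C_def using abs_wave_le[OF \<beta>(1,2) p b, of "(x, t)" T] that by simp
  have am: "amp p \<beta> \<in> borel_measurable borel"
    using continuous_on_amp[OF \<beta>(1,2)] by (rule borel_measurable_continuous_onI)
  have vm: "(\<lambda>z. wave p b \<beta> z) \<in> borel_measurable (borel :: (real \<times> real) measure)"
    using am unfolding wave_def by (simp add: borel_prod[symmetric])
  have wm: "(\<lambda>x. wave p b \<beta> (x, t)) \<in> borel_measurable borel" for t
    unfolding wave_def by simp
  have sl: "\<bar>sawtooth p b x\<bar> \<le> (L - b 0) powr (1 / p)" for x by (rule abs_sawtooth_le[OF p b])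
  show ?thesis unfolding entropy_solution_def
  proof (intro conjI allI impI)
    fix T :: real assume "0 < T"
    have "(\<lambda>z. wave p b \<beta> z) \<in> borel_measurable (lebesgue_on (UNIV \<times> {0<..<T}))"
      using vm by (intro measurable_restrict_space1 measurable_completion) simp
    moreover have "AE z in lebesgue_on (UNIV \<times> {0<..<T}). \<bar>wave p b \<beta> z\<bar> \<le> C T"
      using bd[of _ T] \<open>0 < T\<close> by (intro AE_I2) (auto simp: space_restrict_space)
    ultimately show "Linfty (lebesgue_on (UNIV \<times> {0<..<T})) (\<lambda>(x, t). wave p b \<beta> (x, t))"
      unfolding Linfty_def case_prod_unfold prod.collapse by blast
  next
    fix t :: real and K :: "real set" assume t: "0 \<le> t" and K: "compact K"
    have "integrable lborel (\<lambda>x. wave p b \<beta> (x, t) * indicator K x)"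
      using bd[of t t] t by (intro integrable_indicator_compact[OF K wm]) auto
    moreover have "(\<lambda>x. indicator K x *\<^sub>R wave p b \<beta> (x, t)) \<in> borel_measurable lborel"
      using wm[of t] compact_imp_closed[OF K] by (auto simp: borel_closed)
    ultimately show "(\<lambda>x. wave p b \<beta> (x, t)) absolutely_integrable_on K"
      unfolding set_integrable_def by (simp add: integrable_completion mult.commute)
    \<comment> \<open>The time dependence factors out, so continuity in \<open>L^1_loc\<close> is
      continuity of the amplitude.\<close>
    have e: "(LINT x:K|lebesgue. \<bar>wave p b \<beta> (x, \<tau>) - wave p b \<beta> (x, t)\<bar>)
        = \<bar>amp p \<beta> \<tau> - amp p \<beta> t\<bar> * (LINT x:K|lebesgue. \<bar>sawtooth p b x\<bar>)" for \<tau>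
    proof -
      have "\<bar>wave p b \<beta> (x, \<tau>) - wave p b \<beta> (x, t)\<bar> = \<bar>amp p \<beta> \<tau> - amp p \<beta> t\<bar> * \<bar>sawtooth p b x\<bar>" for x
        by (simp add: wave_def abs_mult flip: left_diff_distrib)
      then show ?thesis by simp
    qed
    have "(amp p \<beta> \<longlongrightarrow> amp p \<beta> t) (at t within {0..})"
      using continuous_on_amp[OF \<beta>(1,2), of p] by (auto simp: continuous_on_def intro: tendsto_within_subset)
    from tendsto_mult[OF tendsto_rabs[OF tendsto_diff[OF this tendsto_const]] tendsto_const]
    have "((\<lambda>\<tau>. \<bar>amp p \<beta> \<tau> - amp p \<beta> t\<bar> * (LINT x:K|lebesgue. \<bar>sawtooth p b x\<bar>))
       \<longlongrightarrow> \<bar>amp p \<beta> t - amp p \<beta> t\<bar> * (LINT x:K|lebesgue. \<bar>sawtooth p b x\<bar>)) (at t within {0..})" .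
    then show "((\<lambda>\<tau>. LINT x:K|lebesgue. \<bar>wave p b \<beta> (x, \<tau>) - wave p b \<beta> (x, t)\<bar>) \<longlongrightarrow> 0) (at t within {0..})"
      unfolding e by simp
  next
    show "AE x in lebesgue. wave p b \<beta> (x, 0) = sawtooth p b x" by (simp add: wave_def)
  next
    fix k \<phi> assume \<phi>: "test_function \<phi>" and nn: "\<forall>z. 0 \<le> \<phi> z"
    obtain \<phi>x \<phi>t where D: "\<And>x t. ((\<lambda>\<tau>. \<phi> (x, \<tau>)) has_real_derivative \<phi>t (x, t)) (at t)"
      "\<And>x t. ((\<lambda>y. \<phi> (y, t)) has_real_derivative \<phi>x (x, t)) (at x)"
      "continuous_on UNIV \<phi>" "continuous_on UNIV \<phi>t" "continuous_on UNIV \<phi>x"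
      using \<phi> by (auto simp: test_function_def intro: smooth_partial_derivatives[of \<phi>])
    obtain K where K: "compact K" "K \<subseteq> UNIV \<times> {0<..}" "\<And>z. z \<notin> K \<Longrightarrow> \<phi> z = 0"
      using \<phi> unfolding test_function_def by blast
    obtain R where R: "\<And>z. z \<in> K \<Longrightarrow> norm z \<le> R"
      using compact_imp_bounded[OF K(1)] by (auto simp: bounded_iff)
    \<comment> \<open>This exceeds every time coordinate in the support and is positive, so the test
      function vanishes at time \<open>T\<close>.\<close>
    define T where "T = max R 0 + 1"
    have z: "\<phi> z = 0" if "R < \<bar>fst z\<bar> \<or> \<not> (0 < snd z \<and> snd z < T)" for z
    proof (rule K(3), rule notI)
      assume "z \<in> K"
      then have "norm z \<le> R" "0 < snd z" using R K(2) by auto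
      then have "\<bar>fst z\<bar> \<le> R" "\<bar>snd z\<bar> \<le> R"
        using norm_fst_le[of "fst z" "snd z"] norm_snd_le[of "snd z" "fst z"] by auto
      then show False using that \<open>0 < snd z\<close> by (auto simp: T_def)
    qed
    \<comment> \<open>A nonnegative function has a minimum wherever it vanishes, so its partial
      derivatives vanish there too.\<close>
    have z': "\<phi>t z = 0" "\<phi>x z = 0" if "\<phi> z = 0" for z
    proof -
      obtain x t where [simp]: "z = (x, t)" by (cases z)
      show "\<phi>t z = 0" using DERIV_local_min[OF D(1)[of x t], of 1] nn that by simp
      show "\<phi>x z = 0" using DERIV_local_min[OF D(2)[of t x], of 1] nn that by simp
    qed
    have supp: "\<phi> z = 0 \<and> \<phi>x z = 0 \<and> \<phi>t z = 0" if "R < \<bar>fst z\<bar> \<or> \<not> (0 < snd z \<and> snd z < T)" for z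
      using z[OF that] z' by blast
    have dt: "deriv (\<lambda>\<tau>. \<phi> (x, \<tau>)) t = \<phi>t (x, t)" and dx: "deriv (\<lambda>y. \<phi> (y, t)) x = \<phi>x (x, t)" for x t
      using D(1,2) by (auto intro: DERIV_imp_deriv)
    have "set_lebesgue_integral lebesgue (UNIV \<times> {0<..}) (\<lambda>(x, t).
      \<bar>wave p b \<beta> (x, t) - k\<bar> * \<phi>t (x, t) + sgn (wave p b \<beta> (x, t) - k) * (flux p (wave p b \<beta> (x, t)) - flux p k) * \<phi>x (x, t)
       + sgn (wave p b \<beta> (x, t) - k) * \<alpha> t * wave p b \<beta> (x, t) * \<phi> (x, t))
    = (LBINT z. kruzkov p \<beta> (wave p b \<beta>) k \<phi> \<phi>t \<phi>x z)"
      by (rule entropy_integral_eq[where T=T and u="\<lambda>x t. wave p b \<beta> (x, t)"]) (use vm \<beta> D supp in auto)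
    also have "\<dots> = (LBINT z. indicator {0..T} (snd z) * kruzkov p \<beta> (wave p b \<beta>) k \<phi> \<phi>t \<phi>x z)
       + (LBINT y. \<bar>sawtooth p b y - k\<bar> * \<phi> (y, 0))"
    proof -
      have "indicator {0..T} (snd z) * kruzkov p \<beta> (wave p b \<beta>) k \<phi> \<phi>t \<phi>x z
        = kruzkov p \<beta> (wave p b \<beta>) k \<phi> \<phi>t \<phi>x z" for z
        using supp[of z] by (cases "0 < snd z \<and> snd z < T") (auto simp: kruzkov_def)
      moreover have "\<phi> (y, 0) = 0" for y using supp[of "(y, 0)"] by simp
      ultimately show ?thesis by (simp only: mult_zero_right Bochner_Integration.integral_zero add_0_right)
    qed
    also have "0 \<le> \<dots>"
    proof (rule wave_entropy_inequality[OF \<beta>(1,2) p _ b D, where R=R])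
      show "0 < T" by (simp add: T_def)
    qed (use nn supp in \<open>auto simp: T_def\<close>)
    finally show "0 \<le> set_lebesgue_integral lebesgue (UNIV \<times> {0<..}) (\<lambda>(x, t).
               \<bar>wave p b \<beta> (x, t) - k\<bar> * deriv (\<lambda>\<tau>. \<phi> (x, \<tau>)) t
             + sgn (wave p b \<beta> (x, t) - k) * (flux p (wave p b \<beta> (x, t)) - flux p k) * deriv (\<lambda>y. \<phi> (y, t)) x
             + sgn (wave p b \<beta> (x, t) - k) * \<alpha> t * wave p b \<beta> (x, t) * \<phi> (x, t))"
      unfolding dt dx .
  qed
qed

section \<open>Doubling of variables\<close>

text \<open>Bounded solutions are not integrable in space. This weight is integrable, controls its
  own derivative, and changes at most by a factor four under shifts of length at most one.\<close>

definition weight :: "real \<Rightarrow> real" where "weight y = 1 / (1 + y\<^sup>2)"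
definition weight' :: "real \<Rightarrow> real" where "weight' y = - 2 * y / (1 + y\<^sup>2)\<^sup>2"

lemma weight_pos: "0 < weight y" by (simp add: weight_def add_pos_nonneg)
lemma weight_le_1: "weight y \<le> 1" by (simp add: weight_def divide_le_eq add_pos_nonneg)

lemma one_plus_square_neq_0: "1 + y\<^sup>2 \<noteq> (0::real)"
  using zero_le_power2[of y] by linarith

lemma weight_has_derivative: "(weight has_real_derivative weight' y) (at y)"
  unfolding weight_def weight'_def using one_plus_square_neq_0[of y]
  by (auto intro!: derivative_eq_intros simp: power2_eq_square)

lemma continuous_on_weight: "continuous_on A weight" "continuous_on A weight'"
  unfolding weight_def weight'_def using one_plus_square_neq_0
  by (auto intro!: continuous_intros)

lemma borel_measurable_weight[measurable]: "weight \<in> borel_measurable borel" "weight' \<in> borel_measurable borel"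
  using continuous_on_weight by (auto intro: borel_measurable_continuous_onI)

lemma abs_weight'_le: "\<bar>weight' y\<bar> \<le> weight y"
proof -
  have "2 * \<bar>y\<bar> \<le> 1 + y\<^sup>2" using zero_le_power2[of "\<bar>y\<bar> - 1"] by (simp add: power2_eq_square algebra_simps)
  moreover have "0 < 1 + y\<^sup>2" by (simp add: add_pos_nonneg)
  ultimately have "2 * \<bar>y\<bar> / ((1 + y\<^sup>2) * (1 + y\<^sup>2)) \<le> (1 + y\<^sup>2) / ((1 + y\<^sup>2) * (1 + y\<^sup>2))"
    by (intro divide_right_mono) auto
  then show ?thesis using \<open>0 < 1 + y\<^sup>2\<close>
    by (simp add: weight_def weight'_def abs_mult power2_eq_square)
qed

lemma weight_shift: "\<bar>z\<bar> \<le> 1 \<Longrightarrow> weight y \<le> 4 * weight (y + z)"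
proof -
  assume "\<bar>z\<bar> \<le> 1"
  then have "z\<^sup>2 \<le> 1" by (simp add: abs_square_le_1)
  moreover have "(y + z)\<^sup>2 \<le> 2 * y\<^sup>2 + 2 * z\<^sup>2"
    using zero_le_power2[of "y - z"] by (simp add: power2_eq_square algebra_simps)
  moreover have "0 \<le> y\<^sup>2" by simp
  ultimately have "1 + (y + z)\<^sup>2 \<le> 4 * (1 + y\<^sup>2)" by argo
  then show ?thesis unfolding weight_def
    by (simp add: divide_simps add_pos_nonneg)
qed

lemma integrable_weight: "integrable lborel weight"
proof -
  have d: "(arctan has_real_derivative weight y) (at y)" for y
    unfolding weight_def using DERIV_arctan[of y] by (simp add: inverse_eq_divide)
  have "(\<integral>\<^sup>+y. ennreal (weight y) * indicator {0..} y \<partial>lborel) = pi / 2 - arctan 0"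
    by (rule nn_integral_FTC_atLeast) (use d weight_pos tendsto_arctan_at_top in \<open>auto intro: less_imp_le\<close>)
  then have pos: "integrable lborel (\<lambda>y. weight y * indicator {0..} y)"
    using weight_pos
    by (intro integrableI_nonneg) (auto simp: ennreal_mult' less_imp_le ennreal_indicator)
  \<comment> \<open>The reflected half covers the negative axis. The origin is counted twice, so the
    sum dominates the weight rather than being equal to it.\<close>
  have "integrable lborel (\<lambda>y. weight (0 + (- 1) * y) * indicator {0..} (0 + (- 1) * y))"
    using lborel_integrable_real_affine[OF pos, of "-1" 0] by simp
  then have "integrable lborel (\<lambda>y. weight y * indicator {0..} y + weight (0 + (- 1) * y) * indicator {0..} (0 + (- 1) * y))"
    using pos by (rule Bochner_Integration.integrable_add[rotated])
  then show ?thesis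
    by (rule Bochner_Integration.integrable_bound)
      (use weight_pos in \<open>auto intro!: AE_I2 simp: indicator_def less_imp_le weight_def\<close>)
qed

definition strip_weight :: "real \<Rightarrow> real \<times> real \<Rightarrow> real" where
  "strip_weight T z = indicator {0<..<T} (snd z) * weight (fst z)"

lemma borel_measurable_fst_snd:
  fixes f :: "real \<Rightarrow> real"
  assumes "f \<in> borel_measurable borel"
  shows "(\<lambda>z. f (fst z)) \<in> borel_measurable (borel :: (real \<times> real) measure)"
    "(\<lambda>z. f (snd z)) \<in> borel_measurable (borel :: (real \<times> real) measure)"
  using assms by (auto simp: borel_prod[symmetric])

lemma integrable_tensor:
  fixes f g :: "real \<Rightarrow> real"
  assumes "integrable lborel f" "integrable lborel g"
  shows "integrable lborel (\<lambda>z. f (fst z) * g (snd z))"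
    "(LBINT z. f (fst z) * g (snd z)) = (LBINT x. f x) * (LBINT x. g x)"
proof -
  have m: "f \<in> borel_measurable borel" "g \<in> borel_measurable borel" using assms by auto
  have i: "integrable (lborel \<Otimes>\<^sub>M lborel) (\<lambda>z. f (fst z) * g (snd z))"
  proof (rule lborel_pair.Fubini_integrable)
    show "(\<lambda>z. f (fst z) * g (snd z)) \<in> borel_measurable (lborel \<Otimes>\<^sub>M lborel)"
      using m by measurable
  qed (use assms in \<open>auto simp: abs_mult\<close>)
  then show "integrable lborel (\<lambda>z. f (fst z) * g (snd z))" by (simp add: lborel_prod)
  show "(LBINT z. f (fst z) * g (snd z)) = (LBINT x. f x) * (LBINT x. g x)"
    using lborel_pair.integral_fst[of "\<lambda>x y. f x * g y"] i by (simp add: lborel_prod case_prod_unfold)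
qed

lemma integrable_strip_weight: "integrable lborel (strip_weight T)"
proof -
  have "integrable lborel (indicator {0<..<T} :: real \<Rightarrow> real)"
    by (rule integrable_real_indicator) (auto simp: emeasure_lborel_box_eq[where 'a=real, simplified] emeasure_lborel_Ioo intro: less_top[THEN iffD1])
  from integrable_tensor(1)[OF integrable_weight this]
  show ?thesis unfolding strip_weight_def by (simp add: mult.commute)
qed

lemma strip_weight_bounds: "0 \<le> strip_weight T z" "strip_weight T z \<le> (1 + T\<^sup>2) * (weight (fst z) * weight (snd z))"
proof -
  show "0 \<le> strip_weight T z" using weight_pos[of "fst z"] by (simp add: strip_weight_def)
  have "indicator {0<..<T} s \<le> (1 + T\<^sup>2) * weight s" for s
  proof (cases "s \<in> {0<..<T}")
    case True
    then have "1 + s\<^sup>2 \<le> 1 + T\<^sup>2" by (simp add: power_mono)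
    then show ?thesis using True by (simp add: weight_def divide_simps add_pos_nonneg)
  next
    case False
    then show ?thesis using weight_pos[of s] by (simp add: add_nonneg_nonneg)
  qed
  from mult_right_mono[OF this, of "weight (fst z)" "snd z"] weight_pos[of "fst z"]
  show "strip_weight T z \<le> (1 + T\<^sup>2) * (weight (fst z) * weight (snd z))"
    by (simp add: strip_weight_def mult_ac less_imp_le)
qed

text \<open>The sharp cut-off in time is not comparable with its shifts. It is dominated by the
  product of the weights in space and in time, at the price of the factor
  \<open>1 + T\<^sup>2\<close>, and that product changes by at most \<open>16 = 4 * 4\<close> under
  unit shifts.\<close>

lemma strip_translation_continuity:
  fixes a :: "real \<times> real \<Rightarrow> real"
  assumes a[measurable]: "a \<in> borel_measurable borel" and M: "\<And>z. \<bar>a z\<bar> \<le> M" and "0 < \<epsilon>"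
  obtains \<delta> where "0 < \<delta>" "\<And>w. norm w \<le> \<delta> \<Longrightarrow> (LBINT z. \<bar>a (z + w) - a z\<bar> * strip_weight T z) \<le> \<epsilon>"
proof -
  define G where "G z = weight (fst z) * weight (snd z)" for z
  have Gi: "integrable lborel G" unfolding G_def by (rule integrable_tensor(1)[OF integrable_weight integrable_weight])
  have G0: "0 \<le> G z" for z using weight_pos[of "fst z"] weight_pos[of "snd z"] by (simp add: G_def)
  have T: "0 < 1 + T\<^sup>2" by (simp add: add_pos_nonneg)
  have Gs: "G z \<le> 16 * G (z + w)" if "norm w \<le> 1" for z w
  proof -
    have "\<bar>fst w\<bar> \<le> 1" "\<bar>snd w\<bar> \<le> 1"
      using that norm_fst_le[of "fst w" "snd w"] norm_snd_le[of "snd w" "fst w"] by auto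
    then have "weight (fst z) * weight (snd z) \<le> (4 * weight (fst z + fst w)) * (4 * weight (snd z + snd w))"
      using weight_pos by (intro mult_mono weight_shift) (auto simp: less_imp_le)
    then show ?thesis by (simp add: G_def)
  qed
  have "0 < \<epsilon> / (1 + T\<^sup>2)" using \<open>0 < \<epsilon>\<close> T by simp
  from translation_continuity[OF a M Gi G0 Gs this] obtain \<delta> where \<delta>: "0 < \<delta>"
    "\<And>w. norm w \<le> \<delta> \<Longrightarrow> (LBINT z. \<bar>a (z + w) - a z\<bar> * G z) \<le> \<epsilon> / (1 + T\<^sup>2)" by metis
  show thesis
  proof (rule that[OF \<delta>(1)])
    fix w :: "real \<times> real" assume w: "norm w \<le> \<delta>"
    have bd: "\<bar>\<bar>a (z + w) - a z\<bar>\<bar> \<le> 2 * M" for z using M[of "z + w"] M[of z] by simp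
    have i: "integrable lborel (\<lambda>z. \<bar>a (z + w) - a z\<bar> * G z)"
      by (rule integrable_bounded_mult[OF Gi _ bd]) measurable
    have i': "integrable lborel (\<lambda>z. \<bar>a (z + w) - a z\<bar> * strip_weight T z)"
      by (rule integrable_bounded_mult[OF integrable_strip_weight _ bd]) measurable
    have "(LBINT z. \<bar>a (z + w) - a z\<bar> * strip_weight T z) \<le> (LBINT z. (1 + T\<^sup>2) * (\<bar>a (z + w) - a z\<bar> * G z))"
    proof (rule integral_mono[OF i'])
      show "\<bar>a (z + w) - a z\<bar> * strip_weight T z \<le> (1 + T\<^sup>2) * (\<bar>a (z + w) - a z\<bar> * G z)" for z
        using mult_left_mono[OF strip_weight_bounds(2)[of T z], of "\<bar>a (z + w) - a z\<bar>"] by (simp add: G_def mult_ac)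
    qed (use i in simp)
    also have "\<dots> = (1 + T\<^sup>2) * (LBINT z. \<bar>a (z + w) - a z\<bar> * G z)" by simp
    also have "\<dots> \<le> (1 + T\<^sup>2) * (\<epsilon> / (1 + T\<^sup>2))" using \<delta>(2)[OF w] T by (intro mult_left_mono) auto
    finally show "(LBINT z. \<bar>a (z + w) - a z\<bar> * strip_weight T z) \<le> \<epsilon>" using T by simp
  qed
qed

section \<open>Integrability of the doubled integrands\<close>

lemma bumpD:
  assumes "bump \<delta> \<eta> \<eta>'"
  shows "(\<eta> has_real_derivative \<eta>' x) (at x)" "continuous_on UNIV \<eta>'" "continuous_on UNIV \<eta>" "0 \<le> \<eta> x"
    "x \<notin> {0<..<\<delta>} \<Longrightarrow> \<eta> x = 0" "x \<notin> {0<..<\<delta>} \<Longrightarrow> \<eta>' x = 0" "has_bochner_integral lborel \<eta> 1"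
    "integrable lborel \<eta>" "integral\<^sup>L lborel \<eta> = 1" "integrable lborel \<eta>'"
    "\<eta> \<in> borel_measurable borel" "\<eta>' \<in> borel_measurable borel"
proof -
  show 1: "(\<eta> has_real_derivative \<eta>' x) (at x)" "continuous_on UNIV \<eta>'" "0 \<le> \<eta> x"
    "x \<notin> {0<..<\<delta>} \<Longrightarrow> \<eta> x = 0" "x \<notin> {0<..<\<delta>} \<Longrightarrow> \<eta>' x = 0" "has_bochner_integral lborel \<eta> 1" for x
    using assms unfolding bump_def by blast+
  show c: "continuous_on UNIV \<eta>" using 1(1) by (meson DERIV_isCont continuous_at_imp_continuous_on)
  show "integrable lborel \<eta>" "integral\<^sup>L lborel \<eta> = 1" using 1(6) by (auto simp: has_bochner_integral_iff)
  show "integrable lborel \<eta>'"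
    by (rule integrable_continuous_compact_support[OF 1(2), of "\<bar>\<delta>\<bar>"], rule 1(5)) auto
  show "\<eta> \<in> borel_measurable borel" "\<eta>' \<in> borel_measurable borel"
    using c 1(2) by (auto intro: borel_measurable_continuous_onI)
qed

lemma integrable_bounded_kernel:
  fixes \<kappa> \<gamma> :: "'a::euclidean_space \<Rightarrow> real"
  assumes "integrable lborel \<kappa>" "integrable lborel \<gamma>"
    and "f \<in> borel_measurable (borel \<Otimes>\<^sub>M borel)" "\<And>z. \<bar>f z\<bar> \<le> C"
  shows "integrable (lborel \<Otimes>\<^sub>M lborel) (\<lambda>z. f z * (\<kappa> (fst z - snd z) * \<gamma> (snd z)))"
  using integrable_bounded_mult[OF integrable_convolution_kernel[OF assms(1,2)], of f C] assms(3,4)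
  by (simp add: case_prod_unfold cong: measurable_cong_sets)

lemma borel_measurable_pair:
  fixes f :: "'a::topological_space \<Rightarrow> real"
  assumes "f \<in> borel_measurable borel"
  shows "(\<lambda>z. f (fst z)) \<in> borel_measurable (borel \<Otimes>\<^sub>M (borel :: 'b::topological_space measure))"
    "(\<lambda>z. f (snd z)) \<in> borel_measurable ((borel :: 'b::topological_space measure) \<Otimes>\<^sub>M borel)"
  using measurable_compose[OF measurable_fst assms] measurable_compose[OF measurable_snd assms] by blast+

text \<open>The order of integration is essential: for fixed \<open>y\<close> the kernel in
  \<open>P\<close> has mass one and leaves the integrable function \<open>weight\<close>.\<close>

lemma integrable_initial_kernel:
  assumes bump: "bump \<delta> \<eta> \<eta>'"
  shows "integrable (lborel \<Otimes>\<^sub>M lborel) (\<lambda>z. \<eta> (fst (fst z) - snd z) * weight (snd z) * \<eta> (snd (fst z)))"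
proof -
  note \<eta> = bumpD(8,9,11)[OF bump]
  note [measurable] = \<eta>(3)
  have s: "integrable lborel (\<lambda>x. \<eta> (x - y))" "(LBINT x. \<eta> (x - y)) = 1" for y
    using integrable_translate[OF \<eta>(3), of "- y"] integral_translate[OF \<eta>(3), of "- y"] \<eta> by auto
  have t: "integrable lborel (\<lambda>z. \<eta> (fst z - y) * \<eta> (snd z))" "(LBINT z. \<eta> (fst z - y) * \<eta> (snd z)) = 1" for y
    using integrable_tensor[OF s(1) \<eta>(1), of y] s(2)[of y] \<eta>(2) by simp_all
  have m: "(\<lambda>z. \<eta> (fst (snd z) - fst z) * weight (fst z) * \<eta> (snd (snd z)))
      \<in> borel_measurable (borel \<Otimes>\<^sub>M (borel :: (real \<times> real) measure))"
    unfolding borel_prod[symmetric] by measurable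
  have "integrable (lborel \<Otimes>\<^sub>M lborel) (\<lambda>(y, P). \<eta> (fst P - y) * weight y * \<eta> (snd P))"
  proof (rule lborel_pair.Fubini_integrable)
    show "(\<lambda>(y, P). \<eta> (fst P - y) * weight y * \<eta> (snd P)) \<in> borel_measurable (lborel \<Otimes>\<^sub>M lborel)"
      using m by (simp add: case_prod_unfold cong: measurable_cong_sets)
    have e: "\<bar>\<eta> (fst P - y) * weight y * \<eta> (snd P)\<bar> = weight y * (\<eta> (fst P - y) * \<eta> (snd P))" for y P
      using bumpD(4)[OF bump] weight_pos[of y] by (simp add: abs_mult)
    show "integrable lborel (\<lambda>y. LBINT P. norm (case (y, P) of (y, P) \<Rightarrow> \<eta> (fst P - y) * weight y * \<eta> (snd P)))"
      using integrable_weight t by (simp add: e)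
    have "integrable lborel (\<lambda>P. weight y * (\<eta> (fst P - y) * \<eta> (snd P)))" for y using t by simp
    then show "AE y in lborel. integrable lborel (\<lambda>P. case (y, P) of (y, P) \<Rightarrow> \<eta> (fst P - y) * weight y * \<eta> (snd P))"
      by (simp add: mult_ac)
  qed
  then show ?thesis
    by (subst lborel_pair.integrable_product_swap_iff[symmetric]) (simp add: case_prod_unfold)
qed

text \<open>The factor \<open>(T - s) exp (- C s)\<close> absorbs the Lipschitz constant of the flux and the bound of the
  source, because its derivative plus \<open>C\<close> times itself is \<open>- exp (- C s)\<close>; the weight in space is admissible
  because \<open>|weight'| \<le> weight\<close>.\<close>

definition dual_test where
  "dual_test \<eta> T C x t z =
     \<eta> (x - fst z) * weight (fst z) * (\<eta> (t - snd z) * ((T - snd z) * exp (- C * snd z)))"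

definition dual_test_t where
  "dual_test_t \<eta> \<eta>' T C x t z = \<eta> (x - fst z) * weight (fst z) *
     (- \<eta>' (t - snd z) * ((T - snd z) * exp (- C * snd z))
      + \<eta> (t - snd z) * (- exp (- C * snd z) - C * ((T - snd z) * exp (- C * snd z))))"

definition dual_test_x where
  "dual_test_x \<eta> \<eta>' T C x t z = (- \<eta>' (x - fst z) * weight (fst z) + \<eta> (x - fst z) * weight' (fst z))
     * (\<eta> (t - snd z) * ((T - snd z) * exp (- C * snd z)))"

text \<open>The inequality for \<open>u\<close> is used with \<open>k = V Q\<close> and the one for \<open>V\<close> with \<open>k = u P\<close>. The kernel is supported
  in \<open>{s<..<s + \<delta>}\<close>, so test functions for \<open>u\<close> live in positive time, while the inequality for \<open>V\<close> carries
  the initial datum. On the right-hand side only a translation of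
  \<open>\<beta>\<close> and the error at the initial time remain.\<close>

lemma doubling_inequality:
  fixes u V :: "real \<times> real \<Rightarrow> real" and \<beta> h :: "real \<Rightarrow> real"
  assumes p: "0 < p" and T: "0 < T" and bump: "bump \<delta> \<eta> \<eta>'"
    and um: "u \<in> borel_measurable borel" and Vm: "V \<in> borel_measurable borel"
    and \<beta>m: "\<beta> \<in> borel_measurable borel" and hm: "h \<in> borel_measurable borel"
    and M: "\<And>z. \<bar>u z\<bar> \<le> M" "\<And>z. \<bar>V z\<bar> \<le> M" "\<And>x. \<bar>h x\<bar> \<le> M" and a: "\<And>t. \<bar>\<beta> t\<bar> \<le> a"
    and C: "C = M powr p + a"
    and u: "\<And>k y s. 0 < s \<Longrightarrow> s < T \<Longrightarrow> 0 \<le> (LBINT z. kruzkov p \<beta> u k (\<lambda>z. \<eta> (fst z - y) * \<eta> (snd z - s))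
        (\<lambda>z. \<eta> (fst z - y) * \<eta>' (snd z - s)) (\<lambda>z. \<eta>' (fst z - y) * \<eta> (snd z - s)) z)"
    and V: "\<And>k x t. 0 \<le> (LBINT z. indicator {0<..<T} (snd z) * kruzkov p \<beta> V k (dual_test \<eta> T C x t)
          (dual_test_t \<eta> \<eta>' T C x t) (dual_test_x \<eta> \<eta>' T C x t) z)
        + (LBINT y. \<bar>h y - k\<bar> * dual_test \<eta> T C x t (y, 0))"
  shows "exp (- C * T) * (\<integral>(P, Q). \<eta> (fst P - fst Q) * \<eta> (snd P - snd Q) * strip_weight T Q * \<bar>u P - V Q\<bar> \<partial>(lborel \<Otimes>\<^sub>M lborel))
     \<le> T * M * (\<integral>(P, Q). \<eta> (fst P - fst Q) * \<eta> (snd P - snd Q) * strip_weight T Q * \<bar>\<beta> (snd P) - \<beta> (snd Q)\<bar> \<partial>(lborel \<Otimes>\<^sub>M lborel))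
      + T * (LBINT P. LBINT y. \<bar>h y - u P\<bar> * (\<eta> (fst P - y) * weight y * \<eta> (snd P)))"
proof -
  note [measurable] = um Vm \<beta>m hm borel_measurable_fst_snd(2)[OF \<beta>m]
  define \<theta> where "\<theta> s = (T - s) * exp (- C * s)" for s
  define I where "I s = (indicator {0<..<T} s :: real)" for s
  define \<kappa> where "\<kappa> z = \<eta> (fst z) * \<eta> (snd z)" for z
  define \<kappa>x where "\<kappa>x z = \<eta>' (fst z) * \<eta> (snd z)" for z
  define \<kappa>t where "\<kappa>t z = \<eta> (fst z) * \<eta>' (snd z)" for z
  define \<gamma> where "\<gamma> = strip_weight T"
  define \<gamma>' where "\<gamma>' z = I (snd z) * weight' (fst z)" for z
  have M0: "0 \<le> M" using M(1)[of undefined] by linarith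
  have a0: "0 \<le> a" using a[of 0] by linarith
  have C0: "0 \<le> C" unfolding C using a0 by simp
  have \<kappa>i: "integrable lborel \<kappa>" "integrable lborel \<kappa>x" "integrable lborel \<kappa>t"
    unfolding \<kappa>_def \<kappa>x_def \<kappa>t_def
    by (intro integrable_tensor bumpD[OF bump])+
  have \<gamma>i: "integrable lborel \<gamma>" unfolding \<gamma>_def by (rule integrable_strip_weight)
  have [measurable]: "\<theta> \<in> borel_measurable borel" "I \<in> borel_measurable borel"
    unfolding \<theta>_def I_def by measurable
  note [measurable] = borel_measurable_fst_snd[OF borel_measurable_weight(2)] borel_measurable_fst_snd[OF \<open>I \<in> _\<close>]
    borel_measurable_fst_snd[OF \<open>\<theta> \<in> _\<close>]
  have \<gamma>'i: "integrable lborel \<gamma>'"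
  proof (rule Bochner_Integration.integrable_bound[OF \<gamma>i])
    show "\<gamma>' \<in> borel_measurable lborel" unfolding \<gamma>'_def by measurable
    show "AE z in lborel. norm (\<gamma>' z) \<le> norm (\<gamma> z)"
      using abs_weight'_le order_trans[OF abs_ge_zero abs_weight'_le]
      by (intro AE_I2) (auto simp: \<gamma>'_def \<gamma>_def strip_weight_def I_def abs_mult indicator_def)
  qed
  have \<theta>: "0 \<le> I s * \<theta> s" "I s * \<theta> s \<le> T" "\<bar>I s * \<theta> s\<bar> \<le> T" for s
  proof -
    have "exp (- C * s) \<le> 1" if "0 < s" using C0 that by simp
    then have "(T - s) * exp (- C * s) \<le> T * 1" if "0 < s" "s < T" using that T by (intro mult_mono) auto
    then show "0 \<le> I s * \<theta> s" "I s * \<theta> s \<le> T" using T by (auto simp: I_def \<theta>_def indicator_def)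
    then show "\<bar>I s * \<theta> s\<bar> \<le> T" by simp
  qed
  have e1: "\<bar>I s * exp (- C * s)\<bar> \<le> 1" for s using C0 by (auto simp: I_def indicator_def)
  have eflux_bd: "\<bar>eflux p x y\<bar> \<le> M powr p * (2 * M)" if "\<bar>x\<bar> \<le> M" "\<bar>y\<bar> \<le> M" for x y
  proof -
    have "\<bar>eflux p x y\<bar> \<le> M powr p * \<bar>x - y\<bar>" unfolding abs_eflux by (rule flux_lipschitz[OF p that])
    also have "\<dots> \<le> M powr p * (2 * M)" using that by (intro mult_left_mono) auto
    finally show ?thesis .
  qed
  have diff_bd: "\<bar>\<bar>x - y\<bar>\<bar> \<le> 2 * M" if "\<bar>x\<bar> \<le> M" "\<bar>y\<bar> \<le> M" for x y :: real using that by simp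
  have s1: "\<bar>sgn x\<bar> \<le> 1" for x :: real by (simp add: sgn_if)
  \<comment> \<open>These are the two entropy inequalities before integration in the parameter, each
    written as bounded factors times integrable kernels. The terms with \<open>\<kappa>t\<close> and
    \<open>\<kappa>x\<close> occur with opposite signs in \<open>F1\<close> and \<open>F2\<close>
    and cancel in the sum; only derivatives of the weight and of the temporal factor
    survive.\<close>
  define F1 where "F1 P Q = \<bar>u P - V Q\<bar> * (I (snd Q) * \<theta> (snd Q)) * (\<kappa>t (P - Q) * \<gamma> Q)
     + eflux p (u P) (V Q) * (I (snd Q) * \<theta> (snd Q)) * (\<kappa>x (P - Q) * \<gamma> Q)
     + sgn (u P - V Q) * \<beta> (snd P) * u P * (I (snd Q) * \<theta> (snd Q)) * (\<kappa> (P - Q) * \<gamma> Q)" for P Q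
  define F2 where "F2 P Q = \<bar>u P - V Q\<bar> * (I (snd Q) * \<theta> (snd Q)) * (- \<kappa>t (P - Q) * \<gamma> Q)
     + \<bar>u P - V Q\<bar> * (- (I (snd Q) * exp (- C * snd Q)) - C * (I (snd Q) * \<theta> (snd Q))) * (\<kappa> (P - Q) * \<gamma> Q)
     + eflux p (u P) (V Q) * (I (snd Q) * \<theta> (snd Q)) * (- \<kappa>x (P - Q) * \<gamma> Q)
     + eflux p (u P) (V Q) * (I (snd Q) * \<theta> (snd Q)) * (\<kappa> (P - Q) * \<gamma>' Q)
     + sgn (V Q - u P) * \<beta> (snd Q) * V Q * (I (snd Q) * \<theta> (snd Q)) * (\<kappa> (P - Q) * \<gamma> Q)" for P Q
  define F3 where "F3 P y = \<bar>h y - u P\<bar> * (\<eta> (fst P - y) * weight y * \<eta> (snd P))" for P y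
  note [measurable] = borel_measurable_pair(1)[OF um] borel_measurable_pair(2)[OF Vm]
    borel_measurable_pair[OF borel_measurable_fst_snd(2)[OF \<beta>m]]
    borel_measurable_pair(2)[OF borel_measurable_fst_snd(2)[OF \<open>I \<in> _\<close>]]
    borel_measurable_pair(2)[OF borel_measurable_fst_snd(2)[OF \<open>\<theta> \<in> _\<close>]]
  have "(\<lambda>s. exp (- C * s)) \<in> borel_measurable borel" by measurable
  note [measurable] = borel_measurable_pair(2)[OF borel_measurable_fst_snd(2)[OF this]]
  have F1i: "integrable (lborel \<Otimes>\<^sub>M lborel) (\<lambda>z. F1 (fst z) (snd z))"
    unfolding F1_def
  proof (intro Bochner_Integration.integrable_add integrable_bounded_kernel \<kappa>i \<gamma>i)
    show "\<bar>\<bar>u (fst z) - V (snd z)\<bar> * (I (snd (snd z)) * \<theta> (snd (snd z)))\<bar> \<le> (2 * M) * T" for z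
      by (intro abs_mult_le diff_bd M \<theta>)
    show "\<bar>eflux p (u (fst z)) (V (snd z)) * (I (snd (snd z)) * \<theta> (snd (snd z)))\<bar> \<le> (M powr p * (2 * M)) * T" for z
      by (intro abs_mult_le eflux_bd M \<theta>)
    show "\<bar>sgn (u (fst z) - V (snd z)) * \<beta> (snd (fst z)) * u (fst z) * (I (snd (snd z)) * \<theta> (snd (snd z)))\<bar> \<le> 1 * a * M * T" for z
      by (intro abs_mult_le s1 a M \<theta>)
  qed measurable
  have F2i: "integrable (lborel \<Otimes>\<^sub>M lborel) (\<lambda>z. F2 (fst z) (snd z))"
    unfolding F2_def
  proof (intro Bochner_Integration.integrable_add integrable_bounded_kernel[where \<kappa> = "\<lambda>z. - \<kappa>t z"]
      integrable_bounded_kernel[where \<kappa> = "\<lambda>z. - \<kappa>x z"] integrable_bounded_kernel[where \<kappa> = \<kappa>] \<kappa>i \<gamma>i \<gamma>'i Bochner_Integration.integrable_minus)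
    show "\<bar>\<bar>u (fst z) - V (snd z)\<bar> * (I (snd (snd z)) * \<theta> (snd (snd z)))\<bar> \<le> (2 * M) * T" for z
      by (intro abs_mult_le diff_bd M \<theta>)
    show "\<bar>\<bar>u (fst z) - V (snd z)\<bar> * (- (I (snd (snd z)) * exp (- C * snd (snd z))) - C * (I (snd (snd z)) * \<theta> (snd (snd z))))\<bar> \<le> (2 * M) * (1 + C * T)" for z
    proof (intro abs_mult_le diff_bd M)
      have "\<bar>C * (I (snd (snd z)) * \<theta> (snd (snd z)))\<bar> \<le> C * T" using C0 by (intro abs_mult_le \<theta>) simp
      then show "\<bar>- (I (snd (snd z)) * exp (- C * snd (snd z))) - C * (I (snd (snd z)) * \<theta> (snd (snd z)))\<bar> \<le> 1 + C * T"
        using e1[of "snd (snd z)"] by linarith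
    qed
    show "\<bar>eflux p (u (fst z)) (V (snd z)) * (I (snd (snd z)) * \<theta> (snd (snd z)))\<bar> \<le> (M powr p * (2 * M)) * T" for z
      by (intro abs_mult_le eflux_bd M \<theta>)
    show "\<bar>eflux p (u (fst z)) (V (snd z)) * (I (snd (snd z)) * \<theta> (snd (snd z)))\<bar> \<le> (M powr p * (2 * M)) * T" for z
      by (intro abs_mult_le eflux_bd M \<theta>)
    show "\<bar>sgn (V (snd z) - u (fst z)) * \<beta> (snd (snd z)) * V (snd z) * (I (snd (snd z)) * \<theta> (snd (snd z)))\<bar> \<le> 1 * a * M * T" for z
      by (intro abs_mult_le s1 a M \<theta>)
  qed measurable
  have F3i: "integrable (lborel \<Otimes>\<^sub>M lborel) (\<lambda>z. F3 (fst z) (snd z))"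
    unfolding F3_def
  proof (rule integrable_bounded_mult[OF integrable_initial_kernel[OF bump], where C = "2 * M"])
    have "(\<lambda>z. h (snd z)) \<in> borel_measurable (borel \<Otimes>\<^sub>M borel)"
      by (rule measurable_compose[OF measurable_snd hm])
    moreover have "(\<lambda>z. u (fst z)) \<in> borel_measurable (borel \<Otimes>\<^sub>M borel)"
      by (rule measurable_compose[OF measurable_fst um])
    ultimately show "(\<lambda>z. \<bar>h (snd z) - u (fst z)\<bar>) \<in> borel_measurable (lborel \<Otimes>\<^sub>M lborel)"
      by (simp cong: measurable_cong_sets)
  qed (intro diff_bd M)
  define R where "R f = (\<integral>z. f (fst z) (snd z) * (\<kappa> (fst z - snd z) * \<gamma> (snd z)) \<partial>(lborel \<Otimes>\<^sub>M lborel))" for f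
  have R1: "integrable (lborel \<Otimes>\<^sub>M lborel) (\<lambda>z. \<bar>u (fst z) - V (snd z)\<bar> * (\<kappa> (fst z - snd z) * \<gamma> (snd z)))"
    by (intro integrable_bounded_kernel[where C = "2 * M"] \<kappa>i \<gamma>i diff_bd M) measurable
  have R2: "integrable (lborel \<Otimes>\<^sub>M lborel) (\<lambda>z. \<bar>\<beta> (snd (fst z)) - \<beta> (snd (snd z))\<bar> * (\<kappa> (fst z - snd z) * \<gamma> (snd z)))"
  proof (intro integrable_bounded_kernel[where C = "2 * a"] \<kappa>i \<gamma>i)
    show "\<bar>\<bar>\<beta> (snd (fst z)) - \<beta> (snd (snd z))\<bar>\<bar> \<le> 2 * a" for z
      using a[of "snd (fst z)"] a[of "snd (snd z)"] by simp
  qed measurable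
  have "0 \<le> (LBINT Q. LBINT P. F1 P Q)"
  proof (rule Bochner_Integration.integral_nonneg)
    fix Q
    show "0 \<le> (LBINT P. F1 P Q)"
    proof (cases "snd Q \<in> {0<..<T}")
      case True
      have "F1 P Q = (\<theta> (snd Q) * \<gamma> Q) * kruzkov p \<beta> u (V Q) (\<lambda>z. \<eta> (fst z - fst Q) * \<eta> (snd z - snd Q))
        (\<lambda>z. \<eta> (fst z - fst Q) * \<eta>' (snd z - snd Q)) (\<lambda>z. \<eta>' (fst z - fst Q) * \<eta> (snd z - snd Q)) P" for P
        using True by (simp add: F1_def kruzkov_def \<kappa>_def \<kappa>x_def \<kappa>t_def I_def algebra_simps)
      moreover have "0 \<le> \<theta> (snd Q) * \<gamma> Q"
        using \<theta>(1)[of "snd Q"] True strip_weight_bounds(1)[of T Q] by (simp add: I_def \<gamma>_def)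
      ultimately show ?thesis using u[of "snd Q" "V Q" "fst Q"] True by simp
    qed (simp add: F1_def I_def)
  qed
  also have "\<dots> = (\<integral>z. F1 (fst z) (snd z) \<partial>(lborel \<Otimes>\<^sub>M lborel))"
    using lborel_pair.integral_snd[of F1] F1i by (simp add: case_prod_unfold)
  finally have 1: "0 \<le> (\<integral>z. F1 (fst z) (snd z) \<partial>(lborel \<Otimes>\<^sub>M lborel))" .
  have "0 \<le> (LBINT P. (LBINT Q. F2 P Q) + T * (LBINT y. F3 P y))"
  proof (rule Bochner_Integration.integral_nonneg)
    fix P
    have "F2 P z = indicator {0<..<T} (snd z) * kruzkov p \<beta> V (u P) (dual_test \<eta> T C (fst P) (snd P))
          (dual_test_t \<eta> \<eta>' T C (fst P) (snd P)) (dual_test_x \<eta> \<eta>' T C (fst P) (snd P)) z" for z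
    proof (cases "snd z \<in> {0<..<T}")
      case True
      then show ?thesis
        by (simp add: F2_def kruzkov_def dual_test_def dual_test_t_def dual_test_x_def \<kappa>_def \<kappa>x_def \<kappa>t_def
            I_def \<gamma>_def \<gamma>'_def strip_weight_def \<theta>_def eflux_commute[of p "u P"]
            abs_minus_commute[of "u P"] algebra_simps)
    qed (simp add: F2_def I_def)
    moreover have "T * (LBINT y. F3 P y) = (LBINT y. \<bar>h y - u P\<bar> * dual_test \<eta> T C (fst P) (snd P) (y, 0))"
    proof -
      \<comment> \<open>At time zero the temporal factor \<open>(T - s) * exp (- C * s)\<close>
        equals \<open>T\<close>.\<close>
      have "\<bar>h y - u P\<bar> * dual_test \<eta> T C (fst P) (snd P) (y, 0) = T * F3 P y" for y
        by (simp add: F3_def dual_test_def)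
      then show ?thesis by (simp only: integral_mult_right_zero)
    qed
    ultimately show "0 \<le> (LBINT Q. F2 P Q) + T * (LBINT y. F3 P y)"
      using V[of "u P" "fst P" "snd P"] by simp
  qed
  also have "\<dots> = (LBINT P. LBINT Q. F2 P Q) + (LBINT P. T * (LBINT y. F3 P y))"
    using lborel_pair.integrable_fst[of F2] F2i lborel_pair.integrable_fst[of F3] F3i
    by (intro Bochner_Integration.integral_add) (simp_all add: case_prod_unfold)
  also have "\<dots> = (\<integral>z. F2 (fst z) (snd z) \<partial>(lborel \<Otimes>\<^sub>M lborel)) + T * (LBINT P. LBINT y. F3 P y)"
    using lborel_pair.integral_fst[of F2] F2i by (simp add: case_prod_unfold)
  finally have 2: "0 \<le> (\<integral>z. F2 (fst z) (snd z) \<partial>(lborel \<Otimes>\<^sub>M lborel)) + T * (LBINT P. LBINT y. F3 P y)" .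
  have le: "F1 P Q + F2 P Q \<le> - exp (- C * T) * (\<bar>u P - V Q\<bar> * (\<kappa> (P - Q) * \<gamma> Q))
      + T * M * (\<bar>\<beta> (snd P) - \<beta> (snd Q)\<bar> * (\<kappa> (P - Q) * \<gamma> Q))" for P Q
  proof (cases "snd Q \<in> {0<..<T}")
    case True
    define k where "k = \<kappa> (P - Q)"
    define w where "w = \<bar>u P - V Q\<bar>"
    define g where "g = \<gamma> Q"
    define t where "t = \<theta> (snd Q)"
    have k: "0 \<le> k" unfolding k_def \<kappa>_def using bumpD(4)[OF bump] by simp
    have w: "0 \<le> w" by (simp add: w_def)
    have g: "0 \<le> g" unfolding g_def \<gamma>_def by (rule strip_weight_bounds)
    have t: "0 \<le> t" "t \<le> T" using \<theta>[of "snd Q"] True by (auto simp: I_def t_def)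
    have sum: "F1 P Q + F2 P Q = w * (- exp (- C * snd Q) - C * t) * (k * g)
       + eflux p (u P) (V Q) * t * (k * \<gamma>' Q)
       + (sgn (u P - V Q) * \<beta> (snd P) * u P + sgn (V Q - u P) * \<beta> (snd Q) * V Q) * t * (k * g)"
      using True by (simp add: F1_def F2_def I_def w_def k_def g_def t_def algebra_simps)
    have A: "eflux p (u P) (V Q) * t * (k * \<gamma>' Q) \<le> M powr p * w * t * (k * g)"
    proof -
      have "\<bar>eflux p (u P) (V Q)\<bar> \<le> M powr p * w"
        unfolding abs_eflux w_def by (rule flux_lipschitz[OF p M(1,2)])
      moreover have "\<bar>\<gamma>' Q\<bar> \<le> g"
        using abs_weight'_le[of "fst Q"] True by (simp add: \<gamma>'_def g_def \<gamma>_def strip_weight_def I_def)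
      ultimately have "\<bar>eflux p (u P) (V Q) * t * (k * \<gamma>' Q)\<bar> \<le> M powr p * w * t * (k * g)"
        using t k by (intro abs_mult_le) auto
      then show ?thesis by linarith
    qed
    \<comment> \<open>The two sources differ by \<open>\<beta> (snd P) * (u P - V Q)\<close>,
      absorbed later by the choice of \<open>C\<close>, and
      \<open>(\<beta> (snd P) - \<beta> (snd Q)) * V Q\<close>, a translation of the
      coefficient.\<close>
    have B: "sgn (u P - V Q) * \<beta> (snd P) * u P + sgn (V Q - u P) * \<beta> (snd Q) * V Q \<le> a * w + \<bar>\<beta> (snd P) - \<beta> (snd Q)\<bar> * M"
    proof -
      have "sgn (V Q - u P) = - sgn (u P - V Q)" by (auto simp: sgn_if)
      then have "sgn (u P - V Q) * \<beta> (snd P) * u P + sgn (V Q - u P) * \<beta> (snd Q) * V Q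
         = \<beta> (snd P) * \<bar>u P - V Q\<bar> + sgn (u P - V Q) * (\<beta> (snd P) - \<beta> (snd Q)) * V Q"
        by (simp add: abs_sgn algebra_simps)
      moreover have "\<beta> (snd P) * \<bar>u P - V Q\<bar> \<le> a * w"
        unfolding w_def using a[of "snd P"] by (intro mult_right_mono) auto
      moreover have "\<bar>sgn (u P - V Q) * (\<beta> (snd P) - \<beta> (snd Q)) * V Q\<bar> \<le> 1 * \<bar>\<beta> (snd P) - \<beta> (snd Q)\<bar> * M"
        by (intro abs_mult_le s1 M) simp
      ultimately show ?thesis by linarith
    qed
    have "F1 P Q + F2 P Q \<le> w * (- exp (- C * snd Q) - C * t) * (k * g)
       + M powr p * w * t * (k * g) + (a * w + \<bar>\<beta> (snd P) - \<beta> (snd Q)\<bar> * M) * t * (k * g)"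
      unfolding sum
      by (rule add_mono[OF add_mono[OF order_refl A] mult_right_mono[OF mult_right_mono[OF B t(1)] mult_nonneg_nonneg[OF k g]]])
    \<comment> \<open>With \<open>C = M powr p + a\<close> all terms containing \<open>w * t\<close>
      cancel exactly.\<close>
    also have "\<dots> = - exp (- C * snd Q) * (w * (k * g)) + t * M * (\<bar>\<beta> (snd P) - \<beta> (snd Q)\<bar> * (k * g))"
      unfolding C by (simp add: algebra_simps)
    \<comment> \<open>Since \<open>C\<close> is nonnegative, the exponential on the strip is at
      least its value at \<open>T\<close>; this gives a coefficient independent of
      \<open>Q\<close>.\<close>
    also have "\<dots> \<le> - exp (- C * T) * (w * (k * g)) + T * M * (\<bar>\<beta> (snd P) - \<beta> (snd Q)\<bar> * (k * g))"
      using True C0 w k g t M0 by (intro add_mono mult_right_mono) (auto intro!: mult_left_mono)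
    finally show ?thesis unfolding w_def k_def g_def .
  qed (simp add: F1_def F2_def I_def \<gamma>_def strip_weight_def)
  have "(\<integral>z. F1 (fst z) (snd z) \<partial>(lborel \<Otimes>\<^sub>M lborel)) + (\<integral>z. F2 (fst z) (snd z) \<partial>(lborel \<Otimes>\<^sub>M lborel))
     = (\<integral>z. F1 (fst z) (snd z) + F2 (fst z) (snd z) \<partial>(lborel \<Otimes>\<^sub>M lborel))"
    using F1i F2i by simp
  also have "\<dots> \<le> (\<integral>z. - exp (- C * T) * (\<bar>u (fst z) - V (snd z)\<bar> * (\<kappa> (fst z - snd z) * \<gamma> (snd z)))
      + T * M * (\<bar>\<beta> (snd (fst z)) - \<beta> (snd (snd z))\<bar> * (\<kappa> (fst z - snd z) * \<gamma> (snd z))) \<partial>(lborel \<Otimes>\<^sub>M lborel))"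
    by (intro integral_mono le Bochner_Integration.integrable_add F1i F2i integrable_mult_right R1 R2)
  also have "\<dots> = - exp (- C * T) * (\<integral>z. \<bar>u (fst z) - V (snd z)\<bar> * (\<kappa> (fst z - snd z) * \<gamma> (snd z)) \<partial>(lborel \<Otimes>\<^sub>M lborel))
      + T * M * (\<integral>z. \<bar>\<beta> (snd (fst z)) - \<beta> (snd (snd z))\<bar> * (\<kappa> (fst z - snd z) * \<gamma> (snd z)) \<partial>(lborel \<Otimes>\<^sub>M lborel))"
    using R1 R2 by (subst Bochner_Integration.integral_add) (auto intro!: integrable_mult_right)
  finally show ?thesis using 1 2 unfolding F3_def \<kappa>_def \<gamma>_def
    by (simp add: case_prod_unfold mult_ac)
qed

section \<open>Uniqueness\<close>

lemma AE_sections: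
  assumes "AE z in (lborel :: (real \<times> real) measure). P (fst z) (snd z)"
  shows "AE t in lborel. AE x in lborel. P x t"
proof -
  obtain N where N: "{z. \<not> P (fst z) (snd z)} \<subseteq> N" "N \<in> null_sets (lborel :: (real \<times> real) measure)"
    using AE_E[OF assms] by (auto simp: null_sets_def)
  have Nm: "N \<in> sets (lborel \<Otimes>\<^sub>M lborel)" using N(2) by (simp only: lborel_prod null_setsD2)
  have "AE z in lborel \<Otimes>\<^sub>M lborel. z \<notin> N" using N(2) by (simp add: lborel_prod AE_not_in)
  then have "AE x in lborel. AE t in lborel. (x, t) \<notin> N" by (rule lborel_pair.AE_pair)
  then have "AE t in lborel. AE x in lborel. (x, t) \<notin> N"
  proof (subst lborel_pair.AE_commute[symmetric])
    have "space (lborel \<Otimes>\<^sub>M lborel) - N \<in> sets (lborel \<Otimes>\<^sub>M lborel)" using Nm by (rule sets.compl_sets)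
    moreover have "{x \<in> space (lborel \<Otimes>\<^sub>M lborel). (fst x, snd x) \<notin> N} = space (lborel \<Otimes>\<^sub>M lborel) - N" by auto
    ultimately show "{x \<in> space (lborel \<Otimes>\<^sub>M lborel). (fst x, snd x) \<notin> N} \<in> sets (lborel \<Otimes>\<^sub>M lborel)" by metis
  qed
  then show ?thesis
  proof (rule eventually_mono)
    fix t assume "AE x in lborel. (x, t) \<notin> N"
    then show "AE x in lborel. P x t" 
    proof (rule eventually_mono)
      show "P x t" if "(x, t) \<notin> N" for x
        using subsetD[OF N(1), of "(x, t)"] that by auto
    qed
  qed
qed

text \<open>Clipping a Borel representative turns the essential bound into one valid everywhere.
  Thereafter no exceptional sets interfere with shifts and sections.\<close>

lemma Linfty_borel_representative:
  fixes u :: "real \<Rightarrow> real \<Rightarrow> real"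
  assumes "Linfty (lebesgue_on (UNIV \<times> {0<..<T})) (\<lambda>(x, t). u x t)"
  obtains w M where "w \<in> borel_measurable borel" "\<And>z. \<bar>w z\<bar> \<le> M"
    "AE z in lborel. 0 < snd z \<and> snd z < T \<longrightarrow> u (fst z) (snd z) = w z"
proof -
  let ?S = "(UNIV :: real set) \<times> {0<..<T}"
  define g where "g z = (if z \<in> ?S then u (fst z) (snd z) else 0)" for z
  have "open ?S" by (intro open_Times) auto
  then have S: "?S \<in> sets lebesgue" by auto
  obtain C where C: "AE z in lebesgue_on ?S. \<bar>case z of (x, t) \<Rightarrow> u x t\<bar> \<le> C"
    and m: "(\<lambda>(x, t). u x t) \<in> borel_measurable (lebesgue_on ?S)"
    using assms unfolding Linfty_def by auto
  have "g \<in> borel_measurable lebesgue"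
    using borel_measurable_if[OF S, of "\<lambda>(x, t). u x t"] m unfolding g_def case_prod_unfold by simp
  then obtain g' where g': "g' \<in> borel_measurable lborel" "AE z in lborel. g z = g' z"
    using completion_ex_borel_measurable_real by blast
  define w where "w z = max (- \<bar>C\<bar>) (min \<bar>C\<bar> (g' z))" for z
  have "AE z in lebesgue. z \<in> ?S \<longrightarrow> \<bar>u (fst z) (snd z)\<bar> \<le> C"
    using C S by (subst (asm) AE_restrict_space_iff) (auto simp: case_prod_unfold)
  then have "AE z in lborel. z \<in> ?S \<longrightarrow> \<bar>u (fst z) (snd z)\<bar> \<le> C" by (simp only: AE_completion_iff)
  with g'(2) have "AE z in lborel. 0 < snd z \<and> snd z < T \<longrightarrow> u (fst z) (snd z) = w z"
  proof eventually_elim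
    case (elim z)
    then show ?case by (cases z) (auto simp: g_def w_def)
  qed
  moreover have "w \<in> borel_measurable borel" unfolding w_def using g'(1) by simp
  moreover have "\<bar>w z\<bar> \<le> \<bar>C\<bar>" for z by (auto simp: w_def)
  ultimately show ?thesis using that by blast
qed

lemma weight_tail:
  assumes "0 < \<epsilon>"
  obtains R where "0 < R" "(LBINT x. weight x * indicator (- {-R..R}) x) \<le> \<epsilon>"
proof -
  have "(\<lambda>n. LBINT x. weight x * indicator (- {-real n..real n}) x) \<longlonglongrightarrow> (\<integral>x. 0 \<partial>(lborel::real measure))"
  proof (rule integral_dominated_convergence[where w = weight])
    show "AE x in lborel. (\<lambda>n. weight x * indicator (- {-real n..real n}) x) \<longlonglongrightarrow> 0"
    proof (rule AE_I2)
      fix x :: real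
      have "\<forall>\<^sub>F n in sequentially. \<bar>x\<bar> \<le> real n"
        using eventually_ge_at_top[of "nat \<lceil>\<bar>x\<bar>\<rceil>"] by eventually_elim linarith
      then have "\<forall>\<^sub>F n in sequentially. weight x * indicator (- {-real n..real n}) x = 0"
        by eventually_elim (auto simp: abs_le_iff)
      then show "(\<lambda>n. weight x * indicator (- {-real n..real n}) x) \<longlonglongrightarrow> 0"
        by (rule tendsto_eventually)
    qed
    show "AE x in lborel. norm (weight x * indicator (- {-real n..real n}) x) \<le> weight x" for n
      using weight_pos by (intro AE_I2) (auto simp: indicator_def less_imp_le)
  qed (use integrable_weight in auto)
  then have "\<forall>\<^sub>F n in sequentially. (LBINT x. weight x * indicator (- {-real n..real n}) x) < \<epsilon>"
    using assms by (intro order_tendstoD(2)) auto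
  then obtain n where "1 \<le> n" "(LBINT x. weight x * indicator (- {-real n..real n}) x) < \<epsilon>"
    unfolding eventually_sequentially by (meson linorder_linear order_trans)
  then show ?thesis using that[of "real n"] by simp
qed

text \<open>The distance is split at \<open>h (fst P)\<close>. One part is a translation error of
  \<open>h\<close> in the mean; the other is the deviation of \<open>w\<close> from \<open>h\<close>
  at times in the support of \<open>\<eta>\<close>, which shrinks to zero. The initial trace is
  controlled on bounded intervals only, and the integrable weight handles the rest of the
  line.\<close>

lemma initial_error:
  fixes w :: "real \<times> real \<Rightarrow> real"
  assumes h: "h \<in> borel_measurable borel" "\<And>x. \<bar>h x\<bar> \<le> M"
    and w: "w \<in> borel_measurable borel" "\<And>z. \<bar>w z\<bar> \<le> M"
    and lim: "\<And>R \<epsilon>. 0 < \<epsilon> \<Longrightarrow> \<exists>\<delta>>0. AE t in lborel. 0 < t \<and> t < \<delta> \<longrightarrow>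
       (LBINT x. \<bar>w (x, t) - h x\<bar> * indicator {-R..R} x) \<le> \<epsilon>"
    and \<epsilon>: "0 < \<epsilon>"
  shows "\<exists>\<delta>0>0. \<forall>\<delta> \<eta> \<eta>'. \<delta> \<le> \<delta>0 \<longrightarrow> bump \<delta> \<eta> \<eta>' \<longrightarrow>
     (LBINT P. LBINT y. \<bar>h y - w P\<bar> * (\<eta> (fst P - y) * weight y * \<eta> (snd P))) \<le> \<epsilon>"
proof -
  have M0: "0 \<le> M" using h(2)[of 0] by linarith
  note [measurable] = h(1) w(1) borel_measurable_fst_snd[OF borel_measurable_weight(1)] borel_measurable_fst_snd[OF h(1)]
  obtain \<delta>1 where \<delta>1: "0 < \<delta>1" "\<delta>1 \<le> 1" "\<And>z. norm z \<le> \<delta>1 \<Longrightarrow> (LBINT x. \<bar>h (x + z) - h x\<bar> * weight x) \<le> \<epsilon> / 2"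
  proof (rule translation_continuity[OF h integrable_weight, of 4 "\<epsilon> / 2"])
    show "0 \<le> weight x" for x using weight_pos[of x] by simp
    show "norm z \<le> 1 \<Longrightarrow> weight x \<le> 4 * weight (x + z)" for x z by (rule weight_shift) simp
  qed (use \<epsilon> in auto)
  \<comment> \<open>The deviation at small times will be at most \<open>2 * e\<close> and is
    multiplied by four from shifting the weight, so it uses up half of \<epsilon>.\<close>
  define e where "e = \<epsilon> / 16"
  have e: "0 < e" using \<epsilon> by (simp add: e_def)
  \<comment> \<open>On the tail the difference is at most \<open>2 * M\<close>, hence its weighted
    integral there is at most \<open>e\<close>.\<close>
  obtain R where R: "0 < R" "(LBINT x. weight x * indicator (- {-R..R}) x) \<le> e / (2 * M + 1)"
    using weight_tail[of "e / (2 * M + 1)"] e M0 by auto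
  obtain \<delta>2 where \<delta>2: "0 < \<delta>2" "AE t in lborel. 0 < t \<and> t < \<delta>2 \<longrightarrow>
       (LBINT x. \<bar>w (x, t) - h x\<bar> * indicator {-R..R} x) \<le> e"
    using lim[OF e] by blast
  have sec: "(\<lambda>x. w (x, t)) \<in> borel_measurable borel" for t
    using w(1) by (simp add: borel_prod[symmetric])
  note [measurable] = sec
  have diff: "\<bar>\<bar>w (x, t) - h x\<bar>\<bar> \<le> 2 * M" "\<bar>\<bar>h x - h y\<bar>\<bar> \<le> 2 * M" for x y t
    using w(2)[of "(x, t)"] h(2)[of x] h(2)[of y] by simp_all
  have D: "AE t in lborel. 0 < t \<and> t < \<delta>2 \<longrightarrow> (LBINT x. \<bar>w (x, t) - h x\<bar> * weight x) \<le> 2 * e"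
    using \<delta>2(2)
  proof eventually_elim
    case (elim t)
    show ?case
    proof
      assume t: "0 < t \<and> t < \<delta>2"
      have i1: "integrable lborel (\<lambda>x. \<bar>w (x, t) - h x\<bar> * indicator {-R..R} x)"
        by (rule integrable_bounded_mult[where C = "2 * M"]) (use diff in auto)
      have i2: "integrable lborel (\<lambda>x. weight x * indicator (- {-R..R}) x)"
        using integrable_real_mult_indicator[OF _ integrable_weight, of "- {-R..R}"] by simp
      have "(LBINT x. \<bar>w (x, t) - h x\<bar> * weight x) \<le>
        (LBINT x. \<bar>w (x, t) - h x\<bar> * indicator {-R..R} x + (2 * M) * (weight x * indicator (- {-R..R}) x))"
      proof (rule integral_mono)
        show "integrable lborel (\<lambda>x. \<bar>w (x, t) - h x\<bar> * weight x)"
          by (rule integrable_bounded_mult[OF integrable_weight, where C = "2 * M"]) (use diff in auto)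
        show "\<bar>w (x, t) - h x\<bar> * weight x \<le> \<bar>w (x, t) - h x\<bar> * indicator {-R..R} x + (2 * M) * (weight x * indicator (- {-R..R}) x)" for x
        proof (cases "x \<in> {-R..R}")
          case True
          then show ?thesis using mult_left_mono[OF weight_le_1[of x], of "\<bar>w (x, t) - h x\<bar>"] by simp
        next
          case False
          then show ?thesis using mult_right_mono[of "\<bar>w (x, t) - h x\<bar>" "2 * M" "weight x"] diff(1)[of x t] weight_pos[of x] by simp
        qed
      qed (use i1 i2 in simp)
      also have "\<dots> = (LBINT x. \<bar>w (x, t) - h x\<bar> * indicator {-R..R} x) + (2 * M) * (LBINT x. weight x * indicator (- {-R..R}) x)"
        using i1 i2 by simp
      also have "\<dots> \<le> e + (2 * M) * (e / (2 * M + 1))"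
        using elim t R(2) M0 by (intro add_mono mult_left_mono) auto
      also have "\<dots> \<le> e + e" using M0 e by (simp add: field_simps)
      finally show "(LBINT x. \<bar>w (x, t) - h x\<bar> * weight x) \<le> 2 * e" by simp
    qed
  qed
  show ?thesis
  proof (intro exI[of _ "min \<delta>1 \<delta>2"] conjI allI impI)
    show "0 < min \<delta>1 \<delta>2" using \<delta>1 \<delta>2 by simp
    fix \<delta> \<eta> \<eta>' assume \<delta>: "\<delta> \<le> min \<delta>1 \<delta>2" and bump: "bump \<delta> \<eta> \<eta>'"
    note \<eta> = bumpD[OF bump]
    note [measurable] = \<eta>(11)
    have supp: "\<bar>z\<bar> \<le> \<delta>1" "0 < z" "z < \<delta>2" if "\<eta> z \<noteq> 0" for z
    proof -
      have "z \<in> {0<..<\<delta>}" using \<eta>(5) that by blast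
      then show "\<bar>z\<bar> \<le> \<delta>1" "0 < z" "z < \<delta>2" using \<delta> by auto
    qed
    define k where "k x y = \<eta> (x - y) * weight y" for x y
    have refl: "integrable lborel (\<lambda>y. \<eta> (x - y))" "(LBINT y. \<eta> (x - y)) = 1" for x
      using lborel_integrable_real_affine[OF \<eta>(8), of "-1" x] lborel_integral_real_affine[of "-1" \<eta> x] \<eta>(9) by simp_all
    have ki: "integrable lborel (k x)" for x
      unfolding k_def using integrable_bounded_mult[OF refl(1), of weight 1 x] weight_pos weight_le_1
      by (simp add: mult.commute less_imp_le)
    have k0: "0 \<le> k x y" for x y unfolding k_def using \<eta>(4) weight_pos[of y] by simp
    \<comment> \<open>On the support of the kernel \<open>y\<close> is within distance one of
      \<open>x\<close>, so the weight may be moved to \<open>x\<close> before the kernel is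
      integrated out.\<close>
    have \<Psi>: "(LBINT y. k x y) \<le> 4 * weight x" for x
    proof -
      have "(LBINT y. k x y) \<le> (LBINT y. 4 * weight x * \<eta> (x - y))"
      proof (rule integral_mono[OF ki])
        show "k x y \<le> 4 * weight x * \<eta> (x - y)" for y
        proof (cases "\<eta> (x - y) = 0")
          case False
          have "weight y \<le> 4 * weight (y + (x - y))"
            using supp(1)[OF False] \<delta>1 by (intro weight_shift) simp
          then show ?thesis unfolding k_def using \<eta>(4)[of "x - y"]
            using mult_left_mono[of "weight y" "4 * weight x" "\<eta> (x - y)"] by (simp add: mult.commute)
        qed (simp add: k_def)
      qed (use refl in simp)
      then show ?thesis using refl by simp
    qed
    define \<Phi> where "\<Phi> x = (LBINT y. \<bar>h x - h y\<bar> * k x y)" for x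
    have \<Phi>i: "integrable (lborel \<Otimes>\<^sub>M lborel) (\<lambda>(x, y). \<bar>h x - h y\<bar> * k x y)"
      unfolding k_def case_prod_unfold
      using integrable_bounded_kernel[OF \<eta>(8) integrable_weight, of "\<lambda>z. \<bar>h (fst z) - h (snd z)\<bar>" "2 * M"] diff(2)
        measurable_compose[OF measurable_fst h(1)] measurable_compose[OF measurable_snd h(1)]
      by simp
    have \<Phi>: "integrable lborel \<Phi>" unfolding \<Phi>_def using lborel_pair.integrable_fst[OF \<Phi>i] .
    have "(LBINT x. \<Phi> x) = (\<integral>(x, y). \<eta> (x - y) * weight y * \<bar>h x - h y\<bar> \<partial>(lborel \<Otimes>\<^sub>M lborel))"
      unfolding \<Phi>_def using lborel_pair.integral_fst[OF \<Phi>i] by (simp add: k_def mult_ac)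
    also have "\<dots> \<le> \<epsilon> / 2"
    proof (rule integral_convolution_kernel_le[OF h \<eta>(7,4) _ integrable_weight])
      show "\<delta>1 < norm z \<Longrightarrow> \<eta> z = 0" for z using supp(1)[of z] by force
      show "0 \<le> weight x" for x using weight_pos[of x] by simp
    qed (rule \<delta>1(3))
    finally have \<Phi>le: "(LBINT x. \<Phi> x) \<le> \<epsilon> / 2" .
    \<comment> \<open>Here the weight has been moved to the spatial point of \<open>w\<close>, so
      the integral factors into a spatial error at each time and a time average against
      \<open>\<eta>\<close>.\<close>
    define A where "A z = \<bar>w z - h (fst z)\<bar> * (weight (fst z) * \<eta> (snd z))" for z
    have Ai: "integrable lborel A" unfolding A_def
    proof (rule integrable_bounded_mult[OF integrable_tensor(1)[OF integrable_weight \<eta>(8)], where C = "2 * M"])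
      show "\<bar>\<bar>w z - h (fst z)\<bar>\<bar> \<le> 2 * M" for z using diff(1)[of "fst z" "snd z"] by simp
    qed measurable
    have Ale: "(LBINT z. A z) \<le> 2 * e"
    proof -
      have Ai': "integrable (lborel \<Otimes>\<^sub>M lborel) (\<lambda>(x, t). A (x, t))" using Ai by (simp add: lborel_prod)
      have "(LBINT z. A z) = (LBINT t. LBINT x. A (x, t))"
        using lborel_pair.integral_snd[OF Ai'] by (simp add: lborel_prod)
      also have "\<dots> \<le> (LBINT t. 2 * e * \<eta> t)"
      proof (rule integral_mono_AE)
        show "integrable lborel (\<lambda>t. LBINT x. A (x, t))" using lborel_pair.integrable_snd[OF Ai'] .
        show "AE t in lborel. (LBINT x. A (x, t)) \<le> 2 * e * \<eta> t"
          using D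
        proof eventually_elim
          case (elim t)
          have "(LBINT x. A (x, t)) = (LBINT x. \<bar>w (x, t) - h x\<bar> * weight x) * \<eta> t"
            unfolding A_def by (simp add: mult.assoc[symmetric])
          also have "\<dots> \<le> 2 * e * \<eta> t"
          proof (cases "\<eta> t = 0")
            case False
            then show ?thesis using elim supp[OF False] \<eta>(4)[of t] by (intro mult_right_mono) auto
          qed simp
          finally show ?case .
        qed
      qed (use \<eta>(8) in simp)
      also have "\<dots> = 2 * e" using \<eta>(9) by simp
      finally show ?thesis .
    qed
    have Ti: "integrable lborel (\<lambda>P. \<Phi> (fst P) * \<eta> (snd P))" "(LBINT P. \<Phi> (fst P) * \<eta> (snd P)) = (LBINT x. \<Phi> x)"
      using integrable_tensor[OF \<Phi> \<eta>(8)] \<eta>(9) by simp_all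
    have "(LBINT P. LBINT y. \<bar>h y - w P\<bar> * (\<eta> (fst P - y) * weight y * \<eta> (snd P)))
       \<le> (LBINT P. \<Phi> (fst P) * \<eta> (snd P) + 4 * A P)"
    proof (rule integral_mono')
      show "integrable lborel (\<lambda>P. \<Phi> (fst P) * \<eta> (snd P) + 4 * A P)" using Ti Ai by simp
      fix P :: "real \<times> real"
      have j1: "integrable lborel (\<lambda>y. \<bar>h (fst P) - h y\<bar> * k (fst P) y)"
        by (rule integrable_bounded_mult[OF ki, where C = "2 * M"]) (use diff in auto)
      have "(LBINT y. \<bar>h y - w P\<bar> * (\<eta> (fst P - y) * weight y * \<eta> (snd P)))
         \<le> (LBINT y. \<eta> (snd P) * (\<bar>h (fst P) - h y\<bar> * k (fst P) y) + \<eta> (snd P) * \<bar>w P - h (fst P)\<bar> * k (fst P) y)"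
      proof (rule integral_mono')
        fix y
        have "\<bar>h y - w P\<bar> * (\<eta> (snd P) * k (fst P) y) \<le> (\<bar>h (fst P) - h y\<bar> + \<bar>w P - h (fst P)\<bar>) * (\<eta> (snd P) * k (fst P) y)"
          using k0[of "fst P" y] \<eta>(4)[of "snd P"] by (intro mult_right_mono) auto
        then show "\<bar>h y - w P\<bar> * (\<eta> (fst P - y) * weight y * \<eta> (snd P)) \<le> \<eta> (snd P) * (\<bar>h (fst P) - h y\<bar> * k (fst P) y) + \<eta> (snd P) * \<bar>w P - h (fst P)\<bar> * k (fst P) y"
          by (simp add: k_def algebra_simps)
        show "0 \<le> \<eta> (snd P) * (\<bar>h (fst P) - h y\<bar> * k (fst P) y) + \<eta> (snd P) * \<bar>w P - h (fst P)\<bar> * k (fst P) y"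
          using k0[of "fst P" y] \<eta>(4)[of "snd P"] by simp
      qed (use j1 ki in simp)
      also have "\<dots> = \<eta> (snd P) * \<Phi> (fst P) + \<eta> (snd P) * \<bar>w P - h (fst P)\<bar> * (LBINT y. k (fst P) y)"
        using j1 ki by (simp add: \<Phi>_def)
      also have "\<dots> \<le> \<eta> (snd P) * \<Phi> (fst P) + \<eta> (snd P) * \<bar>w P - h (fst P)\<bar> * (4 * weight (fst P))"
        using \<Psi> \<eta>(4)[of "snd P"] by (intro add_left_mono mult_left_mono) auto
      finally show "(LBINT y. \<bar>h y - w P\<bar> * (\<eta> (fst P - y) * weight y * \<eta> (snd P))) \<le> \<Phi> (fst P) * \<eta> (snd P) + 4 * A P"
        by (simp add: A_def mult_ac)
      have "0 \<le> \<Phi> (fst P)" unfolding \<Phi>_def using k0 by (intro Bochner_Integration.integral_nonneg) simp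
      then show "0 \<le> \<Phi> (fst P) * \<eta> (snd P) + 4 * A P"
        using \<eta>(4)[of "snd P"] weight_pos[of "fst P"] by (simp add: A_def less_imp_le)
    qed
    also have "\<dots> \<le> \<epsilon> / 2 + 4 * (2 * e)" using Ti Ai \<Phi>le Ale by simp
    also have "\<dots> = \<epsilon>" by (simp add: e_def)
    finally show "(LBINT P. LBINT y. \<bar>h y - w P\<bar> * (\<eta> (fst P - y) * weight y * \<eta> (snd P))) \<le> \<epsilon>" .
  qed
qed

text \<open>As the kernel shrinks, the doubled distance between the solutions tends to zero because
  only translation errors and the initial error bound it. Replacing \<open>w P\<close> by
  \<open>w Q\<close> costs one more translation error, and the unit mass of the kernel then leaves
  the weighted distance on the diagonal.\<close>

lemma entropy_solution_eq_wave:
  fixes u :: "real \<Rightarrow> real \<Rightarrow> real"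
  assumes \<beta>: "\<beta> \<in> borel_measurable borel" "\<And>s. \<bar>\<beta> s\<bar> \<le> a" "AE t in lborel. 0 < t \<longrightarrow> \<alpha> t = \<beta> t"
    and p: "0 < p" and b: "strict_mono b" "b \<longlonglongrightarrow> L" and T: "0 < T"
    and es: "entropy_solution (flux p) \<alpha> (sawtooth p b) u"
  shows "AE z in lborel. 0 < snd z \<and> snd z < T \<longrightarrow> u (fst z) (snd z) = wave p b \<beta> z"
proof -
  define h where "h = sawtooth p b"
  \<comment> \<open>One unit of time beyond \<open>T\<close> is kept in reserve: kernels centred at
    \<open>s < T\<close> reach up to \<open>s + \<delta>\<close>, where \<open>\<delta>\<close> will
    be at most one.\<close>
  have es1: "Linfty (lebesgue_on (UNIV \<times> {0<..<T + 1})) (\<lambda>(x, t). u x t)"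
    using es T unfolding entropy_solution_def by (metis add_pos_pos zero_less_one)
  have es2: "(\<lambda>x. u x t) absolutely_integrable_on K" if "0 \<le> t" "compact K" for t K
    using es that unfolding entropy_solution_def by blast
  have es3: "((\<lambda>\<tau>. LINT x:K|lebesgue. \<bar>u x \<tau> - u x 0\<bar>) \<longlongrightarrow> 0) (at 0 within {0..})" if "compact K" for K
    using es that unfolding entropy_solution_def by blast
  have es4: "AE x in lebesgue. u x 0 = h x"
    using es unfolding entropy_solution_def h_def by blast
  have es5: "0 \<le> set_lebesgue_integral lebesgue (UNIV \<times> {0<..}) (\<lambda>(x, t).
               \<bar>u x t - k\<bar> * deriv (\<lambda>\<tau>. \<phi> (x, \<tau>)) t
             + sgn (u x t - k) * (flux p (u x t) - flux p k) * deriv (\<lambda>y. \<phi> (y, t)) x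
             + sgn (u x t - k) * \<alpha> t * u x t * \<phi> (x, t))"
    if "test_function \<phi>" "\<And>z. 0 \<le> \<phi> z" for k \<phi>
    using es that unfolding entropy_solution_def by blast
  obtain w M0 where w: "w \<in> borel_measurable borel" "\<And>z. \<bar>w z\<bar> \<le> M0"
    "AE z in lborel. 0 < snd z \<and> snd z < T + 1 \<longrightarrow> u (fst z) (snd z) = w z"
    by (rule Linfty_borel_representative[OF es1]) blast
  \<comment> \<open>The explicit solution is only bounded on bounded time intervals; cutting it off
    outside the strip gives a bound valid everywhere.\<close>
  define V where "V z = indicator {0<..<T} (snd z) * wave p b \<beta> z" for z
  define M where "M = M0 + exp (a * T) * (L - b 0) powr (1 / p) + (L - b 0) powr (1 / p)"
  have M00: "0 \<le> M0" using w(2)[of undefined] by linarith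
  have M: "\<bar>w z\<bar> \<le> M" "\<bar>V z\<bar> \<le> M" "\<bar>h x\<bar> \<le> M" for z x
  proof -
    have "0 \<le> (L - b 0) powr (1 / p)" by simp
    moreover have "0 \<le> exp (a * T) * (L - b 0) powr (1 / p)" by simp
    ultimately show "\<bar>w z\<bar> \<le> M" "\<bar>h x\<bar> \<le> M"
      using w(2)[of z] abs_sawtooth_le[OF p b, of x] M00 unfolding M_def h_def by linarith+
    have "\<bar>V z\<bar> \<le> exp (a * T) * (L - b 0) powr (1 / p)"
      using abs_wave_le[OF \<beta>(1,2) p b, of z T] T by (auto simp: V_def indicator_def)
    then show "\<bar>V z\<bar> \<le> M" using M00 \<open>0 \<le> (L - b 0) powr (1 / p)\<close> unfolding M_def by linarith
  qed
  have M0: "0 \<le> M" using M(3)[of 0] by linarith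
  have am: "amp p \<beta> \<in> borel_measurable borel"
    using continuous_on_amp[OF \<beta>(1,2)] by (rule borel_measurable_continuous_onI)
  have hm: "h \<in> borel_measurable borel" by (simp add: h_def)
  have Im: "(indicator {0<..<T} :: real \<Rightarrow> real) \<in> borel_measurable borel" by simp
  have Vm: "V \<in> borel_measurable borel"
    unfolding V_def wave_def h_def[symmetric]
    by (intro borel_measurable_times borel_measurable_fst_snd Im am hm)
  note [measurable] = w(1) Vm borel_measurable_fst_snd(2)[OF \<beta>(1)] borel_measurable_fst_snd(2)[OF Im]
    borel_measurable_fst_snd(1)[OF hm] borel_measurable_fst_snd(1)[OF borel_measurable_weight(1)]
  define C where "C = M powr p + a"
  have "0 \<le> a" using \<beta>(2)[of 0] by linarith
  then have C0: "0 \<le> C" by (simp add: C_def)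

  \<comment> \<open>Continuity at time zero holds for the sections of \<open>u\<close>; it passes to
    the Borel representative at almost every small time, by Fubini.\<close>
  have initial: "\<exists>\<delta>>0. AE t in lborel. 0 < t \<and> t < \<delta> \<longrightarrow>
       (LBINT x. \<bar>w (x, t) - h x\<bar> * indicator {-R..R} x) \<le> \<epsilon>" if "0 < \<epsilon>" for R \<epsilon>
  proof -
    have "\<forall>\<^sub>F \<tau> in at 0 within {0..}. (LINT x:{-R..R}|lebesgue. \<bar>u x \<tau> - u x 0\<bar>) < \<epsilon>"
      using es3[of "{-R..R}"] that by (intro order_tendstoD(2)) auto
    then obtain d where d: "0 < d" "\<And>\<tau>. 0 < \<tau> \<Longrightarrow> \<tau> < d \<Longrightarrow> (LINT x:{-R..R}|lebesgue. \<bar>u x \<tau> - u x 0\<bar>) < \<epsilon>"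
      unfolding eventually_at by (auto simp: dist_real_def)
    have "AE t in lborel. AE x in lborel. 0 < t \<and> t < T + 1 \<longrightarrow> u x t = w (x, t)"
      using AE_sections[of "\<lambda>x t. 0 < t \<and> t < T + 1 \<longrightarrow> u x t = w (x, t)"] w(3) by simp
    then have "AE t in lborel. 0 < t \<and> t < min d T \<longrightarrow> (LBINT x. \<bar>w (x, t) - h x\<bar> * indicator {-R..R} x) \<le> \<epsilon>"
    proof eventually_elim
      case (elim t)
      show ?case
      proof
        assume t: "0 < t \<and> t < min d T"
        then have "AE x in lborel. u x t = w (x, t)" using elim by (auto elim: eventually_mono)
        then have "AE x in lebesgue. u x t = w (x, t)" by (rule AE_completion)
        with es4 have ae: "AE x in lebesgue. indicator {-R..R} x *\<^sub>R \<bar>u x t - u x 0\<bar> = \<bar>w (x, t) - h x\<bar> * indicator {-R..R} x"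
          by eventually_elim simp
        have wt: "(\<lambda>x. w (x, t)) \<in> borel_measurable borel" using w(1) by (simp add: borel_prod[symmetric])
        have gm: "(\<lambda>x. \<bar>w (x, t) - h x\<bar> * indicator {-R..R} x) \<in> borel_measurable borel"
          using wt hm by measurable
        have gl: "(\<lambda>x. \<bar>w (x, t) - h x\<bar> * indicator {-R..R} x) \<in> borel_measurable lebesgue"
          using gm by (simp add: measurable_completion)
        have "AE x in lebesgue. \<bar>w (x, t) - h x\<bar> * indicator {-R..R} x = indicator {-R..R} x *\<^sub>R \<bar>u x t - u x 0\<bar>"
          by (rule eventually_mono[OF ae]) (rule sym)
        note fm = borel_measurable_AE[OF gl this]
        have "(LINT x:{-R..R}|lebesgue. \<bar>u x t - u x 0\<bar>) = (\<integral>x. \<bar>w (x, t) - h x\<bar> * indicator {-R..R} x \<partial>lebesgue)"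
          unfolding set_lebesgue_integral_def by (rule integral_cong_AE[OF fm gl ae])
        also have "\<dots> = (LBINT x. \<bar>w (x, t) - h x\<bar> * indicator {-R..R} x)"
          by (rule integral_completion) (use gm in simp)
        finally show "(LBINT x. \<bar>w (x, t) - h x\<bar> * indicator {-R..R} x) \<le> \<epsilon>"
          using d(2)[of t] t by simp
      qed
    qed
    then show ?thesis using d(1) T by (intro exI[of _ "min d T"]) simp
  qed

  have key: "(LBINT z. \<bar>w z - V z\<bar> * strip_weight T z) \<le> \<epsilon>" if "0 < \<epsilon>" for \<epsilon>
  proof -
    \<comment> \<open>The final estimate is \<open>e\<close> for translating \<open>w\<close>, plus
      \<open>exp (C * T)\<close> times the errors \<open>T * M * e\<close> from the coefficient and
      \<open>T * e\<close> from the initial time.\<close>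
    define e where "e = \<epsilon> / (1 + exp (C * T) * (T * M + T))"
    have den: "0 < 1 + exp (C * T) * (T * M + T)"
      using T M0 by (intro add_pos_nonneg mult_nonneg_nonneg add_nonneg_nonneg) auto
    have e: "0 < e" using that den by (simp add: e_def)
    obtain \<delta>1 where \<delta>1: "0 < \<delta>1" "\<And>z'. norm z' \<le> \<delta>1 \<Longrightarrow> (LBINT z. \<bar>w (z + z') - w z\<bar> * strip_weight T z) \<le> e"
      by (rule strip_translation_continuity[OF w(1) M(1) e]) blast
    obtain \<delta>2 where \<delta>2: "0 < \<delta>2" "\<And>z'. norm z' \<le> \<delta>2 \<Longrightarrow> (LBINT z. \<bar>\<beta> (snd (z + z')) - \<beta> (snd z)\<bar> * strip_weight T z) \<le> e"
      by (rule strip_translation_continuity[OF borel_measurable_fst_snd(2)[OF \<beta>(1)] \<beta>(2) e]) blast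
    obtain \<delta>3 where \<delta>3: "0 < \<delta>3" "\<And>\<delta> \<eta> \<eta>'. \<delta> \<le> \<delta>3 \<Longrightarrow> bump \<delta> \<eta> \<eta>' \<Longrightarrow>
       (LBINT P. LBINT y. \<bar>h y - w P\<bar> * (\<eta> (fst P - y) * weight y * \<eta> (snd P))) \<le> e"
      using initial_error[OF hm M(3) w(1) M(1) initial e] by blast
    \<comment> \<open>The product kernel lives in a square of side \<open>\<delta>\<close>, whose
      points have norm at most \<open>2 * \<delta>\<close>; hence the halves.\<close>
    define \<delta> where "\<delta> = min (min (\<delta>1 / 2) (\<delta>2 / 2)) (min \<delta>3 1)"
    have \<delta>: "0 < \<delta>" "2 * \<delta> \<le> \<delta>1" "2 * \<delta> \<le> \<delta>2" "\<delta> \<le> \<delta>3" "\<delta> \<le> 1" using \<delta>1 \<delta>2 \<delta>3 by (auto simp: \<delta>_def)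
    obtain \<eta> \<eta>' where bump: "bump \<delta> \<eta> \<eta>'" using ex_bump[OF \<delta>(1)] by blast
    note \<eta> = bumpD[OF bump]
    define \<kappa> where "\<kappa> z = \<eta> (fst z) * \<eta> (snd z)" for z
    have \<kappa>: "has_bochner_integral lborel \<kappa> 1" "\<And>z. 0 \<le> \<kappa> z" "\<And>z. 2 * \<delta> < norm z \<Longrightarrow> \<kappa> z = 0"
    proof -
      show "has_bochner_integral lborel \<kappa> 1"
        unfolding \<kappa>_def using integrable_tensor[OF \<eta>(8) \<eta>(8)] \<eta>(9) by (simp add: has_bochner_integral_iff)
      show "0 \<le> \<kappa> z" for z unfolding \<kappa>_def using \<eta>(4) by simp
      show "\<kappa> z = 0" if "2 * \<delta> < norm z" for z
      proof -
        have "norm z \<le> \<bar>fst z\<bar> + \<bar>snd z\<bar>" using norm_Pair_le[of "fst z" "snd z"] by simp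
        then have "fst z \<notin> {0<..<\<delta>} \<or> snd z \<notin> {0<..<\<delta>}" using that by auto
        then show ?thesis unfolding \<kappa>_def using \<eta>(5) by auto
      qed
    qed
    have tf: "test_function (\<lambda>(x, t). \<eta> (x - y) * \<eta> (t - s))" if "0 < s" for y s
      by (rule bump_product_test_function[OF bump that])
    have sh: "((\<lambda>x. \<eta> (x - c)) has_real_derivative \<eta>' (x - c)) (at x)" for x c
      using DERIV_chain2[where f = \<eta> and g = "\<lambda>x. x - c" and x = x and Db = 1 and s = UNIV, OF \<eta>(1) DERIV_diff[OF DERIV_ident DERIV_const, simplified]] by simp
    have cs: "continuous_on UNIV (\<lambda>z. \<eta> (fst z - y))" "continuous_on UNIV (\<lambda>z. \<eta> (snd z - s))"
      "continuous_on UNIV (\<lambda>z. \<eta>' (fst z - y))" "continuous_on UNIV (\<lambda>z. \<eta>' (snd z - s))" for y s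
      by (auto intro!: continuous_on_compose2[OF \<eta>(3)] continuous_on_compose2[OF \<eta>(2)] continuous_intros)
    have uineq: "0 \<le> (LBINT z. kruzkov p \<beta> w k (\<lambda>z. \<eta> (fst z - y) * \<eta> (snd z - s))
        (\<lambda>z. \<eta> (fst z - y) * \<eta>' (snd z - s)) (\<lambda>z. \<eta>' (fst z - y) * \<eta> (snd z - s)) z)"
      if s: "0 < s" "s < T" for k y s
    proof -
      let ?\<phi> = "\<lambda>(x, t). \<eta> (x - y) * \<eta> (t - s)"
      have d1: "deriv (\<lambda>\<tau>. ?\<phi> (x, \<tau>)) t = \<eta> (x - y) * \<eta>' (t - s)" for x t
        using DERIV_cmult[OF sh[of s t], of "\<eta> (x - y)"] by (auto intro!: DERIV_imp_deriv)
      have d2: "deriv (\<lambda>y. ?\<phi> (y, t)) x = \<eta>' (x - y) * \<eta> (t - s)" for x t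
        using DERIV_cmult_right[OF sh[of y x], of "\<eta> (t - s)"] by (auto intro!: DERIV_imp_deriv)
      have "0 \<le> set_lebesgue_integral lebesgue (UNIV \<times> {0<..}) (\<lambda>(x, t).
               \<bar>u x t - k\<bar> * deriv (\<lambda>\<tau>. ?\<phi> (x, \<tau>)) t
             + sgn (u x t - k) * (flux p (u x t) - flux p k) * deriv (\<lambda>y. ?\<phi> (y, t)) x
             + sgn (u x t - k) * \<alpha> t * u x t * ?\<phi> (x, t))"
        by (rule es5[OF tf[OF s(1)]]) (use \<eta>(4) in auto)
      also have "\<dots> = set_lebesgue_integral lebesgue (UNIV \<times> {0<..}) (\<lambda>(x, t).
               \<bar>u x t - k\<bar> * (\<lambda>z. \<eta> (fst z - y) * \<eta>' (snd z - s)) (x, t)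
             + sgn (u x t - k) * (flux p (u x t) - flux p k) * (\<lambda>z. \<eta>' (fst z - y) * \<eta> (snd z - s)) (x, t)
             + sgn (u x t - k) * \<alpha> t * u x t * (\<lambda>z. \<eta> (fst z - y) * \<eta> (snd z - s)) (x, t))"
        unfolding d1 d2 by simp
      also have "\<dots> = (LBINT z. kruzkov p \<beta> w k (\<lambda>z. \<eta> (fst z - y) * \<eta> (snd z - s))
        (\<lambda>z. \<eta> (fst z - y) * \<eta>' (snd z - s)) (\<lambda>z. \<eta>' (fst z - y) * \<eta> (snd z - s)) z)"
      proof (rule entropy_integral_eq[OF w(1,3) \<beta>(1,3)])
        fix z :: "real \<times> real" assume "\<not> (0 < snd z \<and> snd z < T + 1)"
        then have "snd z - s \<notin> {0<..<\<delta>}" using s \<delta> by auto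
        then show "\<eta> (fst z - y) * \<eta> (snd z - s) = 0 \<and> \<eta>' (fst z - y) * \<eta> (snd z - s) = 0 \<and> \<eta> (fst z - y) * \<eta>' (snd z - s) = 0"
          using \<eta>(5,6) by simp
      qed (intro continuous_on_mult cs)+
      finally show ?thesis .
    qed
    have vineq: "0 \<le> (LBINT z. indicator {0<..<T} (snd z) * kruzkov p \<beta> V k (dual_test \<eta> T C x t)
          (dual_test_t \<eta> \<eta>' T C x t) (dual_test_x \<eta> \<eta>' T C x t) z)
        + (LBINT y. \<bar>h y - k\<bar> * dual_test \<eta> T C x t (y, 0))" for k x t
    proof -
      define \<phi> where "\<phi> = dual_test \<eta> T C x t"
      define \<phi>t where "\<phi>t = dual_test_t \<eta> \<eta>' T C x t"
      define \<phi>x where "\<phi>x = dual_test_x \<eta> \<eta>' T C x t"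
      note \<phi>_defs = \<phi>_def \<phi>t_def \<phi>x_def dual_test_def[abs_def] dual_test_t_def[abs_def] dual_test_x_def[abs_def]
      have rs: "((\<lambda>y. \<eta> (c - y)) has_real_derivative - \<eta>' (c - y)) (at y)" for c y
        using DERIV_chain2[where f = \<eta> and g = "\<lambda>y. c - y" and x = y and Db = "-1" and s = UNIV, OF \<eta>(1) DERIV_diff[OF DERIV_const DERIV_ident, simplified]] by simp
      have cr: "continuous_on UNIV (\<lambda>z. \<eta> (x - fst z))" "continuous_on UNIV (\<lambda>z. \<eta> (t - snd z))"
        "continuous_on UNIV (\<lambda>z. \<eta>' (x - fst z))" "continuous_on UNIV (\<lambda>z. \<eta>' (t - snd z))"
        "continuous_on UNIV (\<lambda>z. weight (fst z))" "continuous_on UNIV (\<lambda>z. weight' (fst z))"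
        by (auto intro!: continuous_on_compose2[OF \<eta>(3)] continuous_on_compose2[OF \<eta>(2)]
            continuous_on_compose2[OF continuous_on_weight(1)] continuous_on_compose2[OF continuous_on_weight(2)] continuous_intros)
      have "0 \<le> (LBINT z. indicator {0..T} (snd z) *
       kruzkov p \<beta> (wave p b \<beta>) k \<phi> \<phi>t \<phi>x z)
      + (LBINT y. \<bar>sawtooth p b y - k\<bar> * \<phi> (y, 0))"
      proof (rule wave_entropy_inequality[OF \<beta>(1,2) p T b, where R = "\<bar>x\<bar> + \<delta>"])
        show "((\<lambda>\<tau>. \<phi> (y, \<tau>)) has_real_derivative \<phi>t (y, s)) (at s)" for y s
          unfolding \<phi>_defs by (auto intro!: derivative_eq_intros rs simp: algebra_simps)
        show "((\<lambda>y. \<phi> (y, s)) has_real_derivative \<phi>x (y, s)) (at y)" for y s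
          unfolding \<phi>_defs by (auto intro!: derivative_eq_intros rs weight_has_derivative simp: algebra_simps)
        show "continuous_on UNIV \<phi>" "continuous_on UNIV \<phi>t" "continuous_on UNIV \<phi>x"
          unfolding \<phi>_defs by (intro continuous_intros cr)+
        show "0 \<le> \<phi> (y, s)" if "0 \<le> s" "s \<le> T" for y s
          unfolding \<phi>_defs using that \<eta>(4) weight_pos[of y] by simp
        show "\<phi> (y, T) = 0" for y by (simp add: \<phi>_defs)
        have "x - y \<notin> {0<..<\<delta>}" if "\<bar>x\<bar> + \<delta> < \<bar>y\<bar>" for y using that by auto
        then show "\<phi> (y, s) = 0" "\<phi>t (y, s) = 0" "\<phi>x (y, s) = 0" if "\<bar>x\<bar> + \<delta> < \<bar>y\<bar>" for y s
          using that \<eta>(5,6) unfolding \<phi>_defs by simp_all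
      qed
      also have "(LBINT z. indicator {0..T} (snd z) *
       kruzkov p \<beta> (wave p b \<beta>) k \<phi> \<phi>t \<phi>x z)
        = (LBINT z. indicator {0<..<T} (snd z) * kruzkov p \<beta> V k \<phi> \<phi>t \<phi>x z)"
      proof (rule integral_cong_AE)
        \<comment> \<open>The closed and the open strip differ by two null time levels, and on the
          open strip \<open>V\<close> is the wave.\<close>
        have "AE t in lborel. t \<noteq> 0 \<and> t \<noteq> T"
          using AE_lborel_singleton[of 0] AE_lborel_singleton[of T] by (rule AE_conjI)
        from AE_lborel_snd[OF this]
        show "AE z in lborel. indicator {0..T} (snd z) *
       kruzkov p \<beta> (wave p b \<beta>) k \<phi> \<phi>t \<phi>x z
        = indicator {0<..<T} (snd z) * kruzkov p \<beta> V k \<phi> \<phi>t \<phi>x z"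
          by eventually_elim (auto simp: kruzkov_def V_def indicator_def)
        have [measurable]: "\<phi> \<in> borel_measurable borel" "\<phi>t \<in> borel_measurable borel" "\<phi>x \<in> borel_measurable borel"
          unfolding \<phi>_defs
          by (intro borel_measurable_continuous_onI continuous_intros cr)+
        have Im': "(indicator {0..T} :: real \<Rightarrow> real) \<in> borel_measurable borel" by simp
        have [measurable]: "(\<lambda>z. wave p b \<beta> z) \<in> borel_measurable borel"
          unfolding wave_def h_def[symmetric]
          by (intro borel_measurable_times borel_measurable_fst_snd am hm)
        note [measurable] = borel_measurable_fst_snd(2)[OF Im']
        show "(\<lambda>z. indicator {0..T} (snd z) *
       kruzkov p \<beta> (wave p b \<beta>) k \<phi> \<phi>t \<phi>x z) \<in> borel_measurable lborel"
          unfolding kruzkov_def by measurable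
        show "(\<lambda>z. indicator {0<..<T} (snd z) * kruzkov p \<beta> V k \<phi> \<phi>t \<phi>x z) \<in> borel_measurable lborel"
          unfolding kruzkov_def by measurable
      qed
      finally show ?thesis unfolding \<phi>_def \<phi>t_def \<phi>x_def h_def .
    qed
    define \<gamma> where "\<gamma> = strip_weight T"
    have \<gamma>: "integrable lborel \<gamma>" "\<And>z. 0 \<le> \<gamma> z" unfolding \<gamma>_def by (rule integrable_strip_weight, rule strip_weight_bounds)
    define E where "E = (\<integral>(P, Q). \<kappa> (P - Q) * \<gamma> Q * \<bar>w P - V Q\<bar> \<partial>(lborel \<Otimes>\<^sub>M lborel))"
    have "exp (- C * T) * E \<le> T * M * (\<integral>(P, Q). \<kappa> (P - Q) * \<gamma> Q * \<bar>\<beta> (snd P) - \<beta> (snd Q)\<bar> \<partial>(lborel \<Otimes>\<^sub>M lborel))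
      + T * (LBINT P. LBINT y. \<bar>h y - w P\<bar> * (\<eta> (fst P - y) * weight y * \<eta> (snd P)))"
      using doubling_inequality[OF p T bump w(1) Vm \<beta>(1) hm M \<beta>(2) C_def uineq vineq]
      by (simp add: E_def \<kappa>_def \<gamma>_def)
    also have "\<dots> \<le> T * M * e + T * e"
    proof (intro add_mono mult_left_mono)
      show "(\<integral>(P, Q). \<kappa> (P - Q) * \<gamma> Q * \<bar>\<beta> (snd P) - \<beta> (snd Q)\<bar> \<partial>(lborel \<Otimes>\<^sub>M lborel)) \<le> e"
      proof (rule integral_convolution_kernel_le[OF borel_measurable_fst_snd(2)[OF \<beta>(1)] \<beta>(2) \<kappa> \<gamma>])
        show "norm z' \<le> 2 * \<delta> \<Longrightarrow> (LBINT z. \<bar>\<beta> (snd (z + z')) - \<beta> (snd z)\<bar> * \<gamma> z) \<le> e" for z'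
          unfolding \<gamma>_def using \<delta>2(2)[of z'] \<delta> by simp
      qed
      show "(LBINT P. LBINT y. \<bar>h y - w P\<bar> * (\<eta> (fst P - y) * weight y * \<eta> (snd P))) \<le> e"
        by (rule \<delta>3(2)[OF \<delta>(4) bump])
    qed (use T M0 in auto)
    finally have "E \<le> exp (C * T) * ((T * M + T) * e)"
      by (simp add: exp_minus field_simps)
    moreover have "(\<integral>(P, Q). \<kappa> (P - Q) * \<gamma> Q * \<bar>w P - w Q\<bar> \<partial>(lborel \<Otimes>\<^sub>M lborel)) \<le> e"
    proof (rule integral_convolution_kernel_le[OF w(1) M(1) \<kappa> \<gamma>])
      show "norm z' \<le> 2 * \<delta> \<Longrightarrow> (LBINT z. \<bar>w (z + z') - w z\<bar> * \<gamma> z) \<le> e" for z'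
        unfolding \<gamma>_def using \<delta>1(2)[of z'] \<delta> by simp
    qed
    \<comment> \<open>The left-hand side is spread over the doubled space by the unit mass of
      \<open>\<kappa>\<close>; then the triangle inequality through \<open>w P\<close> is
      applied.\<close>
    moreover have "(LBINT z. \<bar>w z - V z\<bar> * \<gamma> z) \<le> (\<integral>(P, Q). \<kappa> (P - Q) * \<gamma> Q * \<bar>w P - w Q\<bar> \<partial>(lborel \<Otimes>\<^sub>M lborel)) + E"
    proof -
      have \<kappa>i: "integrable lborel \<kappa>" "integral\<^sup>L lborel \<kappa> = 1" using \<kappa>(1) by (auto simp: has_bochner_integral_iff)
      have \<kappa>m: "\<kappa> \<in> borel_measurable borel" using \<kappa>i(1) by auto
      have bd: "\<bar>\<bar>w z - w z'\<bar>\<bar> \<le> 2 * M" "\<bar>\<bar>w z - V z'\<bar>\<bar> \<le> 2 * M" for z z'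
        using M(1)[of z] M(1)[of z'] M(2)[of z'] by simp_all
      note [measurable] = borel_measurable_pair[OF w(1)] borel_measurable_pair[OF Vm]
      have i1: "integrable (lborel \<Otimes>\<^sub>M lborel) (\<lambda>z. \<bar>w (fst z) - w (snd z)\<bar> * (\<kappa> (fst z - snd z) * \<gamma> (snd z)))"
        by (intro integrable_bounded_kernel[where C = "2 * M"] \<kappa>i \<gamma> bd) measurable
      have i2: "integrable (lborel \<Otimes>\<^sub>M lborel) (\<lambda>z. \<bar>w (fst z) - V (snd z)\<bar> * (\<kappa> (fst z - snd z) * \<gamma> (snd z)))"
        by (intro integrable_bounded_kernel[where C = "2 * M"] \<kappa>i \<gamma> bd) measurable
      have i3: "integrable (lborel \<Otimes>\<^sub>M lborel) (\<lambda>z. \<bar>w (snd z) - V (snd z)\<bar> * (\<kappa> (fst z - snd z) * \<gamma> (snd z)))"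
        by (intro integrable_bounded_kernel[where C = "2 * M"] \<kappa>i \<gamma> bd) measurable
      have i3': "integrable (lborel \<Otimes>\<^sub>M lborel) (\<lambda>(P, Q). \<bar>w Q - V Q\<bar> * (\<kappa> (P - Q) * \<gamma> Q))"
        using i3 by (simp add: case_prod_unfold)
      have \<kappa>1: "(LBINT P. \<kappa> (P - Q)) = 1" for Q
        using integral_translate[OF \<kappa>m, of "- Q"] \<kappa>i(2) by simp
      have "(LBINT z. \<bar>w z - V z\<bar> * \<gamma> z) = (\<integral>z. \<bar>w (snd z) - V (snd z)\<bar> * (\<kappa> (fst z - snd z) * \<gamma> (snd z)) \<partial>(lborel \<Otimes>\<^sub>M lborel))"
        using lborel_pair.integral_snd[OF i3'] by (simp add: case_prod_unfold \<kappa>1)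
      also have "\<dots> \<le> (\<integral>z. \<bar>w (fst z) - w (snd z)\<bar> * (\<kappa> (fst z - snd z) * \<gamma> (snd z)) + \<bar>w (fst z) - V (snd z)\<bar> * (\<kappa> (fst z - snd z) * \<gamma> (snd z)) \<partial>(lborel \<Otimes>\<^sub>M lborel))"
      proof (rule integral_mono[OF i3 Bochner_Integration.integrable_add[OF i1 i2]])
        fix z
        have "\<bar>w (snd z) - V (snd z)\<bar> * (\<kappa> (fst z - snd z) * \<gamma> (snd z))
           \<le> (\<bar>w (fst z) - w (snd z)\<bar> + \<bar>w (fst z) - V (snd z)\<bar>) * (\<kappa> (fst z - snd z) * \<gamma> (snd z))"
          using \<kappa>(2) \<gamma>(2) by (intro mult_right_mono) auto
        then show "\<bar>w (snd z) - V (snd z)\<bar> * (\<kappa> (fst z - snd z) * \<gamma> (snd z))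
           \<le> \<bar>w (fst z) - w (snd z)\<bar> * (\<kappa> (fst z - snd z) * \<gamma> (snd z)) + \<bar>w (fst z) - V (snd z)\<bar> * (\<kappa> (fst z - snd z) * \<gamma> (snd z))"
          by (simp add: algebra_simps)
      qed
      also have "\<dots> = (\<integral>z. \<bar>w (fst z) - w (snd z)\<bar> * (\<kappa> (fst z - snd z) * \<gamma> (snd z)) \<partial>(lborel \<Otimes>\<^sub>M lborel))
          + (\<integral>z. \<bar>w (fst z) - V (snd z)\<bar> * (\<kappa> (fst z - snd z) * \<gamma> (snd z)) \<partial>(lborel \<Otimes>\<^sub>M lborel))"
        by (rule Bochner_Integration.integral_add[OF i1 i2])
      finally show ?thesis unfolding E_def by (simp add: case_prod_unfold mult_ac)
    qed
    ultimately have "(LBINT z. \<bar>w z - V z\<bar> * \<gamma> z) \<le> e + exp (C * T) * ((T * M + T) * e)" by linarith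
    also have "\<dots> = e * (1 + exp (C * T) * (T * M + T))" by (simp add: algebra_simps)
    also have "\<dots> = \<epsilon>" using den by (simp add: e_def)
    finally show ?thesis unfolding \<gamma>_def .
  qed
  have int: "integrable lborel (\<lambda>z. \<bar>w z - V z\<bar> * strip_weight T z)"
  proof (rule integrable_bounded_mult[OF integrable_strip_weight, where C = "2 * M"])
    show "\<bar>\<bar>w z - V z\<bar>\<bar> \<le> 2 * M" for z using M(1)[of z] M(2)[of z] by simp
  qed measurable
  have nn: "0 \<le> \<bar>w z - V z\<bar> * strip_weight T z" for z using strip_weight_bounds(1)[of T z] by simp
  have "(LBINT z. \<bar>w z - V z\<bar> * strip_weight T z) \<le> 0"
    by (rule field_le_epsilon) (use key in simp)
  moreover have "0 \<le> (LBINT z. \<bar>w z - V z\<bar> * strip_weight T z)"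
    using nn by (rule Bochner_Integration.integral_nonneg)
  ultimately have "(LBINT z. \<bar>w z - V z\<bar> * strip_weight T z) = 0" by simp
  then have "AE z in lborel. \<bar>w z - V z\<bar> * strip_weight T z = 0"
    by (subst (asm) integral_nonneg_eq_0_iff_AE[OF int]) (use nn in simp_all)
  with w(3) show ?thesis
  proof eventually_elim
    case (elim z)
    show ?case
    proof
      assume z: "0 < snd z \<and> snd z < T"
      then have "strip_weight T z \<noteq> 0" using weight_pos[of "fst z"] by (simp add: strip_weight_def)
      then have "w z = V z" using elim by simp
      then show "u (fst z) (snd z) = wave p b \<beta> z" using z elim by (simp add: V_def)
    qed
  qed
qed

section \<open>Fractional variation of the profile\<close>

lemma AE_ex_in_interval:
  fixes P :: "real \<Rightarrow> bool"
  assumes "AE x in lborel. P x" "c < d"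
  shows "\<exists>x. c < x \<and> x < d \<and> P x"
proof (rule ccontr)
  assume "\<not> ?thesis"
  then have "AE x in lborel. x \<notin> {c<..<d}"
    using assms(1) by (auto elim: eventually_mono)
  then have "emeasure lborel {c<..<d} = 0"
    by (subst (asm) AE_iff_measurable[of "{c<..<d}"]) auto
  then show False using assms(2) by simp
qed

text \<open>Writing \<open>z^p = z * z^(p - 1)\<close>, both powers \<open>(x - y)^(p - 1)\<close>
  and \<open>y^(p - 1)\<close> are at most \<open>x^(p - 1)\<close>.\<close>

lemma powr_superadditive:
  fixes x y p :: real
  assumes "1 \<le> p" "0 \<le> y" "y \<le> x"
  shows "(x - y) powr p \<le> x powr p - y powr p"
proof -
  have e: "z powr p = z * z powr (p - 1)" if "0 \<le> z" for z :: real
    using powr_mult_base[OF that, of "p - 1"] by simp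
  have "(x - y) * (x - y) powr (p - 1) + y * y powr (p - 1) \<le> (x - y) * x powr (p - 1) + y * x powr (p - 1)"
    using assms by (intro add_mono mult_left_mono powr_mono2) auto
  also have "\<dots> = x * x powr (p - 1)" by (simp add: algebra_simps)
  finally show ?thesis using assms by (simp add: e)
qed

text \<open>This is the characteristic speed, that is, the derivative of the flux.\<close>

definition signed_powr :: "real \<Rightarrow> real \<Rightarrow> real" where
  "signed_powr x p = sgn x * \<bar>x\<bar> powr p"

text \<open>For equal signs superadditivity gives constant one. For opposite signs the distance is
  at most twice the larger modulus, which is where \<open>2 powr p\<close> comes from.\<close>

lemma abs_diff_powr_le:
  assumes "1 \<le> p"
  shows "\<bar>x - y\<bar> powr p \<le> 2 powr p * \<bar>signed_powr x p - signed_powr y p\<bar>"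
proof -
  have *: "\<bar>x - y\<bar> powr p \<le> 2 powr p * \<bar>signed_powr x p - signed_powr y p\<bar>" if "\<bar>y\<bar> \<le> \<bar>x\<bar>" for x y
  proof (cases "0 \<le> x * y")
    case True
    then have 1: "\<bar>x - y\<bar> = \<bar>x\<bar> - \<bar>y\<bar>" using that
      by (auto simp: zero_le_mult_iff)
    have 2: "\<bar>signed_powr x p - signed_powr y p\<bar> = \<bar>x\<bar> powr p - \<bar>y\<bar> powr p"
    proof -
      have "\<bar>y\<bar> powr p \<le> \<bar>x\<bar> powr p" using that assms by (intro powr_mono2) auto
      then show ?thesis using True that
        by (cases "x = 0"; cases "y = 0") (auto simp: signed_powr_def sgn_if zero_le_mult_iff)
    qed
    have "(\<bar>x\<bar> - \<bar>y\<bar>) powr p \<le> 1 * (\<bar>x\<bar> powr p - \<bar>y\<bar> powr p)"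
      using powr_superadditive[OF assms, of "\<bar>y\<bar>" "\<bar>x\<bar>"] that by simp
    also have "\<dots> \<le> 2 powr p * (\<bar>x\<bar> powr p - \<bar>y\<bar> powr p)"
      using that assms by (intro mult_right_mono) (auto intro!: powr_mono2 ge_one_powr_ge_zero)
    finally show ?thesis unfolding 1 2 .
  next
    case False
    have "\<bar>x - y\<bar> powr p \<le> (2 * \<bar>x\<bar>) powr p" using that assms by (intro powr_mono2) auto
    also have "\<dots> = 2 powr p * \<bar>x\<bar> powr p" by (simp add: powr_mult)
    also have "\<dots> \<le> 2 powr p * \<bar>signed_powr x p - signed_powr y p\<bar>"
    proof (intro mult_left_mono)
      have "0 \<le> \<bar>y\<bar> powr p" by simp
      then show "\<bar>x\<bar> powr p \<le> \<bar>signed_powr x p - signed_powr y p\<bar>"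
      proof (cases "0 < x")
        case True
        then have "y < 0" using False by (simp add: not_le mult_less_0_iff)
        then have "signed_powr x p = \<bar>x\<bar> powr p" "signed_powr y p = - (\<bar>y\<bar> powr p)"
          using True by (simp_all add: signed_powr_def)
        then show ?thesis using \<open>0 \<le> \<bar>y\<bar> powr p\<close> by linarith
      next
        case x: False
        then have "x < 0" "0 < y" using False by (auto simp: not_le mult_less_0_iff)
        then have "signed_powr x p = - (\<bar>x\<bar> powr p)" "signed_powr y p = \<bar>y\<bar> powr p"
          by (simp_all add: signed_powr_def)
        then show ?thesis using \<open>0 \<le> \<bar>y\<bar> powr p\<close> by linarith
      qed
    qed simp
    finally show ?thesis .
  qed
  show ?thesis
    using *[of y x] *[of x y] by (cases "\<bar>y\<bar> \<le> \<bar>x\<bar>") (auto simp: abs_minus_commute)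
qed

definition clamp_node :: "(nat \<Rightarrow> real) \<Rightarrow> real \<Rightarrow> real \<Rightarrow> real" where
  "clamp_node b L x = max (b 0) (min L x)"

text \<open>The signed power of the profile has slope one on each branch. Subtracting it from the
  clamped identity leaves a nondecreasing step function with value \<open>b n\<close> on the left
  half of a cell and \<open>b (Suc n)\<close> on the right half. Clamping keeps both monotone
  functions bounded.\<close>

definition jump :: "real \<Rightarrow> (nat \<Rightarrow> real) \<Rightarrow> real \<Rightarrow> real \<Rightarrow> real" where
  "jump p b L x = clamp_node b L x - signed_powr (sawtooth p b x) p"

lemma jump_cell:
  assumes p: "0 < p" and b: "strict_mono b" "b \<longlonglongrightarrow> L" and x: "x \<in> {b n..<b (Suc n)}"
  shows "jump p b L x = (if x < (b n + b (Suc n)) / 2 then b n else b (Suc n))"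
proof -
  have "b 0 \<le> b n" using b(1) by (simp add: strict_mono_less_eq)
  then have c: "clamp_node b L x = x"
    using x strict_mono_less_limit[OF b, of "Suc n"] by (auto simp: clamp_node_def)
  have h: "sawtooth p b x = tooth p (b n) (b (Suc n)) x" by (rule sawtooth_cell[OF b(1) x])
  show ?thesis
  proof (cases "x < (b n + b (Suc n)) / 2")
    case True
    then have t: "sawtooth p b x = (x - b n) powr (1 / p)" using x by (simp add: h tooth_def)
    show ?thesis
    proof (cases "x = b n")
      case False
      then have "0 < x - b n" using x by simp
      then show ?thesis using True p by (simp add: jump_def c t signed_powr_def powr_powr)
    next
      case eq: True
      then have "sawtooth p b x = 0" using t by simp
      then show ?thesis using True eq c by (simp add: jump_def signed_powr_def)
    qed
  next
    case False
    then have t: "sawtooth p b x = - ((b (Suc n) - x) powr (1 / p))" using x by (simp add: h tooth_def)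
    have "0 < b (Suc n) - x" using x by simp
    then show ?thesis using False p by (simp add: jump_def c t signed_powr_def powr_powr)
  qed
qed

lemma jump_outside:
  assumes b: "strict_mono b" "b \<longlonglongrightarrow> L" and "x \<notin> {b 0..<L}"
  shows "jump p b L x = (if x < b 0 then b 0 else L)"
  using sawtooth_outside[OF assms] assms(3) strict_mono_less_limit[OF b, of 0]
  by (auto simp: jump_def signed_powr_def clamp_node_def)

lemma jump_bounds:
  assumes p: "0 < p" and b: "strict_mono b" "b \<longlonglongrightarrow> L"
  shows "b 0 \<le> jump p b L x" "jump p b L x \<le> L"
proof -
  have "b 0 \<le> jump p b L x \<and> jump p b L x \<le> L"
  proof (cases "x \<in> {b 0..<L}")
    case True
    then obtain n where n: "x \<in> {b n..<b (Suc n)}" using ex_cell[OF b(2)] by auto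
    have "b 0 \<le> b n" "b 0 \<le> b (Suc n)" using b(1) by (simp_all add: strict_mono_less_eq)
    then show ?thesis using jump_cell[OF p b n] strict_mono_less_limit[OF b, of n] strict_mono_less_limit[OF b, of "Suc n"]
      by auto
  next
    case False
    then show ?thesis using jump_outside[OF b False] strict_mono_less_limit[OF b, of 0] by auto
  qed
  then show "b 0 \<le> jump p b L x" "jump p b L x \<le> L" by auto
qed

lemma jump_mono:
  assumes p: "0 < p" and b: "strict_mono b" "b \<longlonglongrightarrow> L" and "x \<le> y"
  shows "jump p b L x \<le> jump p b L y"
proof (cases "x \<in> {b 0..<L} \<and> y \<in> {b 0..<L}")
  case True
  then obtain n m where n: "x \<in> {b n..<b (Suc n)}" and m: "y \<in> {b m..<b (Suc m)}"
    using ex_cell[OF b(2)] by (meson atLeastLessThan_iff)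
  have "b n < b (Suc m)" using n m \<open>x \<le> y\<close> by auto
  then have "n \<le> m" using b(1) by (simp add: strict_mono_less)
  show ?thesis
  proof (cases "n = m")
    case True
    moreover have "b n < b (Suc n)" using b(1) by (simp add: strict_mono_less)
    ultimately show ?thesis using jump_cell[OF p b n] jump_cell[OF p b m] \<open>x \<le> y\<close> by auto
  next
    case False
    then have "b (Suc n) \<le> b m" "b n \<le> b m" "b m \<le> b (Suc m)"
      using b(1) \<open>n \<le> m\<close> by (auto simp: strict_mono_less_eq)
    then show ?thesis using jump_cell[OF p b n] jump_cell[OF p b m] by auto
  qed
next
  case False
  then show ?thesis
    using jump_outside[OF b, of x] jump_outside[OF b, of y] jump_bounds[OF p b, of x] jump_bounds[OF p b, of y] \<open>x \<le> y\<close>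
      strict_mono_less_limit[OF b, of 0]
    by (cases "x \<in> {b 0..<L}"; cases "y \<in> {b 0..<L}") (auto split: if_splits)
qed

lemma sum_telescope_from_2:
  fixes g :: "nat \<Rightarrow> real"
  shows "1 \<le> n \<Longrightarrow> (\<Sum>i = 2..n. g i - g (i - 1)) = g n - g 1"
proof (induction n rule: dec_induct)
  case (step n)
  then show ?case by (simp add: sum.atLeast_Suc_atMost numeral_2_eq_2)
qed simp

text \<open>Increments of the signed power are dominated by those of the sum \<open>W\<close> of the
  two monotone functions, and the latter telescope. Since \<open>TV\<close> is an infimum, bounding
  the explicit representative is enough.\<close>

lemma TV_sawtooth_finite:
  assumes p: "1 \<le> p" and b: "strict_mono b" "b \<longlonglongrightarrow> L"
    and v: "AE x in lebesgue. v x = c * sawtooth p b x"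
  shows "TV (1 / p) v < \<infinity>"
proof -
  define h where "h = sawtooth p b"
  define W where "W x = clamp_node b L x + jump p b L x" for x
  have p0: "0 < p" using p by simp
  have Wm: "W x \<le> W y" if "x \<le> y" for x y
    unfolding W_def clamp_node_def using jump_mono[OF p0 b that] that by (intro add_mono) auto
  have Wb: "2 * b 0 \<le> W x" "W x \<le> 2 * L" for x
    unfolding W_def clamp_node_def using jump_bounds[OF p0 b, of x] strict_mono_less_limit[OF b, of 0] by auto
  define K where "K = \<bar>c\<bar> powr p * 2 powr p"
  have K: "0 \<le> K" by (simp add: K_def)
  have step: "\<bar>c * h y - c * h x\<bar> powr p \<le> K * (W y - W x)" if "x \<le> y" for x y
  proof -
    have "\<bar>c * h y - c * h x\<bar> powr p = \<bar>c\<bar> powr p * \<bar>h y - h x\<bar> powr p"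
      by (simp add: abs_mult powr_mult flip: right_diff_distrib)
    also have "\<dots> \<le> \<bar>c\<bar> powr p * (2 powr p * \<bar>signed_powr (h y) p - signed_powr (h x) p\<bar>)"
      by (intro mult_left_mono abs_diff_powr_le p) simp
    also have "\<dots> \<le> \<bar>c\<bar> powr p * (2 powr p * (W y - W x))"
    proof (intro mult_left_mono)
      have "signed_powr (h x) p = clamp_node b L x - jump p b L x"
        "signed_powr (h y) p = clamp_node b L y - jump p b L y"
        by (simp_all add: jump_def h_def)
      moreover have "clamp_node b L x \<le> clamp_node b L y" using that by (auto simp: clamp_node_def)
      moreover have "jump p b L x \<le> jump p b L y" by (rule jump_mono[OF p0 b that])
      ultimately show "\<bar>signed_powr (h y) p - signed_powr (h x) p\<bar> \<le> W y - W x"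
        unfolding W_def by linarith
    qed auto
    finally show ?thesis by (simp add: K_def mult.assoc)
  qed
  have "TV_fun (1 / p) (\<lambda>x. c * h x) \<le> ennreal (K * (2 * L - 2 * b 0))"
    unfolding TV_fun_def
  proof (rule SUP_least, clarify)
    fix n :: nat and x :: "nat \<Rightarrow> real" assume n: "2 \<le> n" and x: "strict_mono_on {1..n} x"
    have "(\<Sum>i = 2..n. \<bar>c * h (x i) - c * h (x (i - 1))\<bar> powr (1 / (1 / p))) \<le> (\<Sum>i = 2..n. K * (W (x i) - W (x (i - 1))))"
    proof (rule sum_mono)
      fix i assume i: "i \<in> {2..n}"
      then have "x (i - 1) < x i" using x by (intro strict_mono_onD[OF x]) auto
      then show "\<bar>c * h (x i) - c * h (x (i - 1))\<bar> powr (1 / (1 / p)) \<le> K * (W (x i) - W (x (i - 1)))"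
        using step[of "x (i - 1)" "x i"] by simp
    qed
    also have "\<dots> = K * (\<Sum>i = 2..n. W (x i) - W (x (i - 1)))" by (simp add: sum_distrib_left)
    also have "\<dots> = K * (W (x n) - W (x 1))"
      using sum_telescope_from_2[of n "\<lambda>i. W (x i)"] n by simp
    also have "\<dots> \<le> K * (2 * L - 2 * b 0)" using K Wb[of "x n"] Wb[of "x 1"] by (intro mult_left_mono) auto
    finally show "ennreal (\<Sum>i = 2..n. \<bar>c * h (x i) - c * h (x (i - 1))\<bar> powr (1 / (1 / p))) \<le> ennreal (K * (2 * L - 2 * b 0))"
      by (rule ennreal_leI)
  qed
  moreover have "TV (1 / p) v \<le> TV_fun (1 / p) (\<lambda>x. c * h x)"
    unfolding TV_def using v by (intro INF_lower) (auto simp: h_def elim: eventually_mono)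
  ultimately have "TV (1 / p) v \<le> ennreal (K * (2 * L - 2 * b 0))" by (rule order_trans[rotated])
  then show ?thesis by (rule order.strict_trans1) simp
qed

text \<open>Every representative has to be treated, so the partition points depend on it: they are
  taken from the set of full measure where it agrees with the profile, one on each side of every
  midpoint. All jumps then enter one interlaced partition, each contributing a fixed multiple of
  \<open>g n powr (1 / (p * \<sigma>))\<close>.\<close>

lemma TV_sawtooth_infinite:
  assumes p: "0 < p" and b: "strict_mono b" "b \<longlonglongrightarrow> L" and c: "0 < c" and \<sigma>: "0 < \<sigma>"
    and v: "AE x in lebesgue. v x = c * sawtooth p b x"
    and div: "\<not> summable (\<lambda>n. (b (Suc n) - b n) powr (1 / (p * \<sigma>)))"
  shows "TV \<sigma> v = \<infinity>"
proof -
  define g where "g n = b (Suc n) - b n" for n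
  define m where "m n = (b n + b (Suc n)) / 2" for n
  have g: "0 < g n" for n using b(1) by (simp add: g_def strict_mono_less)
  have mb: "m n - b n = g n / 2" "b (Suc n) - m n = g n / 2" for n by (simp_all add: m_def g_def field_simps)
  have "TV_fun \<sigma> w = \<infinity>" if w: "AE x in lebesgue. w x = v x" for w
  proof -
    have "AE x in lebesgue. w x = c * sawtooth p b x" using w v by eventually_elim simp
    then have ae: "AE x in lborel. w x = c * sawtooth p b x" by (simp only: AE_completion_iff)
    \<comment> \<open>A point within a quarter of the gap from the midpoint is still farther than a
      quarter from the end of the cell, so the profile keeps a fixed fraction of its height.\<close>
    have "\<exists>y. m n - g n / 4 < y \<and> y < m n \<and> w y = c * sawtooth p b y" for n
      using AE_ex_in_interval[OF ae, of "m n - g n / 4" "m n"] g[of n] by simp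
    then obtain y where y: "\<And>n. m n - g n / 4 < y n" "\<And>n. y n < m n" "\<And>n. w (y n) = c * sawtooth p b (y n)"
      by metis
    have "\<exists>z. m n < z \<and> z < m n + g n / 4 \<and> w z = c * sawtooth p b z" for n
      using AE_ex_in_interval[OF ae, of "m n" "m n + g n / 4"] g[of n] by simp
    then obtain z where z: "\<And>n. m n < z n" "\<And>n. z n < m n + g n / 4" "\<And>n. w (z n) = c * sawtooth p b (z n)"
      by metis
    define e where "e = 1 / \<sigma>"
    have e: "0 < e" using \<sigma> by (simp add: e_def)
    define D where "D = (c * (1 / 4) powr (1 / p)) powr e"
    have D: "0 < D" using c by (simp add: D_def)
    have osc: "D * g n powr (1 / (p * \<sigma>)) \<le> \<bar>w (z n) - w (y n)\<bar> powr e" for n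
    proof -
      have yc: "y n \<in> {b n..<b (Suc n)}" "z n \<in> {b n..<b (Suc n)}"
        using y(1,2)[of n] z(1,2)[of n] mb[of n] g[of n] by auto
      have "sawtooth p b (y n) = (y n - b n) powr (1 / p)"
        using sawtooth_cell[OF b(1) yc(1)] y(2)[of n] yc(1) by (simp add: tooth_def m_def)
      moreover have "(g n / 4) powr (1 / p) \<le> (y n - b n) powr (1 / p)"
        using y(1)[of n] mb[of n] g[of n] p by (intro powr_mono2) auto
      ultimately have 1: "(g n / 4) powr (1 / p) \<le> sawtooth p b (y n)" by simp
      have "sawtooth p b (z n) = - ((b (Suc n) - z n) powr (1 / p))"
        using sawtooth_cell[OF b(1) yc(2)] z(1)[of n] yc(2) by (simp add: tooth_def m_def)
      then have 2: "sawtooth p b (z n) \<le> 0" by simp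
      have "c * (g n / 4) powr (1 / p) \<le> c * (sawtooth p b (y n) - sawtooth p b (z n))"
        using 1 2 c by (intro mult_left_mono) auto
      also have "\<dots> \<le> \<bar>w (z n) - w (y n)\<bar>" unfolding y(3) z(3) by (simp add: algebra_simps)
      finally have "(c * (g n / 4) powr (1 / p)) powr e \<le> \<bar>w (z n) - w (y n)\<bar> powr e"
        using c e by (intro powr_mono2) auto
      moreover have "(c * (g n / 4) powr (1 / p)) powr e = D * g n powr (1 / (p * \<sigma>))"
        unfolding D_def e_def using c g[of n] by (simp add: powr_mult powr_powr powr_divide field_simps)
      ultimately show ?thesis by simp
    qed
    \<comment> \<open>The points interlace as \<open>y 0 < z 0 < y 1 < z 1 < ...\<close> because
      each pair stays inside its own cell.\<close>
    define X where "X k = (if even k then y (k div 2) else z (k div 2))" for k :: nat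
    have Xm: "strict_mono X"
      unfolding strict_mono_Suc_iff
    proof
      fix k
      show "X k < X (Suc k)"
      proof (cases "even k")
        case True
        then have "Suc k div 2 = k div 2" by simp
        then show ?thesis using True y(2)[of "k div 2"] z(1)[of "k div 2"] by (simp add: X_def)
      next
        case False
        then have *: "Suc k div 2 = Suc (k div 2)" by (simp add: odd_Suc_div_two)
        have "z n < y (Suc n)" for n
        proof -
          have "z n < b (Suc n)" using z(2)[of n] mb(2)[of n] g[of n] by linarith
          moreover have "b (Suc n) < y (Suc n)" using y(1)[of "Suc n"] mb(1)[of "Suc n"] g[of "Suc n"] by linarith
          ultimately show ?thesis by simp
        qed
        then show ?thesis using False * by (simp add: X_def)
      qed
    qed
    \<comment> \<open>Partitions are indexed from one, so that \<open>x (2 * n + 1) = y n\<close>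
      and \<open>x (2 * n + 2) = z n\<close>.\<close>
    define x where "x i = X (i - 1)" for i
    have bound: "ennreal (\<Sum>n<N. D * g n powr (1 / (p * \<sigma>))) \<le> TV_fun \<sigma> w" if "1 \<le> N" for N
    proof -
      have "(\<Sum>n<N. D * g n powr (1 / (p * \<sigma>))) \<le> (\<Sum>n<N. \<bar>w (x (2 * n + 2)) - w (x (2 * n + 2 - 1))\<bar> powr e)"
        by (intro sum_mono) (use osc in \<open>simp add: x_def X_def\<close>)
      also have "\<dots> = (\<Sum>i\<in>(\<lambda>n. 2 * n + 2) ` {..<N}. \<bar>w (x i) - w (x (i - 1))\<bar> powr e)"
        by (subst sum.reindex) (auto simp: inj_on_def)
      \<comment> \<open>Only even indices carry a jump from \<open>y n\<close> to
        \<open>z n\<close>; the remaining increments are nonnegative and are added.\<close>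
      also have "\<dots> \<le> (\<Sum>i = 2..2 * N. \<bar>w (x i) - w (x (i - 1))\<bar> powr e)"
        by (rule sum_mono2) auto
      finally have "ennreal (\<Sum>n<N. D * g n powr (1 / (p * \<sigma>))) \<le> ennreal (\<Sum>i = 2..2 * N. \<bar>w (x i) - w (x (i - 1))\<bar> powr (1 / \<sigma>))"
        unfolding e_def by (rule ennreal_leI)
      also have "\<dots> \<le> TV_fun \<sigma> w"
        unfolding TV_fun_def
      proof (rule SUP_upper2[of "(2 * N, x)"])
        have "strict_mono_on {1..2 * N} x"
          unfolding strict_mono_on_def x_def using strict_monoD[OF Xm] by auto
        then show "(2 * N, x) \<in> {(n, x). 2 \<le> n \<and> strict_mono_on {1..n} x}" using that by auto
      qed simp
      finally show ?thesis .
    qed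
    show ?thesis
    proof (rule ccontr)
      assume "TV_fun \<sigma> w \<noteq> \<infinity>"
      then obtain C where C: "0 \<le> C" "TV_fun \<sigma> w = ennreal C" by (cases "TV_fun \<sigma> w") auto
      have "summable (\<lambda>n. D * g n powr (1 / (p * \<sigma>)))"
      proof (rule summableI_nonneg_bounded)
        show "0 \<le> D * g n powr (1 / (p * \<sigma>))" for n using D by simp
        fix N
        have "ennreal (\<Sum>n<Suc N. D * g n powr (1 / (p * \<sigma>))) \<le> ennreal C" using bound[of "Suc N"] C by simp
        then have "(\<Sum>n<Suc N. D * g n powr (1 / (p * \<sigma>))) \<le> C" using C(1) by (simp add: ennreal_le_iff)
        moreover have "0 \<le> D * g N powr (1 / (p * \<sigma>))" using D by simp
        ultimately show "(\<Sum>n<N. D * g n powr (1 / (p * \<sigma>))) \<le> C" by simp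
      qed
      then have "summable (\<lambda>n. g n powr (1 / (p * \<sigma>)))" using D by simp
      then show False using div by (simp add: g_def)
    qed
  qed
  then have "TV \<sigma> v = (INF w \<in> {w. AE x in lebesgue. w x = v x}. \<infinity>)"
    unfolding TV_def by (intro INF_cong) auto
  moreover have "{w. AE x in lebesgue. w x = v x} \<noteq> {}" by (auto intro: exI[of _ v])
  ultimately show ?thesis by simp
qed

section \<open>Logarithmic nodes\<close>

definition log_node :: "nat \<Rightarrow> real" where "log_node n = - 1 / ln (real n + 2)"

lemma strict_mono_log_node: "strict_mono log_node"
  unfolding strict_mono_Suc_iff log_node_def by (auto simp: frac_less2)

lemma log_node_tendsto: "log_node \<longlonglongrightarrow> 0"
  unfolding log_node_def by real_asymp

text \<open>The gaps behave like \<open>1 / (n * (ln n)^2)\<close>: they sum to a finite length, but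
  a power \<open>r < 1\<close> gains \<open>n^(1 - r)\<close> over the harmonic series, which beats
  every power of the logarithm.\<close>

lemma log_node_gaps_not_summable:
  assumes "0 < r" "r < 1"
  shows "\<not> summable (\<lambda>n. (log_node (Suc n) - log_node n) powr r)"
proof
  assume s: "summable (\<lambda>n. (log_node (Suc n) - log_node n) powr r)"
  have "\<forall>\<^sub>F n in sequentially. inverse (real n) \<le> (- 1 / ln (real n + 1 + 2) - (- 1 / ln (real n + 2))) powr r"
    using assms by real_asymp
  then have "\<forall>\<^sub>F n in sequentially. norm (inverse (real n)) \<le> (log_node (Suc n) - log_node n) powr r"
    by eventually_elim (simp add: log_node_def add_ac)
  then have "summable (\<lambda>n. inverse (real n))" using s by (rule summable_comparison_test_ev)
  then show False using not_summable_harmonic[where 'a = real] by simp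
qed

text \<open>Doubling gives equality for almost every time only. Continuity in
  \<open>L^1_loc\<close>, satisfied by both solutions, carries it to each fixed time along good
  times that decrease to it.\<close>

lemma entropy_solution_unique:
  fixes u :: "real \<Rightarrow> real \<Rightarrow> real"
  assumes \<beta>: "\<beta> \<in> borel_measurable borel" "\<And>s. \<bar>\<beta> s\<bar> \<le> a" "AE t in lborel. 0 < t \<longrightarrow> \<alpha> t = \<beta> t"
    and p: "0 < p" and b: "strict_mono b" "b \<longlonglongrightarrow> L" and t: "0 < t"
    and es: "entropy_solution (flux p) \<alpha> (sawtooth p b) u"
  shows "AE x in lebesgue. u x t = wave p b \<beta> (x, t)"
proof -
  define v where "v x t = wave p b \<beta> (x, t)" for x t
  have ev: "entropy_solution (flux p) \<alpha> (sawtooth p b) v"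
    unfolding v_def[abs_def] by (rule wave_entropy_solution[OF \<beta> p b])
  have t0: "0 \<le> t" using t by simp
  have int: "(\<lambda>x. y x \<tau>) absolutely_integrable_on K"
    if "entropy_solution (flux p) \<alpha> (sawtooth p b) y" "0 \<le> \<tau>" "compact K" for y \<tau> K
    using that unfolding entropy_solution_def by blast
  have cont: "((\<lambda>\<tau>. LINT x:K|lebesgue. \<bar>y x \<tau> - y x t\<bar>) \<longlongrightarrow> 0) (at t within {0..})"
    if "entropy_solution (flux p) \<alpha> (sawtooth p b) y" "compact K" for y K
    using that t0 unfolding entropy_solution_def by blast
  have "AE \<tau> in lborel. AE x in lborel. 0 < \<tau> \<and> \<tau> < t + 1 \<longrightarrow> u x \<tau> = v x \<tau>"
    using AE_sections[of "\<lambda>x \<tau>. 0 < \<tau> \<and> \<tau> < t + 1 \<longrightarrow> u x \<tau> = v x \<tau>"]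
      entropy_solution_eq_wave[OF \<beta> p b _ es, of "t + 1"] t by (simp add: v_def)
  \<comment> \<open>Good times have full measure, so each right neighbourhood of \<open>t\<close>
    contains one; the bound \<open>1 / Suc n\<close> keeps it below \<open>t + 1\<close>, where
    equality is known.\<close>
  then have "\<exists>\<tau>. t < \<tau> \<and> \<tau> < t + 1 / Suc n \<and> (AE x in lborel. 0 < \<tau> \<and> \<tau> < t + 1 \<longrightarrow> u x \<tau> = v x \<tau>)" for n
    by (rule AE_ex_in_interval) simp
  then obtain \<tau> where \<tau>: "\<And>n. t < \<tau> n" "\<And>n. \<tau> n < t + 1 / Suc n"
    "\<And>n. AE x in lborel. 0 < \<tau> n \<and> \<tau> n < t + 1 \<longrightarrow> u x (\<tau> n) = v x (\<tau> n)" by metis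
  have eq: "AE x in lebesgue. u x (\<tau> n) = v x (\<tau> n)" for n
  proof -
    have "1 / Suc n \<le> (1::real)" by simp
    then have "\<tau> n < t + 1" using \<tau>(2)[of n] by linarith
    then have "AE x in lborel. u x (\<tau> n) = v x (\<tau> n)" using \<tau>(1)[of n] \<tau>(3)[of n] t by auto
    then show ?thesis by (rule AE_completion)
  qed
  have "\<tau> \<longlonglongrightarrow> t"
  proof (rule tendsto_sandwich)
    show "\<forall>\<^sub>F n in sequentially. t \<le> \<tau> n" "\<forall>\<^sub>F n in sequentially. \<tau> n \<le> t + 1 / Suc n"
      using \<tau>(1,2) by (auto intro!: always_eventually less_imp_le)
    show "(\<lambda>n. t + 1 / Suc n) \<longlonglongrightarrow> t"
      using tendsto_add[OF tendsto_const LIMSEQ_inverse_real_of_nat, of t] by (simp add: inverse_eq_divide)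
  qed simp
  then have fl: "filterlim \<tau> (at t within {0..}) sequentially"
    unfolding filterlim_at using \<tau>(1) t by (auto intro!: always_eventually intro: less_imp_le less_trans dest: less_imp_neq)
  have K: "AE x in lebesgue. x \<in> {- real n..real n} \<longrightarrow> u x t = v x t" for n
  proof -
    let ?K = "{- real n..real n}"
    note iu = int[OF es _ compact_Icc] and iv = int[OF ev _ compact_Icc]
    have sd: "set_integrable lebesgue ?K (\<lambda>x. \<bar>y x - z x\<bar>)"
      if "y absolutely_integrable_on ?K" "z absolutely_integrable_on ?K" for y z :: "real \<Rightarrow> real"
      using that by (intro set_integrable_abs set_integral_diff)
    have \<tau>0: "0 \<le> \<tau> k" for k using \<tau>(1)[of k] t by simp
    \<comment> \<open>The solutions agree at \<open>\<tau> k\<close>, so the triangle inequality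
      through their common value leaves only the two time increments.\<close>
    have le: "(LINT x:?K|lebesgue. \<bar>u x t - v x t\<bar>)
        \<le> (LINT x:?K|lebesgue. \<bar>u x (\<tau> k) - u x t\<bar>) + (LINT x:?K|lebesgue. \<bar>v x (\<tau> k) - v x t\<bar>)" for k
    proof -
      have i: "set_integrable lebesgue ?K (\<lambda>x. \<bar>u x t - v x t\<bar>)"
        "set_integrable lebesgue ?K (\<lambda>x. \<bar>u x (\<tau> k) - u x t\<bar>)" "set_integrable lebesgue ?K (\<lambda>x. \<bar>v x (\<tau> k) - v x t\<bar>)"
        using iu[OF t0] iu[OF \<tau>0[of k]] iv[OF t0] iv[OF \<tau>0[of k]]
        by (auto intro!: sd)
      have "(LINT x:?K|lebesgue. \<bar>u x t - v x t\<bar>) \<le> (LINT x:?K|lebesgue. \<bar>u x (\<tau> k) - u x t\<bar> + \<bar>v x (\<tau> k) - v x t\<bar>)"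
        unfolding set_lebesgue_integral_def
      proof (rule integral_mono_AE)
        show "integrable lebesgue (\<lambda>x. indicator ?K x *\<^sub>R (\<bar>u x (\<tau> k) - u x t\<bar> + \<bar>v x (\<tau> k) - v x t\<bar>))"
          using set_integral_add(1)[OF i(2,3)] by (simp add: set_integrable_def)
        show "integrable lebesgue (\<lambda>x. indicator ?K x *\<^sub>R \<bar>u x t - v x t\<bar>)"
          using i(1) by (simp add: set_integrable_def)
        show "AE x in lebesgue. indicator ?K x *\<^sub>R \<bar>u x t - v x t\<bar> \<le> indicator ?K x *\<^sub>R (\<bar>u x (\<tau> k) - u x t\<bar> + \<bar>v x (\<tau> k) - v x t\<bar>)"
          using eq[of k] by (rule eventually_mono) (auto simp: indicator_def)
      qed
      also have "\<dots> = (LINT x:?K|lebesgue. \<bar>u x (\<tau> k) - u x t\<bar>) + (LINT x:?K|lebesgue. \<bar>v x (\<tau> k) - v x t\<bar>)"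
        by (rule set_integral_add(2)[OF i(2,3)])
      finally show ?thesis .
    qed
    have "(\<lambda>k. (LINT x:?K|lebesgue. \<bar>u x (\<tau> k) - u x t\<bar>) + (LINT x:?K|lebesgue. \<bar>v x (\<tau> k) - v x t\<bar>)) \<longlonglongrightarrow> 0 + 0"
      using filterlim_compose[OF cont[OF es compact_Icc] fl]
        filterlim_compose[OF cont[OF ev compact_Icc] fl] by (rule tendsto_add)
    from LIMSEQ_le_const[OF this, of "LINT x:?K|lebesgue. \<bar>u x t - v x t\<bar>"] le
    have "(LINT x:?K|lebesgue. \<bar>u x t - v x t\<bar>) \<le> 0" by auto
    moreover have "0 \<le> (LINT x:?K|lebesgue. \<bar>u x t - v x t\<bar>)"
      unfolding set_lebesgue_integral_def by (rule Bochner_Integration.integral_nonneg) simp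
    ultimately have "(LINT x:?K|lebesgue. \<bar>u x t - v x t\<bar>) = 0" by linarith
    then have "(\<integral>x. indicator ?K x *\<^sub>R \<bar>u x t - v x t\<bar> \<partial>lebesgue) = 0"
      unfolding set_lebesgue_integral_def .
    moreover have "integrable lebesgue (\<lambda>x. indicator ?K x *\<^sub>R \<bar>u x t - v x t\<bar>)"
      using sd[OF iu[OF t0] iv[OF t0]] by (simp add: set_integrable_def)
    ultimately have "AE x in lebesgue. indicator ?K x *\<^sub>R \<bar>u x t - v x t\<bar> = 0"
      by (subst (asm) integral_nonneg_eq_0_iff_AE) simp_all
    then show ?thesis by (rule eventually_mono) auto
  qed
  have "AE x in lebesgue. \<forall>n. x \<in> {- real n..real n} \<longrightarrow> u x t = v x t"
    unfolding AE_all_countable using K by blast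
  then show ?thesis
  proof (rule eventually_mono)
    fix x assume *: "\<forall>n. x \<in> {- real n..real n} \<longrightarrow> u x t = v x t"
    obtain n where "\<bar>x\<bar> \<le> real n" using real_arch_simple by blast
    then show "u x t = wave p b \<beta> (x, t)" using * by (auto simp: v_def abs_le_iff)
  qed
qed

section \<open>Borel representative of the coefficient and choice of the datum\<close>

lemma Linfty_half_line_representative:
  assumes "Linfty (lebesgue_on {0<..}) \<alpha>"
  obtains \<beta> a where "\<beta> \<in> borel_measurable borel" "\<And>s::real. \<bar>\<beta> s\<bar> \<le> a" "AE t in lborel. 0 < t \<longrightarrow> \<alpha> t = \<beta> t"
proof -
  have S: "{0::real<..} \<in> sets lebesgue" by simp
  define g where "g t = (if t \<in> {0<..} then \<alpha> t else 0)" for t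
  obtain C where C: "AE t in lebesgue_on {0<..}. \<bar>\<alpha> t\<bar> \<le> C" and m: "\<alpha> \<in> borel_measurable (lebesgue_on {0<..})"
    using assms unfolding Linfty_def by auto
  have "g \<in> borel_measurable lebesgue"
    using borel_measurable_if[OF S, of \<alpha>] m unfolding g_def by simp
  then obtain g' where g': "g' \<in> borel_measurable lborel" "AE t in lborel. g t = g' t"
    using completion_ex_borel_measurable_real by blast
  define \<beta> where "\<beta> t = max (- \<bar>C\<bar>) (min \<bar>C\<bar> (g' t))" for t
  have "AE t in lebesgue. t \<in> {0<..} \<longrightarrow> \<bar>\<alpha> t\<bar> \<le> C"
    using C S by (subst (asm) AE_restrict_space_iff) auto
  then have "AE t in lborel. t \<in> {0<..} \<longrightarrow> \<bar>\<alpha> t\<bar> \<le> C" by (simp only: AE_completion_iff)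
  with g'(2) have "AE t in lborel. 0 < t \<longrightarrow> \<alpha> t = \<beta> t"
    by eventually_elim (auto simp: g_def \<beta>_def)
  moreover have "\<beta> \<in> borel_measurable borel" unfolding \<beta>_def using g'(1) by simp
  moreover have "\<bar>\<beta> t\<bar> \<le> \<bar>C\<bar>" for t by (auto simp: \<beta>_def)
  ultimately show ?thesis using that by blast
qed

theorem theorem3p2:
  fixes p s :: real and f \<alpha> :: "real \<Rightarrow> real"
  assumes "p > 1"
    and "s = 1 / p"
    and "f = (\<lambda>v. \<bar>v\<bar> powr (1 + p) / (1 + p))"
    and "Linfty (lebesgue_on {0<..}) \<alpha>"
  shows "\<exists>u\<^sub>0. Linfty lebesgue u\<^sub>0 \<and>
    (\<exists>u. entropy_solution f \<alpha> u\<^sub>0 u) \<and>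
    (\<forall>u. entropy_solution f \<alpha> u\<^sub>0 u \<longrightarrow>
      (\<forall>t>0. \<forall>\<epsilon>>0. TV s (\<lambda>x. u x t) < \<infinity> \<and> TV (s + \<epsilon>) (\<lambda>x. u x t) = \<infinity>))"
proof -
  have p: "0 < p" and f: "f = flux p" using assms by (auto simp: flux_def)
  obtain \<beta> a where \<beta>: "\<beta> \<in> borel_measurable borel" "\<And>s. \<bar>\<beta> s\<bar> \<le> a" "AE t in lborel. 0 < t \<longrightarrow> \<alpha> t = \<beta> t"
    using Linfty_half_line_representative[OF assms(4)] by blast
  note b = strict_mono_log_node log_node_tendsto
  define u0 where "u0 = sawtooth p log_node"
  have "Linfty lebesgue u0"
    unfolding Linfty_def u0_def using abs_sawtooth_le[OF p b]
    by (auto intro!: measurable_completion exI)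
  moreover have "entropy_solution f \<alpha> u0 (\<lambda>x t. wave p log_node \<beta> (x, t))"
    unfolding f u0_def by (rule wave_entropy_solution[OF \<beta> p b])
  moreover have "TV s (\<lambda>x. u x t) < \<infinity> \<and> TV (s + \<epsilon>) (\<lambda>x. u x t) = \<infinity>"
    if u: "entropy_solution f \<alpha> u0 u" and t: "0 < t" and \<epsilon>: "0 < \<epsilon>" for u t \<epsilon>
  proof -
    have v: "AE x in lebesgue. u x t = amp p \<beta> t * sawtooth p log_node x"
      using entropy_solution_unique[OF \<beta> p b t u[unfolded f u0_def]] by (simp add: wave_def)
    \<comment> \<open>The exponent of the gaps is \<open>1 / (1 + p * \<epsilon>)\<close>, below one
      for every positive \<epsilon>, so the same nodes serve all of them.\<close>
    have r: "p * (s + \<epsilon>) = 1 + p * \<epsilon>" using assms(2) p by (simp add: field_simps)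
    have "1 < p * (s + \<epsilon>)" unfolding r using p \<epsilon> by simp
    then have "\<not> summable (\<lambda>n. (log_node (Suc n) - log_node n) powr (1 / (p * (s + \<epsilon>))))"
      by (intro log_node_gaps_not_summable) auto
    moreover have "0 < s + \<epsilon>" using assms(2) p \<epsilon> by (simp add: add_pos_pos)
    ultimately show ?thesis
      using TV_sawtooth_finite[OF _ b v] TV_sawtooth_infinite[OF p b amp_pos _ v, of "s + \<epsilon>"] assms(1,2) by simp
  qed
  ultimately show ?thesis by blast
qed

end
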